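(* In the setting of the context, assume that $(V_n)$ has a finite moment of order $4$. Then $$\sqrt{n}\,\bigl(\widehat{\theta}_n-\theta^{*}\bigr)\xrightarrow{\ \mathcal{L}\ }\mathcal{N}(0,\Sigma_\theta)$$ (convergence in distribution), where $\theta^{*}=\alpha(I_p-\theta_p\rho J_p)\beta$ and $$\Sigma_\theta=\alpha^2\,(I_p-\theta_p\rho J_p)\,\Delta_p^{-1}\,(I_p-\theta_p\rho J_p).$$
   Context: Let $p\ge 1$ be an integer, $\theta=(\theta_1,\dots,\theta_p)'\in\mathbb{R}^p$ a nonzero vector with $\|\theta\|_1=\sum_i|\theta_i|<1$ and $\rho\in\mathbb{R}$ with $|\rho|<1$. A prime denotes transposition. The process is given, for all $n\ge1$, by $$X_n=\theta_1X_{n-1}+\cdots+\theta_pX_{n-p}+\varepsilon_n,\qquad \varepsilon_n=\rho\,\varepsilon_{n-1}+V_n,$$ with square-integrable initial value $X_0=\varepsilon_0$ and $X_{-1}=\cdots=X_{-p}=0$, where $(V_n)$ is a sequence of square-integrable, independent and identically distributed random variables with zero mean and variance $\sigma^2>0$. Let $\Phi_n^p=(X_n,X_{n-1},\dots,X_{n-p+1})'$ and $S_n=\sum_{k=0}^n\Phi_k^p(\Phi_k^p)'+S$, where $S$ is a fixed symmetric positive definite $p\times p$ matrix. The least squares estimator is $\widehat{\theta}_n=(S_{n-1})^{-1}\sum_{k=1}^n\Phi_{k-1}^pX_k$, $n\ge1$. $I_p$ is the identity matrix and $J_p$ the exchange matrix of order $p$ (ones on the antidiagonal, zeros elsewhere).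 Put $$\alpha=\frac{1}{(1-\theta_p\rho)(1+\theta_p\rho)},\qquad \beta=(\beta_1,\dots,\beta_p)'=(\theta_1+\rho,\ \theta_2-\theta_1\rho,\ \dots,\ \theta_p-\theta_{p-1}\rho)'.$$ Set $a_0=1$, $a_i=-\beta_i$ for $1\le i\le p$, $a_{p+1}=\theta_p\rho$, and $a_i=0$ for all other integers $i$. Let $B$ be the square matrix of order $p+2$ with rows and columns indexed by $0,\dots,p+1$ and entries $B_{d,0}=a_d$ and $B_{d,j}=a_{d-j}+a_{d+j}$ for $1\le j\le p+1$. Under the stability conditions $\|\theta\|_1<1$ and $|\rho|<1$, $B$ is invertible; let $\Lambda=(\lambda_0,\dots,\lambda_{p+1})'$ be the unique solution of $B\Lambda=(1,0,\dots,0)'$. Then $\Delta_p=(\lambda_{|i-j|})_{1\le i,j\le p}$, a symmetric Toeplitz matrix (it is positive definite). *)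

theory Defs
  imports "HOL-Probability.Probability"
begin

text \<open>
  The dimension is \<open>p = CARD('p)\<close>. The order on \<open>'p\<close> enumerates the
  coordinates as \<open>1, \<dots>, p\<close>: \<open>idx\<close> is the unique increasing bijection from \<open>'p\<close> onto
  \<open>{1..p}\<close>, and \<open>coord v k\<close> is \<open>v\<^sub>k\<close>.
\<close>

definition idx :: "'p::{finite,linorder} \<Rightarrow> nat" where
  "idx i = card {j. j \<le> i}"

definition coord :: "real ^ 'p::{finite,linorder} \<Rightarrow> nat \<Rightarrow> real" where
  "coord v k = v $ the_inv idx k"

lemma bij_betw_idx: "bij_betw (idx :: 'p::{finite,linorder} \<Rightarrow> nat) UNIV {1..CARD('p)}"
proof -
  have less: "idx i < idx j" if "i < j" for i j :: 'p
    unfolding idx_def using that by (intro psubset_card_mono) (auto dest: less_le_trans)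
  have inj: "inj (idx :: 'p \<Rightarrow> nat)"
    by (rule injI) (metis less less_irrefl neqE)
  have "range (idx :: 'p \<Rightarrow> nat) \<subseteq> {1..CARD('p)}"
  proof (intro image_subsetI)
    fix i :: 'p
    have "{j. j \<le> i} \<noteq> {}" by auto
    then show "idx i \<in> {1..CARD('p)}"
      by (simp add: idx_def Suc_le_eq card_gt_0_iff card_mono)
  qed
  moreover have "card (range (idx :: 'p \<Rightarrow> nat)) = card {1..CARD('p)}"
    using inj by (simp add: card_image)
  ultimately have "range (idx :: 'p \<Rightarrow> nat) = {1..CARD('p)}"
    by (intro card_subset_eq) auto
  with inj show ?thesis by (simp add: bij_betw_def)
qed

lemma coord_idx: "coord v (idx i) = v $ i"
  unfolding coord_def using bij_betw_idx by (metis bij_betw_imp_inj_on the_inv_f_f)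

definition outer :: "real ^ 'p \<Rightarrow> real ^ 'p \<Rightarrow> real ^ 'p ^ 'p" where
  "outer u v = (\<chi> i j. u $ i * v $ j)"

definition pos_def :: "real ^ 'p ^ 'p \<Rightarrow> bool" where
  "pos_def A \<longleftrightarrow> transpose A = A \<and> (\<forall>x. x \<noteq> 0 \<longrightarrow> 0 < x \<bullet> (A *v x))"

definition exchange_mat :: "real ^ 'p::{finite,linorder} ^ 'p::{finite,linorder}" where
  "exchange_mat = (\<chi> i j. if idx i + idx j = CARD('p) + 1 then 1 else 0)"


subsection \<open>The least squares estimator\<close>

text \<open>Processes are indexed by \<open>int\<close> so that the initial values \<open>X\<^sub>-\<^sub>1, \<dots>, X\<^sub>-\<^sub>p\<close> make sense.\<close>

definition Phi :: "(int \<Rightarrow> 'a \<Rightarrow> real) \<Rightarrow> nat \<Rightarrow> 'a \<Rightarrow> real ^ 'p::{finite,linorder}" where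
  "Phi X n \<omega> = (\<chi> i. X (int n + 1 - int (idx i)) \<omega>)"

definition S_mat ::
  "(int \<Rightarrow> 'a \<Rightarrow> real) \<Rightarrow> real ^ 'p::{finite,linorder} ^ 'p::{finite,linorder}
    \<Rightarrow> nat \<Rightarrow> 'a \<Rightarrow> real ^ 'p::{finite,linorder} ^ 'p::{finite,linorder}" where
  "S_mat X S n \<omega> = (\<Sum>k=0..n. outer (Phi X k \<omega>) (Phi X k \<omega>)) + S"

text \<open>Only the values at \<open>n \<ge> 1\<close> are meaningful.\<close>

definition theta_hat ::
  "(int \<Rightarrow> 'a \<Rightarrow> real) \<Rightarrow> real ^ 'p::{finite,linorder} ^ 'p::{finite,linorder}
    \<Rightarrow> nat \<Rightarrow> 'a \<Rightarrow> real ^ 'p::{finite,linorder}" where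
  "theta_hat X S n \<omega> =
     matrix_inv (S_mat X S (n - 1) \<omega>) *v (\<Sum>k=1..n. X (int k) \<omega> *\<^sub>R Phi X (k - 1) \<omega>)"


subsection \<open>The limiting value and the limiting covariance\<close>

definition theta_last :: "real ^ 'p::{finite,linorder} \<Rightarrow> real" where
  "theta_last \<theta> = coord \<theta> CARD('p)"

definition alpha :: "real ^ 'p::{finite,linorder} \<Rightarrow> real \<Rightarrow> real" where
  "alpha \<theta> \<rho> = 1 / ((1 - theta_last \<theta> * \<rho>) * (1 + theta_last \<theta> * \<rho>))"

definition beta :: "real ^ 'p::{finite,linorder} \<Rightarrow> real \<Rightarrow> real ^ 'p::{finite,linorder}" where
  "beta \<theta> \<rho> = (\<chi> i. if idx i = 1 then \<theta> $ i + \<rho> else \<theta> $ i - coord \<theta> (idx i - 1) * \<rho>)"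

definition a_coeff :: "real ^ 'p::{finite,linorder} \<Rightarrow> real \<Rightarrow> int \<Rightarrow> real" where
  "a_coeff \<theta> \<rho> d =
     (if d = 0 then 1
      else if 1 \<le> d \<and> d \<le> int CARD('p) then - coord (beta \<theta> \<rho>) (nat d)
      else if d = int CARD('p) + 1 then theta_last \<theta> * \<rho>
      else 0)"

text \<open>
  The order \<open>p + 2\<close> is not the cardinality of an index type at hand, so \<open>B\<close> and
  \<open>\<Lambda>\<close> are functions on \<open>nat\<close> restricted to \<open>{0..p+1}\<close>; \<open>\<Lambda>\<close> is set to \<open>0\<close> elsewhere,
  which makes the solution unique as a function exactly when it is unique as a vector.
\<close>

definition B_entry :: "real ^ 'p::{finite,linorder} \<Rightarrow> real \<Rightarrow> nat \<Rightarrow> nat \<Rightarrow> real" where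
  "B_entry \<theta> \<rho> d j =
     (if j = 0 then a_coeff \<theta> \<rho> (int d)
      else a_coeff \<theta> \<rho> (int d - int j) + a_coeff \<theta> \<rho> (int d + int j))"

definition Lambda :: "real ^ 'p::{finite,linorder} \<Rightarrow> real \<Rightarrow> nat \<Rightarrow> real" where
  "Lambda \<theta> \<rho> = (THE L.
     (\<forall>d\<in>{0..CARD('p) + 1}.
        (\<Sum>j=0..CARD('p) + 1. B_entry \<theta> \<rho> d j * L j) = (if d = 0 then 1 else 0)) \<and>
     (\<forall>j. j > CARD('p) + 1 \<longrightarrow> L j = 0))"

definition Delta :: "real ^ 'p::{finite,linorder} \<Rightarrow> real \<Rightarrow> real ^ 'p::{finite,linorder} ^ 'p::{finite,linorder}" where
  "Delta \<theta> \<rho> = (\<chi> i j. Lambda \<theta> \<rho> (nat \<bar>int (idx i) - int (idx j)\<bar>))"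

definition theta_star :: "real ^ 'p::{finite,linorder} \<Rightarrow> real \<Rightarrow> real ^ 'p::{finite,linorder}" where
  "theta_star \<theta> \<rho> =
     alpha \<theta> \<rho> *\<^sub>R ((mat 1 - (theta_last \<theta> * \<rho>) *\<^sub>R exchange_mat) *v beta \<theta> \<rho>)"

definition Sigma_theta :: "real ^ 'p::{finite,linorder} \<Rightarrow> real \<Rightarrow> real ^ 'p::{finite,linorder} ^ 'p::{finite,linorder}" where
  "Sigma_theta \<theta> \<rho> =
     (alpha \<theta> \<rho>)\<^sup>2 *\<^sub>R
       ((mat 1 - (theta_last \<theta> * \<rho>) *\<^sub>R exchange_mat) **
        matrix_inv (Delta \<theta> \<rho>) **
        (mat 1 - (theta_last \<theta> * \<rho>) *\<^sub>R exchange_mat))"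


subsection \<open>Multivariate normal law and convergence in distribution\<close>

text \<open>The density of \<open>N(\<mu>, \<Sigma>)\<close>; meaningful for positive definite \<open>\<Sigma>\<close>.\<close>

definition mvn :: "real ^ 'p \<Rightarrow> real ^ 'p ^ 'p \<Rightarrow> (real ^ 'p) measure" where
  "mvn \<mu> \<Sigma> = density lborel (\<lambda>x. ennreal
     (exp (- ((x - \<mu>) \<bullet> (matrix_inv \<Sigma> *v (x - \<mu>))) / 2) / sqrt ((2 * pi) ^ CARD('p) * det \<Sigma>)))"

text \<open>
  Weak convergence of the laws of \<open>Y n\<close>, tested on bounded continuous functions. The
  measurability and probability conjuncts make sure that the Bochner integrals are
  genuine expectations, not default values.
\<close>

definition converges_in_distribution ::
  "'a measure \<Rightarrow> (nat \<Rightarrow> 'a \<Rightarrow> 'b::topological_space) \<Rightarrow> 'b measure \<Rightarrow> bool" where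
  "converges_in_distribution M Y N \<longleftrightarrow>
     (\<forall>n. Y n \<in> measurable M borel) \<and> prob_space N \<and> sets N = sets borel \<and>
     (\<forall>f::'b \<Rightarrow> real. continuous_on UNIV f \<and> bounded (range f) \<longrightarrow>
        (\<lambda>n. \<integral>\<omega>. f (Y n \<omega>) \<partial>M) \<longlonglongrightarrow> (\<integral>x. f x \<partial>N))"

end

theory Submission
  imports Defs "HOL-Computational_Algebra.Formal_Power_Series"
begin

text \<open>
  The recursion is an AR(\<open>p + 1\<close>) recursion \<open>\<Sum>\<^sub>l a\<^sub>l X\<^sub>k\<^sub>-\<^sub>l = V\<^sub>k\<close> with \<open>a\<close> the coefficients of
  \<open>(1 - \<rho> z)(1 - \<Sum> \<theta>\<^sub>i z\<^sup>i)\<close>, whose impulse response \<open>c\<close> is summable. Hence \<open>X\<^sub>k = U\<^sub>k + c\<^sub>k \<epsilon>\<^sub>0\<close> with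
  \<open>U\<close> a linear function of the noise, and the contribution of \<open>\<epsilon>\<^sub>0\<close> is negligible. Multiplying the recursion by \<open>U\<^sub>k\<^sub>-\<^sub>d\<close> and summing over \<open>k\<close> gives the Yule-Walker system
  \<open>B r = N\<close> for the empirical covariances \<open>r\<close>, up to boundary terms; here \<open>N\<^sub>d = \<Sum>\<^sub>k V\<^sub>k U\<^sub>k\<^sub>-\<^sub>d\<close> is a
  martingale for \<open>d \<ge> 1\<close>. Since \<open>N / n\<close> tends to \<open>\<sigma>\<^sup>2 e\<^sub>0\<close> and \<open>B\<close> is invertible, \<open>r / n\<close> tends to
  \<open>\<sigma>\<^sup>2 \<Lambda>\<close>. Reflecting the rows \<open>1, \<dots>, p\<close> of the same system by \<open>J\<close> shows that
  \<open>S\<^sub>n\<^sub>-\<^sub>1 (\<theta>\<^sub>n - \<theta>\<^sup>*) = \<alpha> (I - \<theta>\<^sub>p \<rho> J) N\<close> up to boundary terms. A central limit theorem for the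
  martingales \<open>w \<bullet> N\<close> and the continuity theorem for characteristic functions finish the proof.
\<close>

section \<open>Characteristic functions and weak convergence\<close>

text \<open>Nothing links \<open>\<epsilon>\<^sub>0\<close> to the noise, so \<open>X\<close> itself
  cannot serve as an adapted process for which each \<open>V\<^sub>k\<close> is independent of the
  past. The martingale arguments therefore run on \<open>U\<close>, which depends on the noise
  alone, and the share of \<open>\<epsilon>\<^sub>0\<close> is bounded by second moments and the
  summability of \<open>c\<close>. Since \<Lambda> is a definite description, uniqueness for the
  system \<open>B\<close> is part of the proof: a homogeneous solution extends to an even sequence
  on the integers that solves the recursion everywhere, is bounded, and hence vanishes by stability.
  The matrix \<open>J\<close> enters through
  \<open>a\<^sub>p\<^sub>+\<^sub>1 = \<theta>\<^sub>p \<rho>\<close>, which puts the lag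
  \<open>p + 1 - d\<close> into row \<open>d\<close>; eliminating it against row
  \<open>p + 1 - d\<close> produces \<alpha>. \<open>J\<close> commutes with the symmetric Toeplitz
  matrix \<Delta>, which gives the covariance its stated form. The noise variance cancels: the
  limiting covariance of \<open>N / sqrt n\<close> is its square times \<Delta>, and the
  normalisation divides by it twice.\<close>

lemma borel_measurable_cis[measurable]: "cis \<in> borel_measurable borel"
  unfolding cis_conv_exp[abs_def] by measurable

text \<open>The functions whose integrals are finite linear combinations of values of the
  characteristic function. They form an algebra because a product of two characters is a
  character.\<close>

inductive trig_poly :: "('a::real_inner \<Rightarrow> complex) \<Rightarrow> bool" where
  trig_poly_cis: "trig_poly (\<lambda>x. c * cis (u \<bullet> x))"
| trig_poly_add: "trig_poly f \<Longrightarrow> trig_poly g \<Longrightarrow> trig_poly (\<lambda>x. f x + g x)"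

lemma trig_poly_mult:
  assumes "trig_poly f" "trig_poly g"
  shows "trig_poly (\<lambda>x. f x * g x)"
  using assms
proof (induction f rule: trig_poly.induct)
  case (trig_poly_cis c u)
  from trig_poly_cis show ?case
  proof (induction g rule: trig_poly.induct)
    case (trig_poly_cis c' u')
    have "(\<lambda>x. c * cis (u \<bullet> x) * (c' * cis (u' \<bullet> x))) = (\<lambda>x. (c * c') * cis ((u + u') \<bullet> x))"
      by (simp add: fun_eq_iff inner_add_left cis_mult[symmetric])
    then show ?case by (simp only:) (rule trig_poly.intros)
  next
    case (trig_poly_add f g)
    then show ?case by (simp add: distrib_left trig_poly.trig_poly_add)
  qed
next
  case (trig_poly_add f g)
  then show ?case by (simp add: distrib_right trig_poly.trig_poly_add)
qed

lemma trig_poly_const: "trig_poly (\<lambda>x. c)"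
  using trig_poly_cis[of c 0] by simp

lemma trig_poly_sum: "finite I \<Longrightarrow> (\<And>i. i \<in> I \<Longrightarrow> trig_poly (f i)) \<Longrightarrow> trig_poly (\<lambda>x. \<Sum>i\<in>I. f i x)"
  by (induction I rule: finite_induct) (auto intro: trig_poly_const trig_poly_add)

lemma trig_poly_sin: "trig_poly (\<lambda>x. of_real (sin (u \<bullet> x)))"
proof -
  have "(\<lambda>x. of_real (sin (u \<bullet> x))) = (\<lambda>x. (1 / (2 * \<i>)) * cis (u \<bullet> x) + (- (1 / (2 * \<i>))) * cis ((-u) \<bullet> x))"
    by (auto simp: fun_eq_iff complex_eq_iff)
  then show ?thesis by (simp only:) (intro trig_poly.intros)
qed

lemma trig_poly_real_polynomial_sin:
  fixes P :: "'a::euclidean_space \<Rightarrow> real"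
  assumes "real_polynomial_function P"
  shows "trig_poly (\<lambda>x. of_real (P (\<Sum>b\<in>Basis. sin (x \<bullet> b / L) *\<^sub>R b)))"
  using assms
proof (induction P rule: real_polynomial_function.induct)
  case (linear f)
  then interpret f: bounded_linear f .
  have "(\<lambda>x. complex_of_real (f (\<Sum>b\<in>Basis. sin (x \<bullet> b / L) *\<^sub>R b)))
      = (\<lambda>x. \<Sum>b\<in>Basis. of_real (f b) * of_real (sin ((b /\<^sub>R L) \<bullet> x)))"
    by (auto simp: fun_eq_iff f.sum f.scaleR inner_commute divide_inverse mult.commute)
  then show ?case
    by (simp only:) (intro trig_poly_sum trig_poly_mult trig_poly_const trig_poly_sin finite_Basis)
qed (auto intro: trig_poly_const trig_poly_add trig_poly_mult)

lemma trig_poly_cont_bounded: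
  fixes g :: "'a::euclidean_space \<Rightarrow> complex"
  assumes "trig_poly g"
  shows "continuous_on UNIV g \<and> (\<exists>B. \<forall>x. norm (g x) \<le> B)"
  using assms
proof induction
  case (trig_poly_cis c u)
  have "norm (c * cis (u \<bullet> x)) \<le> norm c" for x by (simp add: norm_mult)
  moreover have "continuous_on UNIV (\<lambda>x. c * cis (u \<bullet> x))"
    by (auto simp: cis_conv_exp intro!: continuous_intros)
  ultimately show ?case by blast
next
  case (trig_poly_add f g)
  then obtain B C where "\<And>x. norm (f x) \<le> B" "\<And>x. norm (g x) \<le> C" by blast
  then have "norm (f x + g x) \<le> B + C" for x by (meson add_mono norm_triangle_ineq order_trans)
  then show ?case using trig_poly_add by (auto intro!: continuous_intros)
qed

lemma (in prob_space) integrable_cont_bounded: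
  fixes g :: "'b::{second_countable_topology,banach} \<Rightarrow> 'c::{second_countable_topology,banach}"
  assumes "continuous_on UNIV g" "\<And>x. norm (g x) \<le> B" "Y \<in> borel_measurable M"
  shows "integrable M (\<lambda>\<omega>. g (Y \<omega>))"
  using assms borel_measurable_continuous_onI[OF assms(1)]
  by (intro integrable_const_bound[where B=B] AE_I2) (auto intro: measurable_compose)

text \<open>
  Composing \<open>f\<close> with the arcsine moves the approximation problem to the cube \<open>[-1, 1]\<^sup>d\<close>, so the
  Weierstrass polynomial becomes, after substitution of sines, a trigonometric polynomial with
  the same bound as \<open>f\<close> on the whole space.
\<close>
lemma trig_poly_approx:
  fixes f :: "'a::euclidean_space \<Rightarrow> real"
  assumes f: "continuous_on UNIV f" and B: "\<And>x. \<bar>f x\<bar> \<le> B" and e: "e > 0"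
  obtains g where "trig_poly (\<lambda>x. of_real (g x))" "\<And>x. norm x \<le> R \<Longrightarrow> \<bar>f x - g x\<bar> \<le> e"
    "\<And>x. \<bar>g x\<bar> \<le> B + e"
proof -
  \<comment> \<open>The cube of half-side \<open>L\<close> contains the ball of radius
    \<open>R\<close>, and on that ball \<open>x \<bullet> b / L\<close> stays in [-1, 1], well
    inside the range where \<open>arcsin\<close> inverts \<open>sin\<close>.\<close>
  define L where "L = \<bar>R\<bar> + 1"
  have L: "L > 0" by (auto simp: L_def)
  define K where "K s = (\<Sum>b\<in>Basis. (L * arcsin (s \<bullet> b)) *\<^sub>R b)" for s :: 'a
  define sv where "sv x = (\<Sum>b\<in>Basis. sin (x \<bullet> b / L) *\<^sub>R b)" for x :: 'a
  have K: "continuous_on (cbox (-One) (One::'a)) K"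
    unfolding K_def
    by (intro continuous_intros continuous_on_arcsin) (auto simp: mem_box)
  have "continuous_on (cbox (-One) (One::'a)) (\<lambda>s. f (K s))"
    using continuous_on_compose2[OF f K] by auto
  from Stone_Weierstrass_real_polynomial_function[OF compact_cbox this e]
  obtain P where P: "real_polynomial_function P"
      "\<And>s. s \<in> cbox (-One) One \<Longrightarrow> \<bar>f (K s) - P s\<bar> < e" by auto
  have sv: "sv x \<in> cbox (-One) One" for x
    by (auto simp: mem_box sv_def inner_sum_left inner_Basis if_distrib cong: if_cong)
  have Ksv: "K (sv x) = x" if x: "norm x \<le> R" for x
  proof -
    have "L * arcsin (sv x \<bullet> b) = x \<bullet> b" if b: "b \<in> Basis" for b
    proof -
      have 1: "sv x \<bullet> b = sin (x \<bullet> b / L)"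
        using b by (auto simp: sv_def inner_sum_left inner_Basis if_distrib cong: if_cong)
      have "\<bar>x \<bullet> b\<bar> \<le> L" using Basis_le_norm[OF b, of x] x by (auto simp: L_def)
      then have "\<bar>x \<bullet> b / L\<bar> \<le> 1" using L by auto
      moreover have "1 < pi / 2" using pi_gt3 by auto
      ultimately have "- (pi/2) \<le> x \<bullet> b / L" "x \<bullet> b / L \<le> pi / 2" by linarith+
      then have "arcsin (sin (x \<bullet> b / L)) = x \<bullet> b / L" by (rule arcsin_sin)
      then show ?thesis using L by (simp add: 1)
    qed
    then have "K (sv x) = (\<Sum>b\<in>Basis. (x \<bullet> b) *\<^sub>R b)" by (simp add: K_def)
    then show ?thesis by (simp add: euclidean_representation)
  qed
  show ?thesis
  proof (rule that[of "\<lambda>x. P (sv x)"])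
    show "trig_poly (\<lambda>x. complex_of_real (P (sv x)))"
      unfolding sv_def by (rule trig_poly_real_polynomial_sin[OF P(1)])
    show "\<bar>f x - P (sv x)\<bar> \<le> e" if "norm x \<le> R" for x
      using P(2)[OF sv, of x] Ksv[OF that] by auto
    show "\<bar>P (sv x)\<bar> \<le> B + e" for x
      using P(2)[OF sv, of x] B[of "K (sv x)"] by auto
  qed
qed

text \<open>Inside the ball the integrands differ by at most \<open>e\<close>, outside it by at most
  the sum of the two bounds, \<open>2 * B + e\<close>.\<close>

lemma (in prob_space) expectation_diff_le_tail:
  fixes f g :: "'b::euclidean_space \<Rightarrow> real"
  assumes "continuous_on UNIV f" "continuous_on UNIV g"
    and fB: "\<And>x. \<bar>f x\<bar> \<le> B" and gB: "\<And>x. \<bar>g x\<bar> \<le> B + e"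
    and fg: "\<And>x. norm x \<le> R \<Longrightarrow> \<bar>f x - g x\<bar> \<le> e"
    and [measurable]: "Y \<in> borel_measurable M" and e: "e > 0"
  shows "\<bar>expectation (\<lambda>\<omega>. f (Y \<omega>)) - expectation (\<lambda>\<omega>. g (Y \<omega>))\<bar>
    \<le> e + (2 * B + e) * prob {\<omega>\<in>space M. norm (Y \<omega>) > R}"
proof -
  have int: "integrable M (\<lambda>\<omega>. f (Y \<omega>))" "integrable M (\<lambda>\<omega>. g (Y \<omega>))"
    using integrable_cont_bounded[OF assms(1) _ assms(6)] integrable_cont_bounded[OF assms(2) _ assms(6)] fB gB
    by auto
  let ?A = "{\<omega>\<in>space M. norm (Y \<omega>) > R}"
  have A: "?A \<in> events" by measurable
  have "\<bar>expectation (\<lambda>\<omega>. f (Y \<omega>)) - expectation (\<lambda>\<omega>. g (Y \<omega>))\<bar>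
      \<le> expectation (\<lambda>\<omega>. \<bar>f (Y \<omega>) - g (Y \<omega>)\<bar>)"
    using integral_abs_bound[of M "\<lambda>\<omega>. f (Y \<omega>) - g (Y \<omega>)"] int by simp
  also have "\<dots> \<le> expectation (\<lambda>\<omega>. e + (2 * B + e) * indicator ?A \<omega>)"
  proof (rule integral_mono)
    show "integrable M (\<lambda>\<omega>. \<bar>f (Y \<omega>) - g (Y \<omega>)\<bar>)" using int by auto
    show "integrable M (\<lambda>\<omega>. e + (2 * B + e) * indicator ?A \<omega>)"
      using A by (auto simp: emeasure_eq_measure)
    show "\<bar>f (Y \<omega>) - g (Y \<omega>)\<bar> \<le> e + (2 * B + e) * indicator ?A \<omega>" if "\<omega> \<in> space M" for \<omega>
      using fg[of "Y \<omega>"] fB[of "Y \<omega>"] gB[of "Y \<omega>"] that e by (auto simp: indicator_def)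
  qed
  also have "\<dots> = e + (2 * B + e) * prob ?A"
    using A by (subst Bochner_Integration.integral_add) (auto simp: prob_space emeasure_eq_measure)
  finally show ?thesis .
qed

lemma trig_poly_expectation_tendsto:
  fixes Y :: "nat \<Rightarrow> 'a \<Rightarrow> 'b::euclidean_space"
  assumes M: "prob_space M" and N: "prob_space N" "sets N = sets borel"
    and Y: "\<And>n. Y n \<in> borel_measurable M"
    and char: "\<And>u. (\<lambda>n. \<integral>\<omega>. cis (u \<bullet> Y n \<omega>) \<partial>M) \<longlonglongrightarrow> (\<integral>x. cis (u \<bullet> x) \<partial>N)"
    and g: "trig_poly g"
  shows "(\<lambda>n. \<integral>\<omega>. g (Y n \<omega>) \<partial>M) \<longlonglongrightarrow> (\<integral>x. g x \<partial>N)"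
  using g
proof induction
  case (trig_poly_cis c u)
  then show ?case using tendsto_mult[OF tendsto_const char[of u], of c] by simp
next
  case (trig_poly_add f g)
  interpret M: prob_space M by fact
  interpret N: prob_space N by fact
  have id: "(\<lambda>x. x) \<in> borel_measurable N" using N(2) by (simp add: measurable_ident_sets)
  from trig_poly_cont_bounded[OF trig_poly_add.hyps(1)] trig_poly_cont_bounded[OF trig_poly_add.hyps(2)]
  obtain B C where *: "continuous_on UNIV f" "\<And>x. norm (f x) \<le> B"
    "continuous_on UNIV g" "\<And>x. norm (g x) \<le> C" by blast
  have "integrable M (\<lambda>\<omega>. f (Y n \<omega>))" "integrable M (\<lambda>\<omega>. g (Y n \<omega>))" for n
    using * Y by (auto intro: M.integrable_cont_bounded)
  moreover have "integrable N f" "integrable N g"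
    using N.integrable_cont_bounded[OF *(1,2) id] N.integrable_cont_bounded[OF *(3,4) id] by auto
  ultimately show ?case using tendsto_add[OF trig_poly_add.IH] by simp
qed

text \<open>\<open>f\<close> is replaced by a trigonometric polynomial that is close to it on a
  large ball and has nearly the same global bound; tightness makes the mass outside the ball
  harmless. Tightness is a hypothesis because for the estimator it follows directly from a first
  moment bound.\<close>

theorem levy_continuity_tight:
  fixes Y :: "nat \<Rightarrow> 'a \<Rightarrow> 'b::euclidean_space" and f :: "'b \<Rightarrow> real"
  assumes M: "prob_space M" and N: "prob_space N" "sets N = sets borel"
    and Y[measurable]: "\<And>n. Y n \<in> borel_measurable M"
    and char: "\<And>u. (\<lambda>n. \<integral>\<omega>. cis (u \<bullet> Y n \<omega>) \<partial>M) \<longlonglongrightarrow> (\<integral>x. cis (u \<bullet> x) \<partial>N)"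
    and tight: "\<And>e. e > 0 \<Longrightarrow> \<exists>R. eventually (\<lambda>n. measure M {\<omega>\<in>space M. norm (Y n \<omega>) > R} < e) sequentially"
    and f: "continuous_on UNIV f" "bounded (range f)"
  shows "(\<lambda>n. \<integral>\<omega>. f (Y n \<omega>) \<partial>M) \<longlonglongrightarrow> (\<integral>x. f x \<partial>N)"
proof (rule tendstoI)
  fix e0 :: real assume e0: "e0 > 0"
  interpret M: prob_space M by fact
  interpret N: prob_space N by fact
  from f(2) obtain B0 where "\<And>x. \<bar>f x\<bar> \<le> B0" unfolding bounded_iff by auto
  then obtain B where B: "\<And>x. \<bar>f x\<bar> \<le> B" "B > 0"
    by (metis less_max_iff_disj max.coboundedI1 max.commute zero_less_one)
  \<comment> \<open>With e \<le> 1, replacing \<open>f\<close> by \<open>g\<close> costs at most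
    \<open>e + (2 * B + e) * e\<close>, hence at most \<open>e * (2 + 2 * B)\<close> and
    \<open>e0 / 4\<close>. Two replacements and the convergence for \<open>g\<close> use three
    quarters of \<open>e0\<close>.\<close>
  define e where "e = min 1 (e0 / (4 * (2 + 2 * B)))"
  have e: "e > 0" "e \<le> 1" using e0 B by (auto simp: e_def)
  have eB: "e * (2 + 2 * B) \<le> e0 / 4"
  proof -
    have "e \<le> e0 / (4 * (2 + 2 * B))" by (simp add: e_def)
    then show ?thesis using B by (simp add: field_simps)
  qed
  have idN[measurable]: "(\<lambda>x. x) \<in> borel_measurable N" using N(2) by (simp add: measurable_ident_sets)
  obtain R1 where R1: "eventually (\<lambda>n. measure M {\<omega>\<in>space M. norm (Y n \<omega>) > R1} < e) sequentially"
    using tight[OF e(1)] by blast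
  have "(\<lambda>n. N.prob {x\<in>space N. norm x > real n}) \<longlonglongrightarrow> N.prob (\<Inter>n. {x\<in>space N. norm x > real n})"
    by (intro N.finite_Lim_measure_decseq) (auto simp: decseq_def)
  moreover have "(\<Inter>n. {x\<in>space N. norm x > real n}) = {}"
    by (auto simp: not_less) (meson real_arch_simple not_less)
  ultimately have "(\<lambda>n. N.prob {x\<in>space N. norm x > real n}) \<longlonglongrightarrow> 0" by (metis measure_empty)
  then have "eventually (\<lambda>n. N.prob {x\<in>space N. norm x > real n} < e) sequentially"
    using e(1) by (rule order_tendstoD(2))
  then obtain R2 where R2: "N.prob {x\<in>space N. norm x > real R2} < e"
    using eventually_happens'[OF sequentially_bot] by blast
  define R where "R = max R1 (real R2)"
  obtain g where g: "trig_poly (\<lambda>x. of_real (g x))" "\<And>x. norm x \<le> R \<Longrightarrow> \<bar>f x - g x\<bar> \<le> e"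
    "\<And>x. \<bar>g x\<bar> \<le> B + e"
    using trig_poly_approx[OF f(1) B(1) e(1), of R] by blast
  have "continuous_on UNIV (\<lambda>x. Re (complex_of_real (g x)))"
    using trig_poly_cont_bounded[OF g(1)] by (intro continuous_intros) auto
  then have gc: "continuous_on UNIV g" by simp
  have "(\<lambda>n. \<integral>\<omega>. complex_of_real (g (Y n \<omega>)) \<partial>M) \<longlonglongrightarrow> (\<integral>x. complex_of_real (g x) \<partial>N)"
    by (rule trig_poly_expectation_tendsto[OF M N Y char g(1)])
  then have "(\<lambda>n. \<integral>\<omega>. g (Y n \<omega>) \<partial>M) \<longlonglongrightarrow> (\<integral>x. g x \<partial>N)"
    by (simp add: tendsto_of_real_iff)
  then have ev1: "eventually (\<lambda>n. dist (\<integral>\<omega>. g (Y n \<omega>) \<partial>M) (\<integral>x. g x \<partial>N) < e0 / 4) sequentially"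
    by (rule tendstoD) (use e0 in auto)
  have "N.prob {x\<in>space N. norm x > R} \<le> N.prob {x\<in>space N. norm x > real R2}"
    by (intro N.finite_measure_mono) (auto simp: R_def)
  then have PN: "N.prob {x\<in>space N. norm x > R} \<le> e" using R2 by simp
  have bound: "e + (2 * B + e) * q \<le> e0 / 4" if "q \<le> e" for q
  proof -
    have "(2 * B + e) * q \<le> (2 * B + 1) * e"
      using that B e by (smt (verit) mult_left_mono mult_right_mono)
    then show ?thesis using eB by (simp add: algebra_simps)
  qed
  have dN: "\<bar>(\<integral>x. f x \<partial>N) - (\<integral>x. g x \<partial>N)\<bar> \<le> e0 / 4"
    by (rule order_trans[OF N.expectation_diff_le_tail[OF f(1) gc B(1) g(3,2) idN e(1)] bound[OF PN]])
  show "eventually (\<lambda>n. dist (\<integral>\<omega>. f (Y n \<omega>) \<partial>M) (\<integral>x. f x \<partial>N) < e0) sequentially"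
    using ev1 R1
  proof eventually_elim
    case (elim n)
    have "M.prob {x\<in>space M. norm (Y n x) > R} \<le> M.prob {x\<in>space M. norm (Y n x) > R1}"
      by (intro M.finite_measure_mono) (auto simp: R_def)
    then have PM: "M.prob {x\<in>space M. norm (Y n x) > R} \<le> e" using elim by simp
    have "\<bar>(\<integral>x. f (Y n x) \<partial>M) - (\<integral>x. g (Y n x) \<partial>M)\<bar> \<le> e0 / 4"
      by (rule order_trans[OF M.expectation_diff_le_tail[OF f(1) gc B(1) g(3,2) Y e(1)] bound[OF PM]])
    then show ?case using dN elim e0 unfolding dist_real_def by linarith
  qed
qed

section \<open>The multivariate normal law\<close>

lemma borel_measurable_vec_lambda [measurable (raw)]:
  fixes f :: "'a \<Rightarrow> 'p::finite \<Rightarrow> real"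
  assumes "\<And>i. (\<lambda>x. f x i) \<in> borel_measurable M"
  shows "(\<lambda>x. \<chi> i. f x i) \<in> borel_measurable M"
  using assms by (subst borel_measurable_euclidean_space) (auto simp: Basis_vec_def inner_axis)

lemma borel_measurable_matrix_vector_mult [measurable]:
  "((*v) A :: real^'p \<Rightarrow> real^'q) \<in> borel_measurable borel"
  by (intro borel_measurable_continuous_onI linear_continuous_on) (simp add: matrix_vector_mul_bounded_linear)

text \<open>Both measures give a box the product of its side lengths. The product form makes Fubini
  available one coordinate at a time.\<close>

lemma lborel_vec:
  "(lborel :: (real^'p) measure) = distr (Pi\<^sub>M UNIV (\<lambda>_::'p. lborel)) borel (\<lambda>f. \<chi> i. f i)"
proof (rule lborel_eqI)
  interpret P: product_sigma_finite "\<lambda>_::'p. lborel::real measure" by standard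
  fix l u :: "real^'p" assume lu: "\<And>b. b \<in> Basis \<Longrightarrow> l \<bullet> b \<le> u \<bullet> b"
  have lu': "l $ i \<le> u $ i" for i
    using lu[of "axis i 1"] by (auto simp: Basis_vec_def inner_axis)
  have "emeasure (distr (Pi\<^sub>M UNIV (\<lambda>_::'p. lborel)) borel (\<lambda>f. \<chi> i. f i)) (box l u)
      = emeasure (Pi\<^sub>M UNIV (\<lambda>_::'p. lborel)) (PiE UNIV (\<lambda>i. {l $ i<..<u $ i}))"
    by (subst emeasure_distr)
      (auto simp: space_PiM mem_box_cart PiE_UNIV_domain Pi_iff intro!: arg_cong[where f="emeasure _"])
  also have "\<dots> = (\<Prod>i\<in>UNIV. ennreal (u $ i - l $ i))"
    by (subst P.emeasure_PiM) (auto simp: lu')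
  also have "\<dots> = ennreal (\<Prod>i\<in>UNIV. (u - l) $ i)"
    by (subst prod_ennreal) (auto simp: lu')
  also have "(\<Prod>i\<in>UNIV. (u - l) $ i) = (\<Prod>b\<in>Basis. (u - l) \<bullet> b)"
    by (intro prod.reindex_bij_witness[where i="\<lambda>b. (SOME i. b = axis i 1)" and j="\<lambda>i. axis i 1"])
      (auto simp: Basis_vec_def inner_axis axis_eq_axis intro: someI2)
  finally show "emeasure (distr (Pi\<^sub>M UNIV (\<lambda>_::'p. lborel)) borel (\<lambda>f. \<chi> i. f i)) (box l u)
      = (\<Prod>b\<in>Basis. (u - l) \<bullet> b)" .
qed simp

lemma nn_integral_lborel_vec:
  fixes f :: "real^'p \<Rightarrow> ennreal"
  assumes [measurable]: "f \<in> borel_measurable borel"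
  shows "(\<integral>\<^sup>+x. f x \<partial>lborel) = (\<integral>\<^sup>+g. f (\<chi> i. g i) \<partial>Pi\<^sub>M UNIV (\<lambda>_::'p. lborel))"
  by (subst lborel_vec) (simp add: nn_integral_distr)

text \<open>Integrate over coordinate \<open>m\<close> first: with the other coordinates fixed, and
  since m \<noteq> n, the shear is a translation by \<open>c * x $ n\<close> in that
  variable.\<close>

lemma nn_integral_lborel_shear:
  fixes f :: "real^'p \<Rightarrow> ennreal"
  assumes f[measurable]: "f \<in> borel_measurable borel" and mn: "m \<noteq> n"
  shows "(\<integral>\<^sup>+x. f (\<chi> i. if i = m then x $ m + c * x $ n else x $ i) \<partial>lborel) = (\<integral>\<^sup>+x. f x \<partial>lborel)"
proof -
  interpret P: product_sigma_finite "\<lambda>_::'p. lborel::real measure" by standard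
  have U: "UNIV = insert m (UNIV - {m})" by auto
  let ?I = "UNIV - {m} :: 'p set"
  let ?P = "Pi\<^sub>M ?I (\<lambda>_::'p. lborel :: real measure)"
  have expand: "(\<integral>\<^sup>+g. h (\<chi> i. g i) \<partial>Pi\<^sub>M UNIV (\<lambda>_::'p. lborel))
      = (\<integral>\<^sup>+g. \<integral>\<^sup>+y. h (\<chi> i. if i = m then y else g i) \<partial>lborel \<partial>?P)"
    if [measurable]: "h \<in> borel_measurable borel" for h :: "real^'p \<Rightarrow> ennreal"
    by (subst U, subst P.product_nn_integral_insert) (auto simp: fun_upd_def insert_absorb)
  let ?s = "\<lambda>x::real^'p. \<chi> i. if i = m then x $ m + c * x $ n else x $ i"
  have "(\<integral>\<^sup>+x. f (?s x) \<partial>lborel) = (\<integral>\<^sup>+g. f (?s (\<chi> i. g i)) \<partial>Pi\<^sub>M UNIV (\<lambda>_::'p. lborel))"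
    by (rule nn_integral_lborel_vec) measurable
  also have "\<dots> = (\<integral>\<^sup>+g. \<integral>\<^sup>+y. f (?s (\<chi> i. if i = m then y else g i)) \<partial>lborel \<partial>?P)"
    by (rule expand) measurable
  also have "\<dots> = (\<integral>\<^sup>+g. \<integral>\<^sup>+y. f (\<chi> i. if i = m then y else g i) \<partial>lborel \<partial>?P)"
  proof (rule nn_integral_cong)
    fix g assume "g \<in> space ?P"
    have "(\<integral>\<^sup>+y. f (\<chi> i. if i = m then y else g i) \<partial>lborel)
        = ennreal \<bar>1\<bar> * (\<integral>\<^sup>+y. f (\<chi> i. if i = m then c * g n + 1 * y else g i) \<partial>lborel)"
      by (rule nn_integral_real_affine) auto
    also have "\<dots> = (\<integral>\<^sup>+y. f (?s (\<chi> i. if i = m then y else g i)) \<partial>lborel)"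
      using mn by (auto intro!: nn_integral_cong arg_cong[where f=f] simp: vec_eq_iff)
    finally show "(\<integral>\<^sup>+y. f (?s (\<chi> i. if i = m then y else g i)) \<partial>lborel)
      = (\<integral>\<^sup>+y. f (\<chi> i. if i = m then y else g i) \<partial>lborel)" ..
  qed
  also have "\<dots> = (\<integral>\<^sup>+x. f x \<partial>lborel)"
    by (simp add: expand[symmetric] nn_integral_lborel_vec)
  finally show ?thesis .
qed

text \<open>The preimage of a box under a permutation of coordinates is a box with the same side
  lengths.\<close>

lemma nn_integral_lborel_permute:
  fixes f :: "real^'p \<Rightarrow> ennreal" and p :: "'p \<Rightarrow> 'p"
  assumes [measurable]: "f \<in> borel_measurable borel" and p: "bij p"
  shows "(\<integral>\<^sup>+x. f (\<chi> i. x $ p i) \<partial>lborel) = (\<integral>\<^sup>+x. f x \<partial>lborel)"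
proof -
  have "(lborel :: (real^'p) measure) = distr lborel borel (\<lambda>x. \<chi> i. x $ p i)"
  proof (rule lborel_eqI)
    fix l u :: "real^'p" assume lu: "\<And>b. b \<in> Basis \<Longrightarrow> l \<bullet> b \<le> u \<bullet> b"
    have prodB: "(\<Prod>b\<in>Basis. v \<bullet> b) = (\<Prod>i\<in>UNIV. v $ i)" for v :: "real^'p"
      by (intro prod.reindex_bij_witness[where j="\<lambda>b. (SOME i. b = axis i 1)" and i="\<lambda>i. axis i 1"])
        (auto simp: Basis_vec_def inner_axis axis_eq_axis intro: someI2)
    let ?r = "\<lambda>v::real^'p. \<chi> i. v $ inv p i"
    have lu': "?r l \<bullet> b \<le> ?r u \<bullet> b" if "b \<in> Basis" for b
      using lu[of "axis (inv p (SOME i. b = axis i 1)) 1"] that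
      by (auto simp: Basis_vec_def inner_axis axis_eq_axis)
    have "emeasure (distr lborel borel (\<lambda>x. \<chi> i. x $ p i)) (box l u) = emeasure lborel (box (?r l) (?r u))"
    proof (subst emeasure_distr)
      have "l $ i < x $ p i \<and> x $ p i < u $ i \<longleftrightarrow> l $ inv p (p i) < x $ p i \<and> x $ p i < u $ inv p (p i)" for x i
        using p by (simp add: bij_is_inj)
      then have "(\<lambda>x. \<chi> i. x $ p i) -` box l u = box (?r l) (?r u)"
        using p by (auto simp: mem_box_cart bij_inv_eq_iff) (metis bij_inv_eq_iff)+
      then show "emeasure lborel ((\<lambda>x. \<chi> i. x $ p i) -` box l u \<inter> space lborel) = emeasure lborel (box (?r l) (?r u))"
        by simp
    qed auto
    also have "\<dots> = (\<Prod>b\<in>Basis. (?r u - ?r l) \<bullet> b)"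
      by (rule emeasure_lborel_box) (rule lu')
    also have "\<dots> = ennreal (\<Prod>i\<in>UNIV. (u - l) $ inv p i)" using prodB[of "?r u - ?r l"] by simp
    also have "(\<Prod>i\<in>UNIV. (u - l) $ inv p i) = (\<Prod>i\<in>UNIV. (u - l) $ i)"
      by (rule prod.reindex_bij_betw[of "inv p"]) (simp add: p bij_imp_bij_inv)
    finally show "emeasure (distr lborel borel (\<lambda>x. \<chi> i. x $ p i)) (box l u) = (\<Prod>b\<in>Basis. (u - l) \<bullet> b)"
      by (simp add: prodB)
  qed simp
  then have "(\<integral>\<^sup>+x. f x \<partial>lborel) = (\<integral>\<^sup>+x. f x \<partial>distr lborel borel (\<lambda>x. \<chi> i. x $ p i))" by simp
  also have "\<dots> = (\<integral>\<^sup>+x. f (\<chi> i. x $ p i) \<partial>lborel)" by (rule nn_integral_distr) auto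
  finally show ?thesis ..
qed

text \<open>
  The change of variables theorems of \<open>HOL-Analysis\<close> require a well-ordered index type, hence
  the induction over elementary matrices.
\<close>
lemma nn_integral_lborel_linear:
  fixes A :: "real^'p^'p" and f :: "real^'p \<Rightarrow> ennreal"
  assumes "det A \<noteq> 0" "f \<in> borel_measurable borel"
  shows "(\<integral>\<^sup>+x. f (A *v x) * ennreal \<bar>det A\<bar> \<partial>lborel) = (\<integral>\<^sup>+x. f x \<partial>lborel)"
proof -
  have "\<forall>f\<in>borel_measurable borel. det A \<noteq> 0 \<longrightarrow>
    (\<integral>\<^sup>+x. f (A *v x) * ennreal \<bar>det A\<bar> \<partial>lborel) = (\<integral>\<^sup>+x. f x \<partial>lborel)"
  proof (induction A rule: induct_matrix_elementary)
    case (1 A B)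
    show ?case
    proof (intro ballI impI)
      fix f :: "real^'p \<Rightarrow> ennreal" assume f[measurable]: "f \<in> borel_measurable borel" and d: "det (A ** B) \<noteq> 0"
      then have dA: "det A \<noteq> 0" and dB: "det B \<noteq> 0" by (auto simp: det_mul)
      have "(\<integral>\<^sup>+x. f ((A ** B) *v x) * ennreal \<bar>det (A ** B)\<bar> \<partial>lborel)
        = (\<integral>\<^sup>+x. (f (A *v (B *v x)) * ennreal \<bar>det A\<bar>) * ennreal \<bar>det B\<bar> \<partial>lborel)"
        by (simp add: det_mul abs_mult ennreal_mult mult.assoc matrix_vector_mul_assoc)
      also have "\<dots> = (\<integral>\<^sup>+x. f (A *v x) * ennreal \<bar>det A\<bar> \<partial>lborel)"
        using 1(2)[rule_format, OF _ dB, of "\<lambda>x. f (A *v x) * ennreal \<bar>det A\<bar>"] by simp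
      also have "\<dots> = (\<integral>\<^sup>+x. f x \<partial>lborel)"
        using 1(1) f dA by blast
      finally show "(\<integral>\<^sup>+x. f ((A ** B) *v x) * ennreal \<bar>det (A ** B)\<bar> \<partial>lborel) = (\<integral>\<^sup>+x. f x \<partial>lborel)" .
    qed
  next
    case (2 A i)
    then show ?case by (auto simp: det_zero_row)
  next
    case (3 A)
    show ?case
    proof (intro ballI impI)
      fix f :: "real^'p \<Rightarrow> ennreal" assume f[measurable]: "f \<in> borel_measurable borel" and d: "det A \<noteq> 0"
      have dd: "det A = (\<Prod>i\<in>UNIV. A $ i $ i)" by (rule det_diagonal) (use 3 in auto)
      with d have nz: "A $ i $ i \<noteq> 0" for i by auto
      have Av: "(A *v x) $ i = A $ i $ i * x $ i" for x i
      proof -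
        have "(A *v x) $ i = (\<Sum>j\<in>UNIV. A $ i $ j * x $ j)" by (simp add: matrix_vector_mult_def)
        also have "\<dots> = (\<Sum>j\<in>UNIV. if j = i then A $ i $ i * x $ i else 0)"
          using 3 by (intro sum.cong) auto
        finally show ?thesis by simp
      qed
      \<comment> \<open>\<open>lborel_affine_euclidean\<close> takes one scaling factor per basis
        vector; for a diagonal matrix this is the diagonal entry.\<close>
      define c where "c b = (A *v b) \<bullet> b" for b :: "real^'p"
      have c: "c (axis i 1) = A $ i $ i" for i by (simp add: c_def inner_axis Av)
      have L1: "(lborel :: (real^'p) measure) = density (distr lborel borel (\<lambda>x. 0 + (\<Sum>j\<in>Basis. (c j * (x \<bullet> j)) *\<^sub>R j)))
          (\<lambda>_. (\<Prod>j\<in>Basis. \<bar>c j\<bar>))"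
        by (rule lborel_affine_euclidean[where c=c and t=0]) (auto simp: Basis_vec_def c nz)
      have L2: "0 + (\<Sum>j\<in>Basis. (c j * (x \<bullet> j)) *\<^sub>R j) = A *v x" for x :: "real^'p"
      proof -
        have "(\<Sum>j\<in>Basis. (c j * (x \<bullet> j)) *\<^sub>R j) \<bullet> b = (A *v x) \<bullet> b" if "b \<in> Basis" for b
          using that by (auto simp: inner_sum_left inner_Basis if_distrib cong: if_cong)
            (auto simp: Basis_vec_def c inner_axis Av)
        then show ?thesis by (simp add: euclidean_eq_iff[where 'a="real^'p"])
      qed
      have L3: "(\<Prod>j\<in>Basis. \<bar>c j\<bar>) = \<bar>det A\<bar>"
      proof -
        have "(\<Prod>j\<in>Basis. \<bar>c j\<bar>) = (\<Prod>i\<in>UNIV. \<bar>A $ i $ i\<bar>)"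
          by (intro prod.reindex_bij_witness[where j="\<lambda>b. (SOME i. b = axis i 1)" and i="\<lambda>i. axis i 1"])
            (auto simp: Basis_vec_def c axis_eq_axis intro: someI2)
        then show ?thesis by (simp add: dd abs_prod)
      qed
      have "(\<integral>\<^sup>+x. f x \<partial>lborel) = (\<integral>\<^sup>+x. f x \<partial>density (distr lborel borel ((*v) A)) (\<lambda>_. \<bar>det A\<bar>))"
        using L1 unfolding L2 L3 by simp
      also have "\<dots> = (\<integral>\<^sup>+x. f (A *v x) * ennreal \<bar>det A\<bar> \<partial>lborel)"
        by (simp add: nn_integral_density nn_integral_distr mult.commute)
      finally show "(\<integral>\<^sup>+x. f (A *v x) * ennreal \<bar>det A\<bar> \<partial>lborel) = (\<integral>\<^sup>+x. f x \<partial>lborel)" ..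
    qed
  next
    case (4 m n)
    let ?p = "Transposition.transpose m n"
    let ?A = "(\<chi> i j. mat 1 $ i $ ?p j) :: real^'p^'p"
    have "det ?A = of_int (sign ?p) * det (mat 1 :: real^'p^'p)"
      by (rule det_permute_columns) (simp add: permutes_swap_id)
    then have "\<bar>det ?A\<bar> = 1" by (simp add: sign_def)
    moreover have "?A *v x = (\<chi> i. x $ ?p i)" for x
    proof -
      have "(\<Sum>j\<in>UNIV. mat 1 $ i $ ?p j * x $ j) = (\<Sum>j\<in>UNIV. if j = ?p i then x $ ?p i else 0)" for i
        by (intro sum.cong) (auto simp: mat_def transpose_eq_iff Transposition.transpose_def split: if_splits)
      then show ?thesis by (simp add: vec_eq_iff matrix_vector_mult_def)
    qed
    ultimately show ?case by (auto simp: nn_integral_lborel_permute bij_swap)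
  next
    case (5 m n c)
    let ?A = "(\<chi> i j. if i = m \<and> j = n then c else of_bool (i = j)) :: real^'p^'p"
    have "?A = (\<chi> k. if k = m then row m (mat 1) + c *s row n (mat 1) else row k (mat 1))"
      using 5 by (auto simp: vec_eq_iff row_def mat_def)
    then have "det ?A = 1" using det_row_operation[OF 5, of "mat 1 :: real^'p^'p" c] by simp
    moreover have "?A *v x = (\<chi> i. if i = m then x $ m + c * x $ n else x $ i)" for x
    proof -
      have "(\<Sum>j\<in>UNIV. (if i = m \<and> j = n then c else of_bool (i = j)) * x $ j)
        = (\<Sum>j\<in>UNIV. (if j = i then x $ i else 0) + (if j = n then (if i = m then c * x $ n else 0) else 0))" for i
        using 5 by (intro sum.cong) auto
      also have "\<dots> i = (if i = m then x $ m + c * x $ n else x $ i)" for i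
        by (subst sum.distrib) auto
      finally show ?thesis by (simp add: vec_eq_iff matrix_vector_mult_def)
    qed
    ultimately show ?case using 5 by (auto simp: nn_integral_lborel_shear)
  qed
  with assms show ?thesis by blast
qed

section \<open>Positive definite matrices\<close>

lemma matrix_inv_mult:
  fixes A :: "real^'n^'n"
  assumes "det A \<noteq> 0"
  shows "A ** matrix_inv A = mat 1" "matrix_inv A ** A = mat 1"
proof -
  have "\<exists>A'. A ** A' = mat 1 \<and> A' ** A = mat 1"
    using assms invertible_det_nz[of A] unfolding invertible_def by blast
  from someI_ex[OF this] show "A ** matrix_inv A = mat 1" "matrix_inv A ** A = mat 1"
    unfolding matrix_inv_def by blast+
qed

lemma matrix_inv_eqI:
  fixes A :: "real^'n^'n"
  assumes "A ** B = mat 1"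
  shows "matrix_inv A = B" "det A \<noteq> 0"
proof -
  show d: "det A \<noteq> 0"
    using assms by (metis det_I det_mul mult_zero_left zero_neq_one)
  have "matrix_inv A = matrix_inv A ** (A ** B)" by (simp add: assms)
  also have "\<dots> = B" by (simp add: matrix_mul_assoc matrix_inv_mult[OF d])
  finally show "matrix_inv A = B" .
qed

lemma inner_matrix_transpose:
  fixes A :: "real^'n^'m"
  shows "x \<bullet> (A *v y) = (transpose A *v x) \<bullet> y"
  by (simp add: dot_lmul_matrix[symmetric])

lemma pos_def_det: "pos_def A \<Longrightarrow> det A \<noteq> 0"
proof
  assume A: "pos_def A" and "det A = 0"
  then have "\<not> inj ((*v) A)" using det_nz_iff_inj[of "(*v) A"] by simp
  then obtain x where "A *v x = 0" "x \<noteq> 0"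
    using linear_injective_0[of "(*v) A"] by auto
  then show False using A unfolding pos_def_def by fastforce
qed

lemma pos_def_congruence:
  fixes A B :: "real^'n^'n"
  assumes A: "pos_def A" and B: "det B \<noteq> 0"
  shows "pos_def (B ** A ** transpose B)"
  unfolding pos_def_def
proof (intro conjI allI impI)
  show "transpose (B ** A ** transpose B) = B ** A ** transpose B"
    using A by (simp add: pos_def_def matrix_transpose_mul matrix_mul_assoc)
  fix x :: "real^'n" assume x: "x \<noteq> 0"
  have dB: "det (transpose B) \<noteq> 0" using B by (simp add: det_transpose)
  then have "transpose B *v x \<noteq> 0"
    using x matrix_inv_mult(2)[OF dB]
    by (metis matrix_vector_mul_assoc matrix_vector_mul_lid matrix_vector_mult_0_right)
  then have "0 < (transpose B *v x) \<bullet> (A *v (transpose B *v x))"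
    using A by (simp add: pos_def_def)
  also have "\<dots> = x \<bullet> ((B ** A ** transpose B) *v x)"
    by (simp add: matrix_vector_mul_assoc[symmetric] inner_matrix_transpose)
  finally show "0 < x \<bullet> ((B ** A ** transpose B) *v x)" .
qed

text \<open>The inverse \<open>B\<close> of \<open>A\<close> is symmetric, so
  \<open>B = B ** A ** transpose B\<close> is congruent to \<open>A\<close>.\<close>

lemma pos_def_inverse:
  fixes A :: "real^'n^'n"
  assumes A: "pos_def A"
  shows "pos_def (matrix_inv A)"
proof -
  let ?B = "matrix_inv A"
  note inv = matrix_inv_mult[OF pos_def_det[OF A]]
  have "transpose ?B ** A = mat 1"
    using arg_cong[OF inv(1), of transpose] A by (simp add: matrix_transpose_mul pos_def_def transpose_mat)
  then have t: "transpose ?B = ?B"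
    by (metis inv(1) matrix_mul_assoc matrix_mul_lid matrix_mul_rid)
  have d: "det ?B \<noteq> 0" using matrix_inv_eqI(2)[OF inv(2)] .
  from pos_def_congruence[OF A d] show ?thesis by (simp add: t inv)
qed

text \<open>
  A maximal set of vectors that are orthonormal for the form \<open>A\<close> is a basis.
\<close>
lemma pos_def_orthonormalize:
  fixes A :: "real^'n^'n"
  assumes A: "pos_def A"
  obtains W :: "real^'n^'n" where "W ** A ** transpose W = mat 1"
proof -
  define q where "q x y = x \<bullet> (A *v y)" for x y :: "real^'n"
  have qsym: "q x y = q y x" for x y
    using A unfolding q_def pos_def_def by (metis inner_matrix_transpose inner_commute)
  have qpos: "x \<noteq> 0 \<Longrightarrow> q x x > 0" for x using A by (simp add: q_def pos_def_def)
  have qsum: "q x (\<Sum>v\<in>T. c v *\<^sub>R v) = (\<Sum>v\<in>T. c v * q x v)" for x c T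
    by (simp add: q_def linear_sum[OF matrix_vector_mul_linear] inner_sum_right
        linear_scale[OF matrix_vector_mul_linear])
  define ons where "ons T \<longleftrightarrow> (\<forall>x\<in>T. \<forall>y\<in>T. q x y = (if x = y then 1 else 0))" for T
  have ind: "finite T \<and> independent T" if "ons T" for T
  proof -
    have "\<not> dependent T"
    proof
      assume "dependent T"
      then obtain U u v where U: "finite U" "U \<subseteq> T" "(\<Sum>v\<in>U. u v *\<^sub>R v) = 0" "v \<in> U" "u v \<noteq> 0"
        unfolding dependent_explicit by auto
      have "0 = q v (\<Sum>v\<in>U. u v *\<^sub>R v)" by (simp add: U(3) q_def)
      also have "\<dots> = (\<Sum>w\<in>U. if w = v then u v else 0)"
        unfolding qsum using U \<open>ons T\<close> by (intro sum.cong) (auto simp: ons_def subset_iff)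
      also have "\<dots> = u v" using U by simp
      finally show False using U by simp
    qed
    then show ?thesis using independent_bound by blast
  qed
  have bd: "card T \<le> CARD('n)" if "ons T" for T
    using ind[OF that] independent_bound[of T] by auto
  have "\<exists>T. ons T \<and> (\<forall>T'. ons T' \<longrightarrow> card T' \<le> card T)"
  proof -
    have "\<exists>T. ons T" by (rule exI[of _ "{}"]) (simp add: ons_def)
    then show ?thesis using ex_has_greatest_nat[of ons _ card "Suc CARD('n)"] bd
      by (metis le_imp_less_Suc)
  qed
  then obtain T where T: "ons T" "\<And>T'. ons T' \<Longrightarrow> card T' \<le> card T" by blast
  have fin: "finite T" using ind[OF T(1)] by blast
  have "span T = UNIV"
  proof (rule ccontr)
    assume "span T \<noteq> UNIV"
    then obtain y where y: "y \<notin> span T" by blast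
    \<comment> \<open>Gram-Schmidt for the form \<open>q\<close>: \<open>z\<close> is orthogonal to
      \<open>T\<close>, and after normalisation it would enlarge the maximal orthonormal
      set.\<close>
    define z where "z = y - (\<Sum>v\<in>T. q v y *\<^sub>R v)"
    have "(\<Sum>v\<in>T. q v y *\<^sub>R v) \<in> span T" by (intro span_sum span_scale span_base)
    then have "z \<noteq> 0" using y by (auto simp: z_def)
    have qz: "q x z = 0" if "x \<in> T" for x
    proof -
      have "q x z = q x y - q x (\<Sum>v\<in>T. q v y *\<^sub>R v)"
        by (simp add: z_def q_def matrix_vector_mult_diff_distrib inner_diff_right)
      also have "q x (\<Sum>v\<in>T. q v y *\<^sub>R v) = (\<Sum>v\<in>T. if v = x then q x y else 0)"
        unfolding qsum using T(1) that by (intro sum.cong) (auto simp: ons_def)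
      finally show ?thesis using that fin by simp
    qed
    define w where "w = (1 / sqrt (q z z)) *\<^sub>R z"
    have w1: "q w w = 1" using qpos[OF \<open>z \<noteq> 0\<close>]
      by (simp add: w_def q_def linear_scale[OF matrix_vector_mul_linear] field_simps power2_eq_square[symmetric])
    have w0: "q x w = 0" if "x \<in> T" for x
      using qz[OF that] by (simp add: w_def q_def linear_scale[OF matrix_vector_mul_linear])
    have "w \<notin> T" using w0 w1 by fastforce
    have "ons (insert w T)" using T(1) w0 w1 qsym \<open>w \<notin> T\<close> by (auto simp: ons_def)
    from T(2)[OF this] show False using \<open>w \<notin> T\<close> fin by simp
  qed
  then have "card T = CARD('n)"
    using ind[OF T(1)] dim_eq_card[of T UNIV] by simp
  then obtain f where f: "bij_betw f (UNIV::'n set) T"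
    using fin by (metis finite_same_card_bij finite)
  define W where "W = (\<chi> i. f i)"
  have "(W ** A ** transpose W) $ i $ j = q (f i) (f j)" for i j
  proof -
    have "(W ** A ** transpose W) $ i $ j = (\<Sum>k\<in>UNIV. \<Sum>l\<in>UNIV. f i $ l * A $ l $ k * f j $ k)"
      by (simp add: W_def matrix_matrix_mult_def transpose_def sum_distrib_right)
    also have "\<dots> = (\<Sum>l\<in>UNIV. \<Sum>k\<in>UNIV. f i $ l * A $ l $ k * f j $ k)"
      by (rule sum.swap)
    also have "\<dots> = q (f i) (f j)"
      by (simp add: q_def matrix_vector_mult_def inner_vec_def sum_distrib_left mult.assoc)
    finally show ?thesis .
  qed
  moreover have "q (f i) (f j) = (if i = j then 1 else 0)" for i j
    using T(1) f by (auto simp: ons_def bij_betw_def inj_on_def)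
  ultimately have "W ** A ** transpose W = mat 1" by (simp add: vec_eq_iff mat_def)
  then show ?thesis by (rule that)
qed

section \<open>The standard normal law and its linear images\<close>

definition std_mvn_density :: "real^'p \<Rightarrow> real" where
  "std_mvn_density x = (\<Prod>i\<in>UNIV. std_normal_density (x $ i))"

definition std_mvn :: "(real^'p) measure" where
  "std_mvn = density lborel (\<lambda>x. ennreal (std_mvn_density x))"

lemma std_mvn_density_eq:
  "std_mvn_density (x :: real^'p) = exp (- (x \<bullet> x) / 2) / sqrt ((2 * pi) ^ CARD('p))"
  by (simp add: std_mvn_density_def std_normal_density_def prod.distrib prod_dividef exp_sum[symmetric]
      inner_vec_def power2_eq_square sum_negf sum_divide_distrib real_sqrt_power real_sqrt_mult power_mult_distrib)

lemma measurable_std_mvn_density[measurable]: "std_mvn_density \<in> borel_measurable borel"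
  unfolding std_mvn_density_def[abs_def] by measurable

lemma std_mvn_density_nonneg: "std_mvn_density x \<ge> 0"
  unfolding std_mvn_density_def by (intro prod_nonneg) (simp add: normal_density_nonneg)

lemma prob_space_std_mvn: "prob_space (std_mvn :: (real^'p) measure)"
proof
  interpret P: product_sigma_finite "\<lambda>_::'p. lborel::real measure" by standard
  have 1: "(\<integral>\<^sup>+y. ennreal (std_normal_density y) \<partial>lborel) = 1"
  proof -
    interpret N: prob_space std_normal_distribution by (rule prob_space_normal_density) simp
    show ?thesis using N.emeasure_space_1 by (simp add: emeasure_density)
  qed
  have "emeasure (std_mvn :: (real^'p) measure) (space std_mvn) = (\<integral>\<^sup>+x. ennreal (std_mvn_density x) \<partial>(lborel :: (real^'p) measure))"
    by (simp add: std_mvn_def emeasure_density)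
  also have "\<dots> = (\<integral>\<^sup>+g. (\<Prod>i\<in>UNIV. ennreal (std_normal_density (g i))) \<partial>Pi\<^sub>M UNIV (\<lambda>_::'p. lborel))"
    by (subst nn_integral_lborel_vec) (auto simp: std_mvn_density_def prod_ennreal normal_density_nonneg)
  also have "\<dots> = 1" by (subst P.product_nn_integral_prod) (auto simp: 1)
  finally show "emeasure (std_mvn :: (real^'p) measure) (space std_mvn) = 1" .
qed

text \<open>Density and character both factor over the coordinates, which reduces the integral to
  one-dimensional characteristic functions.\<close>

lemma char_std_mvn:
  fixes u :: "real^'p"
  shows "(\<integral>x. cis (u \<bullet> x) \<partial>std_mvn) = of_real (exp (- (u \<bullet> u) / 2))"
proof -
  interpret P: product_sigma_finite "\<lambda>_::'p. lborel::real measure" by standard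
  interpret N: prob_space std_normal_distribution by (rule prob_space_normal_density) simp
  have prod: "std_mvn_density x *\<^sub>R cis (u \<bullet> x)
      = (\<Prod>i\<in>UNIV. std_normal_density (x $ i) *\<^sub>R cis (u $ i * x $ i))" for x
  proof -
    have "cis (\<Sum>i\<in>I. t i) = (\<Prod>i\<in>I. cis (t i))" if "finite I" for t and I :: "'p set"
      using that by induction (auto simp: cis_mult[symmetric])
    then show ?thesis
      by (simp add: std_mvn_density_def inner_vec_def scaleR_conv_of_real prod.distrib)
  qed
  have int: "integrable lborel (\<lambda>y. std_normal_density y *\<^sub>R cis (t * y))" for t
  proof -
    have "integrable std_normal_distribution (\<lambda>y. cis (t * y))"
      by (rule N.integrable_const_bound[where B=1]) auto
    then show ?thesis by (subst (asm) integrable_density) (auto simp: normal_density_nonneg)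
  qed
  have one: "(\<integral>y. std_normal_density y *\<^sub>R cis (t * y) \<partial>lborel) = of_real (exp (- t\<^sup>2 / 2))" for t
  proof -
    have "(\<integral>y. std_normal_density y *\<^sub>R cis (t * y) \<partial>lborel) = char std_normal_distribution t"
      unfolding char_def cis_conv_exp[symmetric] by (subst integral_density) (auto simp: normal_density_nonneg)
    then show ?thesis by (simp add: char_std_normal_distribution)
  qed
  have "(\<integral>x. cis (u \<bullet> x) \<partial>std_mvn) = (\<integral>x. std_mvn_density x *\<^sub>R cis (u \<bullet> x) \<partial>lborel)"
    unfolding std_mvn_def by (subst integral_density) (auto simp: std_mvn_density_nonneg)
  also have "\<dots> = (\<integral>g. (\<Prod>i\<in>UNIV. std_normal_density (g i) *\<^sub>R cis (u $ i * g i)) \<partial>Pi\<^sub>M UNIV (\<lambda>_::'p. lborel))"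
    by (subst lborel_vec, subst integral_distr) (auto simp: prod)
  also have "\<dots> = (\<Prod>i\<in>UNIV. of_real (exp (- (u $ i)\<^sup>2 / 2)))"
    by (subst P.product_integral_prod) (auto simp: int one)
  also have "\<dots> = of_real (exp (- (u \<bullet> u) / 2))"
    by (simp add: of_real_prod[symmetric] exp_sum[symmetric] inner_vec_def power2_eq_square
        sum_negf sum_divide_distrib del: of_real_prod)
  finally show ?thesis .
qed

text \<open>Whitening: if \<open>W\<close> turns \<Sigma> into the identity, then the inverse of
  \<Sigma> is \<open>transpose W ** W\<close>, and the density at \<open>x\<close> is the standard
  density at \<open>W *v x\<close> times |det W|. The linear change of variables does the rest, with
  \<open>V\<close> the inverse of \<open>W\<close>.\<close>

lemma mvn_eq_distr:
  fixes \<Sigma> :: "real^'p^'p"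
  assumes "pos_def \<Sigma>"
  obtains V :: "real^'p^'p" where "\<Sigma> = V ** transpose V" "mvn 0 \<Sigma> = distr std_mvn borel ((*v) V)"
proof -
  obtain W :: "real^'p^'p" where W: "W ** \<Sigma> ** transpose W = mat 1" using pos_def_orthonormalize[OF assms] .
  let ?V = "matrix_inv W"
  have dW: "det W \<noteq> 0"
    by (rule matrix_inv_eqI(2)[of _ "\<Sigma> ** transpose W"]) (use W in \<open>simp add: matrix_mul_assoc\<close>)
  note iW = matrix_inv_mult[OF dW]
  have iWt: "transpose W ** transpose ?V = mat 1"
    using arg_cong[OF iW(2), of transpose] by (simp add: matrix_transpose_mul transpose_mat)
  have S: "\<Sigma> = ?V ** transpose ?V"
  proof -
    have "\<Sigma> = (?V ** W) ** \<Sigma> ** (transpose W ** transpose ?V)" by (simp add: iW iWt)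
    also have "\<dots> = ?V ** (W ** \<Sigma> ** transpose W) ** transpose ?V" by (simp add: matrix_mul_assoc)
    finally show ?thesis by (simp add: W)
  qed
  have iS: "matrix_inv \<Sigma> = transpose W ** W"
  proof (rule matrix_inv_eqI(1))
    have "\<Sigma> ** (transpose W ** W) = (?V ** W) ** \<Sigma> ** transpose W ** W"
      by (simp add: iW matrix_mul_assoc)
    also have "\<dots> = ?V ** (W ** \<Sigma> ** transpose W) ** W" by (simp add: matrix_mul_assoc)
    finally show "\<Sigma> ** (transpose W ** W) = mat 1" by (simp add: W iW)
  qed
  have detS: "det \<Sigma> = 1 / (det W)\<^sup>2"
    using arg_cong[OF W, of det] dW by (simp add: det_mul det_transpose power2_eq_square field_simps)
  have dens: "exp (- ((x - 0) \<bullet> (matrix_inv \<Sigma> *v (x - 0))) / 2) / sqrt ((2 * pi) ^ CARD('p) * det \<Sigma>)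
      = std_mvn_density (W *v x) * \<bar>det W\<bar>" for x :: "real^'p"
    by (simp add: std_mvn_density_eq iS detS matrix_vector_mul_assoc[symmetric] inner_matrix_transpose
        real_sqrt_mult real_sqrt_divide inner_commute)
  have "mvn 0 \<Sigma> = density lborel (\<lambda>x. ennreal (std_mvn_density (W *v x) * \<bar>det W\<bar>))"
    unfolding mvn_def dens ..
  also have "\<dots> = distr std_mvn borel ((*v) ?V)"
  proof (rule measure_eqI)
    show "sets (density lborel (\<lambda>x. ennreal (std_mvn_density (W *v x) * \<bar>det W\<bar>))) = sets (distr std_mvn borel ((*v) ?V))"
      by simp
    fix E assume "E \<in> sets (density lborel (\<lambda>x::real^'p. ennreal (std_mvn_density (W *v x) * \<bar>det W\<bar>)))"
    then have E[measurable]: "E \<in> sets borel" by simp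
    have [measurable_cong]: "sets (std_mvn :: (real^'p) measure) = sets borel" by (simp add: std_mvn_def)
    have VW: "?V *v (W *v x) = x" for x by (simp add: matrix_vector_mul_assoc iW)
    have "emeasure (distr std_mvn borel ((*v) ?V)) E = (\<integral>\<^sup>+x. indicator E (?V *v x) \<partial>std_mvn)"
      by (subst nn_integral_indicator[symmetric], simp, rule nn_integral_distr) auto
    also have "\<dots> = (\<integral>\<^sup>+x. ennreal (std_mvn_density x) * indicator E (?V *v x) \<partial>lborel)"
      unfolding std_mvn_def by (rule nn_integral_density) auto
    also have "\<dots> = (\<integral>\<^sup>+x. (ennreal (std_mvn_density (W *v x)) * indicator E (?V *v (W *v x))) * ennreal \<bar>det W\<bar> \<partial>lborel)"
      by (rule nn_integral_lborel_linear[OF dW, symmetric]) auto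
    also have "\<dots> = (\<integral>\<^sup>+x. ennreal (std_mvn_density (W *v x) * \<bar>det W\<bar>) * indicator E x \<partial>lborel)"
      by (simp add: VW ennreal_mult std_mvn_density_nonneg mult_ac)
    also have "\<dots> = emeasure (density lborel (\<lambda>x. ennreal (std_mvn_density (W *v x) * \<bar>det W\<bar>))) E"
      by (rule emeasure_density[symmetric]) auto
    finally show "emeasure (density lborel (\<lambda>x. ennreal (std_mvn_density (W *v x) * \<bar>det W\<bar>))) E
      = emeasure (distr std_mvn borel ((*v) ?V)) E" ..
  qed
  finally show ?thesis by (rule that[OF S])
qed

lemma prob_space_mvn:
  fixes \<Sigma> :: "real^'p^'p"
  assumes "pos_def \<Sigma>"
  shows "prob_space (mvn 0 \<Sigma>)"
proof -
  obtain V :: "real^'p^'p" where "\<Sigma> = V ** transpose V" and V: "mvn 0 \<Sigma> = distr std_mvn borel ((*v) V)"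
    using mvn_eq_distr[OF assms] .
  interpret prob_space "std_mvn :: (real^'p) measure" by (rule prob_space_std_mvn)
  show ?thesis unfolding V by (rule prob_space_distr) (simp add: std_mvn_def)
qed

lemma char_mvn:
  fixes u :: "real^'p"
  assumes "pos_def \<Sigma>"
  shows "(\<integral>x. cis (u \<bullet> x) \<partial>mvn 0 \<Sigma>) = of_real (exp (- (u \<bullet> (\<Sigma> *v u)) / 2))"
proof -
  obtain V :: "real^'p^'p" where V: "\<Sigma> = V ** transpose V" "mvn 0 \<Sigma> = distr std_mvn borel ((*v) V)"
    using mvn_eq_distr[OF assms] .
  have "(\<integral>x. cis (u \<bullet> x) \<partial>mvn 0 \<Sigma>) = (\<integral>x. cis (u \<bullet> (V *v x)) \<partial>std_mvn)"
    unfolding V(2)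
    by (rule integral_distr) (auto simp: std_mvn_def)
  also have "\<dots> = of_real (exp (- ((transpose V *v u) \<bullet> (transpose V *v u)) / 2))"
    by (simp add: inner_matrix_transpose char_std_mvn)
  also have "(transpose V *v u) \<bullet> (transpose V *v u) = u \<bullet> (\<Sigma> *v u)"
    by (simp add: V(1) matrix_vector_mul_assoc[symmetric] inner_matrix_transpose)
  finally show ?thesis .
qed

section \<open>Convergence in probability\<close>

lemma abs_cube_le: "\<bar>y\<bar> ^ 3 \<le> 1 + y ^ 4" for y :: real
proof (cases "\<bar>y\<bar> \<le> 1")
  case True
  then have "\<bar>y\<bar> ^ 3 \<le> 1" by (intro power_le_one) auto
  then show ?thesis by (smt (verit) zero_le_even_power even_numeral)
next
  case False
  then have "\<bar>y\<bar> ^ 3 \<le> \<bar>y\<bar> ^ 4" by (intro power_increasing) auto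
  then show ?thesis by simp
qed

lemma abs_mult_le_squares: "\<bar>x * y\<bar> \<le> x\<^sup>2 + y\<^sup>2" for x y :: real
proof -
  have "2 * (\<bar>x\<bar> * \<bar>y\<bar>) \<le> x\<^sup>2 + y\<^sup>2"
    using zero_le_power2[of "\<bar>x\<bar> - \<bar>y\<bar>"] by (simp add: power2_diff)
  moreover have "0 \<le> \<bar>x\<bar> * \<bar>y\<bar>" by simp
  ultimately show ?thesis unfolding abs_mult by linarith
qed

text \<open>Convergence to 0 in probability, expressed by the truncated distance that metrises it.
  The integrand is bounded, so \<open>Y\<close> needs no moments and all estimates become estimates
  of expectations.\<close>

definition to_zero_prob :: "'a measure \<Rightarrow> (nat \<Rightarrow> 'a \<Rightarrow> real) \<Rightarrow> bool" where
  "to_zero_prob M Y \<longleftrightarrow>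
     (\<forall>n. Y n \<in> borel_measurable M) \<and> (\<lambda>n. \<integral>\<omega>. min 1 \<bar>Y n \<omega>\<bar> \<partial>M) \<longlonglongrightarrow> 0"

context prob_space begin

lemma integrable_min_one:
  assumes [measurable]: "Y \<in> borel_measurable M"
  shows "integrable M (\<lambda>\<omega>. min 1 \<bar>Y \<omega> :: real\<bar>)"
  by (rule integrable_const_bound[where B=1]) auto

lemma to_zero_prob_bound:
  assumes m: "\<And>n. Y n \<in> borel_measurable M"
    and int: "\<And>n. integrable M (Z n)"
    and le: "\<And>n \<omega>. \<omega> \<in> space M \<Longrightarrow> min 1 \<bar>Y n \<omega>\<bar> \<le> Z n \<omega>"
    and lim: "(\<lambda>n. expectation (Z n)) \<longlonglongrightarrow> 0"
  shows "to_zero_prob M Y"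
  unfolding to_zero_prob_def
proof (intro conjI allI m tendsto_sandwich[OF _ _ tendsto_const lim] always_eventually)
  show "0 \<le> expectation (\<lambda>\<omega>. min 1 \<bar>Y n \<omega>\<bar>)" for n by (rule integral_nonneg_AE) auto
  show "expectation (\<lambda>\<omega>. min 1 \<bar>Y n \<omega>\<bar>) \<le> expectation (Z n)" for n
    using m int le by (intro integral_mono integrable_min_one) auto
qed

lemma to_zero_prob_add:
  assumes "to_zero_prob M Y" "to_zero_prob M Z"
  shows "to_zero_prob M (\<lambda>n \<omega>. Y n \<omega> + Z n \<omega>)"
proof (rule to_zero_prob_bound)
  have m[measurable]: "\<And>n. Y n \<in> borel_measurable M" "\<And>n. Z n \<in> borel_measurable M"
    using assms by (auto simp: to_zero_prob_def)
  show "(\<lambda>\<omega>. Y n \<omega> + Z n \<omega>) \<in> borel_measurable M" for n by measurable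
  show "integrable M (\<lambda>\<omega>. min 1 \<bar>Y n \<omega>\<bar> + min 1 \<bar>Z n \<omega>\<bar>)" for n
    by (intro Bochner_Integration.integrable_add integrable_min_one m)
  show "(\<lambda>n. expectation (\<lambda>\<omega>. min 1 \<bar>Y n \<omega>\<bar> + min 1 \<bar>Z n \<omega>\<bar>)) \<longlonglongrightarrow> 0"
    using tendsto_add[of _ 0 _ _ 0] assms
    by (auto simp: to_zero_prob_def Bochner_Integration.integral_add integrable_min_one)
qed auto

lemma to_zero_prob_mono:
  assumes Z: "to_zero_prob M Z" and m: "\<And>n. Y n \<in> borel_measurable M"
    and le: "\<And>n \<omega>. \<omega> \<in> space M \<Longrightarrow> \<bar>Y n \<omega>\<bar> \<le> \<bar>Z n \<omega>\<bar>"
  shows "to_zero_prob M Y"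
proof (rule to_zero_prob_bound[where Z="\<lambda>n \<omega>. min 1 \<bar>Z n \<omega>\<bar>", OF m])
  show "integrable M (\<lambda>\<omega>. min 1 \<bar>Z n \<omega>\<bar>)" for n
    using Z by (intro integrable_min_one) (auto simp: to_zero_prob_def)
  show "(\<lambda>n. expectation (\<lambda>\<omega>. min 1 \<bar>Z n \<omega>\<bar>)) \<longlonglongrightarrow> 0" using Z by (simp add: to_zero_prob_def)
  show "min 1 \<bar>Y n \<omega>\<bar> \<le> min 1 \<bar>Z n \<omega>\<bar>" if "\<omega> \<in> space M" for n \<omega> using le[OF that, of n] by simp
qed

lemma to_zero_prob_cong:
  assumes "\<And>n \<omega>. \<omega> \<in> space M \<Longrightarrow> Y n \<omega> = Z n \<omega>"
  shows "to_zero_prob M Y \<longleftrightarrow> to_zero_prob M Z"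
proof -
  have "Y n \<in> borel_measurable M \<longleftrightarrow> Z n \<in> borel_measurable M" for n
    using assms by (rule measurable_cong)
  moreover have "expectation (\<lambda>\<omega>. min 1 \<bar>Y n \<omega>\<bar>) = expectation (\<lambda>\<omega>. min 1 \<bar>Z n \<omega>\<bar>)" for n
    using assms by (intro Bochner_Integration.integral_cong) auto
  ultimately show ?thesis by (simp add: to_zero_prob_def)
qed

text \<open>
  \<open>min 1 \<bar>y z\<bar> \<le> k min 1 \<bar>y\<bar> + \<bar>z\<bar> / k\<close> for every \<open>k \<ge> 1\<close>, by cases on \<open>\<bar>z\<bar> \<le> k\<close>.
\<close>
lemma to_zero_prob_mult_bounded:
  assumes Y: "to_zero_prob M Y" and Z: "\<And>n. integrable M (Z n)"
    and K: "\<And>n. expectation (\<lambda>\<omega>. \<bar>Z n \<omega>\<bar>) \<le> K"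
  shows "to_zero_prob M (\<lambda>n \<omega>. Y n \<omega> * Z n \<omega>)"
proof -
  have [measurable]: "Y n \<in> borel_measurable M" "Z n \<in> borel_measurable M" for n
    using Y Z by (auto simp: to_zero_prob_def)
  have le: "min 1 \<bar>y * z\<bar> \<le> k * min 1 \<bar>y\<bar> + \<bar>z\<bar> / k" if "k \<ge> 1" for y z k :: real
  proof (cases "\<bar>z\<bar> \<le> k")
    case True
    have "\<bar>y * z\<bar> \<le> \<bar>y\<bar> * k" using True by (simp add: abs_mult mult_left_mono)
    then have "min 1 \<bar>y * z\<bar> \<le> min k (k * \<bar>y\<bar>)" using that by (auto simp: mult.commute)
    also have "\<dots> = k * min 1 \<bar>y\<bar>" using that by (auto simp: min_def)
    finally show ?thesis using that by (smt (verit) divide_nonneg_nonneg abs_ge_zero)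
  next
    case False
    then have "\<bar>z\<bar> / k \<ge> 1" using that by simp
    moreover have "k * min 1 \<bar>y\<bar> \<ge> 0" using that by simp
    ultimately show ?thesis by linarith
  qed
  have K0: "K \<ge> 0" using K[of 0] Bochner_Integration.integral_nonneg[of M "\<lambda>\<omega>. \<bar>Z 0 \<omega>\<bar>"] by linarith
  have bd: "expectation (\<lambda>\<omega>. min 1 \<bar>Y n \<omega> * Z n \<omega>\<bar>) \<le> k * expectation (\<lambda>\<omega>. min 1 \<bar>Y n \<omega>\<bar>) + K / k"
    if "k \<ge> 1" for n k
  proof -
    have "expectation (\<lambda>\<omega>. min 1 \<bar>Y n \<omega> * Z n \<omega>\<bar>) \<le> expectation (\<lambda>\<omega>. k * min 1 \<bar>Y n \<omega>\<bar> + \<bar>Z n \<omega>\<bar> / k)"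
      using le[OF that] Z
      by (intro integral_mono integrable_min_one Bochner_Integration.integrable_add
          integrable_mult_right integrable_divide integrable_abs) auto
    also have "\<dots> = k * expectation (\<lambda>\<omega>. min 1 \<bar>Y n \<omega>\<bar>) + expectation (\<lambda>\<omega>. \<bar>Z n \<omega>\<bar>) / k"
      using Z by (subst Bochner_Integration.integral_add) (auto intro: integrable_min_one)
    also have "\<dots> \<le> k * expectation (\<lambda>\<omega>. min 1 \<bar>Y n \<omega>\<bar>) + K / k"
      using K[of n] that by (auto intro: divide_right_mono)
    finally show ?thesis .
  qed
  have "(\<lambda>n. expectation (\<lambda>\<omega>. min 1 \<bar>Y n \<omega> * Z n \<omega>\<bar>)) \<longlonglongrightarrow> 0"
  proof (rule tendstoI)
    fix e :: real assume e: "e > 0"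
    define k where "k = 1 + 2 * K / e"
    have k: "k \<ge> 1" using e K0 by (simp add: k_def)
    have Kk: "K / k < e / 2"
    proof -
      have "e * k = e + 2 * K" using e by (simp add: k_def field_simps)
      then have "K * 2 < e * k" using e by linarith
      then show ?thesis using k by (simp add: field_simps)
    qed
    have "(\<lambda>n. k * expectation (\<lambda>\<omega>. min 1 \<bar>Y n \<omega>\<bar>)) \<longlonglongrightarrow> k * 0"
      using Y by (intro tendsto_mult tendsto_const) (simp add: to_zero_prob_def)
    then have "eventually (\<lambda>n. k * expectation (\<lambda>\<omega>. min 1 \<bar>Y n \<omega>\<bar>) < e / 2) sequentially"
      by (rule order_tendstoD(2)) (use e in simp)
    then show "eventually (\<lambda>n. dist (expectation (\<lambda>\<omega>. min 1 \<bar>Y n \<omega> * Z n \<omega>\<bar>)) 0 < e) sequentially"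
    proof eventually_elim
      case (elim n)
      have "0 \<le> expectation (\<lambda>\<omega>. min 1 \<bar>Y n \<omega> * Z n \<omega>\<bar>)" by (rule integral_nonneg_AE) auto
      moreover have "expectation (\<lambda>\<omega>. min 1 \<bar>Y n \<omega> * Z n \<omega>\<bar>) < e"
        using bd[OF k, of n] elim Kk by linarith
      ultimately show ?case by (simp add: dist_real_def)
    qed
  qed
  then show ?thesis by (simp add: to_zero_prob_def)
qed

lemma to_zero_prob_cmult:
  assumes "to_zero_prob M Y"
  shows "to_zero_prob M (\<lambda>n \<omega>. c * Y n \<omega>)"
  using to_zero_prob_mult_bounded[OF assms, of "\<lambda>n \<omega>. c" "\<bar>c\<bar>"] by (simp add: mult.commute prob_space)

lemma to_zero_prob_diff:
  assumes "to_zero_prob M Y" "to_zero_prob M Z"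
  shows "to_zero_prob M (\<lambda>n \<omega>. Y n \<omega> - Z n \<omega>)"
  using to_zero_prob_add[OF assms(1) to_zero_prob_cmult[OF assms(2), of "-1"]] by simp

lemma to_zero_prob_zero: "to_zero_prob M (\<lambda>n \<omega>. 0)"
  by (simp add: to_zero_prob_def)

lemma to_zero_prob_sum:
  assumes "\<And>i. i \<in> I \<Longrightarrow> to_zero_prob M (Y i)"
  shows "to_zero_prob M (\<lambda>n \<omega>. \<Sum>i\<in>I. Y i n \<omega>)"
  using assms by (induction I rule: infinite_finite_induct) (auto intro: to_zero_prob_zero to_zero_prob_add)

lemma to_zero_prob_L1:
  assumes int: "\<And>n. integrable M (Y n)" and lim: "(\<lambda>n. expectation (\<lambda>\<omega>. \<bar>Y n \<omega>\<bar>)) \<longlonglongrightarrow> 0"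
  shows "to_zero_prob M Y"
  by (rule to_zero_prob_bound[OF _ _ _ lim]) (use int in auto)

lemma integrable_of_square:
  assumes [measurable]: "Y \<in> borel_measurable M" and "integrable M (\<lambda>\<omega>. (Y \<omega>)\<^sup>2)"
  shows "integrable M (Y :: 'a \<Rightarrow> real)"
proof (rule Bochner_Integration.integrable_bound)
  show "integrable M (\<lambda>\<omega>. 1 + (Y \<omega>)\<^sup>2)" using assms by auto
  have "\<bar>y\<bar> \<le> 1 + y\<^sup>2" for y :: real
    using zero_le_power2[of "\<bar>y\<bar> - 1"] zero_le_power2[of y] by (simp add: power2_diff)
  then show "AE \<omega> in M. norm (Y \<omega>) \<le> norm (1 + (Y \<omega>)\<^sup>2)" by (auto intro!: AE_I2)
qed auto

text \<open>The variance of |Y| is nonnegative.\<close>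

lemma expectation_abs_le_sqrt:
  assumes [measurable]: "Y \<in> borel_measurable M" and int: "integrable M (\<lambda>\<omega>. (Y \<omega> :: real)\<^sup>2)"
  shows "expectation (\<lambda>\<omega>. \<bar>Y \<omega>\<bar>) \<le> sqrt (expectation (\<lambda>\<omega>. (Y \<omega>)\<^sup>2))"
proof (rule real_le_rsqrt)
  have iY: "integrable M (\<lambda>\<omega>. \<bar>Y \<omega>\<bar>)" using integrable_of_square[OF assms] by simp
  have "variance (\<lambda>\<omega>. \<bar>Y \<omega>\<bar>) = expectation (\<lambda>\<omega>. \<bar>Y \<omega>\<bar>\<^sup>2) - (expectation (\<lambda>\<omega>. \<bar>Y \<omega>\<bar>))\<^sup>2"
    by (rule variance_eq[OF iY]) (use int in simp)
  then show "(expectation (\<lambda>\<omega>. \<bar>Y \<omega>\<bar>))\<^sup>2 \<le> expectation (\<lambda>\<omega>. (Y \<omega>)\<^sup>2)"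
    using variance_positive[of "\<lambda>\<omega>. \<bar>Y \<omega>\<bar>"] by simp
qed

lemma to_zero_prob_tail:
  assumes Y: "to_zero_prob M Y" and e: "e > 0"
  shows "(\<lambda>n. prob {\<omega>\<in>space M. \<bar>Y n \<omega>\<bar> > e}) \<longlonglongrightarrow> 0"
proof -
  have [measurable]: "\<And>n. Y n \<in> borel_measurable M" using Y by (simp add: to_zero_prob_def)
  have le: "prob {\<omega>\<in>space M. \<bar>Y n \<omega>\<bar> > e} \<le> expectation (\<lambda>\<omega>. min 1 \<bar>Y n \<omega>\<bar>) / min 1 e" for n
  proof -
    have "prob {\<omega>\<in>space M. \<bar>Y n \<omega>\<bar> > e} = expectation (indicator {\<omega>\<in>space M. \<bar>Y n \<omega>\<bar> > e})" by simp
    also have "\<dots> \<le> expectation (\<lambda>\<omega>. min 1 \<bar>Y n \<omega>\<bar> / min 1 e)"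
      using e by (intro integral_mono integrable_divide integrable_min_one)
        (auto simp: indicator_def emeasure_eq_measure min_def field_simps)
    finally show ?thesis by simp
  qed
  have "(\<lambda>n. expectation (\<lambda>\<omega>. min 1 \<bar>Y n \<omega>\<bar>) / min 1 e) \<longlonglongrightarrow> 0 / min 1 e"
    using Y e by (intro tendsto_divide tendsto_const) (auto simp: to_zero_prob_def)
  then have lim: "(\<lambda>n. expectation (\<lambda>\<omega>. min 1 \<bar>Y n \<omega>\<bar>) / min 1 e) \<longlonglongrightarrow> 0" by simp
  show ?thesis
    by (rule tendsto_sandwich[OF _ _ tendsto_const lim]) (simp_all add: le)
qed

lemma integrable_cis [simp]:
  assumes [measurable]: "f \<in> borel_measurable M"
  shows "integrable M (\<lambda>\<omega>. cis (f \<omega>))"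
  by (rule integrable_const_bound[where B=1]) auto

lemma norm_cis_diff: "norm (cis a - cis b) \<le> 2 * min 1 \<bar>a - b\<bar>"
proof -
  have "norm (cis a - cis b) \<le> \<bar>a - b\<bar>"
  proof -
    have "cis a - cis b = cis b * (cis (a - b) - 1)" by (simp add: algebra_simps cis_mult)
    then have "norm (cis a - cis b) = norm (cis (a - b) - 1)" by (simp add: norm_mult)
    also have "\<dots> \<le> \<bar>a - b\<bar>"
      using iexp_approx1[of "a - b" 0] by (simp add: cis_conv_exp)
    finally show ?thesis .
  qed
  moreover have "norm (cis a - cis b) \<le> 2" using norm_triangle_ineq4[of "cis a" "cis b"] by simp
  ultimately show ?thesis by (smt (verit) min_def)
qed

text \<open>Slutsky for characteristic functions: \<open>cis\<close> is bounded and 1-Lipschitz, so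
  the two expectations differ by at most twice the truncated distance.\<close>

lemma char_tendsto_of_to_zero_prob:
  assumes [measurable]: "\<And>n. Y n \<in> borel_measurable M" "\<And>n. Z n \<in> borel_measurable M"
    and D: "to_zero_prob M (\<lambda>n \<omega>. Y n \<omega> - Z n \<omega>)"
    and Z: "(\<lambda>n. expectation (\<lambda>\<omega>. cis (Z n \<omega>))) \<longlonglongrightarrow> l"
  shows "(\<lambda>n. expectation (\<lambda>\<omega>. cis (Y n \<omega>))) \<longlonglongrightarrow> l"
proof (rule Lim_transform[OF Z], rule Lim_null_comparison)
  show "eventually (\<lambda>n. norm (expectation (\<lambda>\<omega>. cis (Y n \<omega>)) - expectation (\<lambda>\<omega>. cis (Z n \<omega>)))
      \<le> 2 * expectation (\<lambda>\<omega>. min 1 \<bar>Y n \<omega> - Z n \<omega>\<bar>)) sequentially"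
  proof (rule always_eventually, rule allI)
    fix n
    have "norm (expectation (\<lambda>\<omega>. cis (Y n \<omega>)) - expectation (\<lambda>\<omega>. cis (Z n \<omega>)))
      = norm (expectation (\<lambda>\<omega>. cis (Y n \<omega>) - cis (Z n \<omega>)))"
      by (subst Bochner_Integration.integral_diff) simp_all
    also have "\<dots> \<le> expectation (\<lambda>\<omega>. norm (cis (Y n \<omega>) - cis (Z n \<omega>)))"
      by (rule integral_norm_bound)
    also have "\<dots> \<le> expectation (\<lambda>\<omega>. 2 * min 1 \<bar>Y n \<omega> - Z n \<omega>\<bar>)"
      by (intro integral_mono integrable_mult_right integrable_min_one integrable_norm
          Bochner_Integration.integrable_diff integrable_cis norm_cis_diff) measurable
    finally show "norm (expectation (\<lambda>\<omega>. cis (Y n \<omega>)) - expectation (\<lambda>\<omega>. cis (Z n \<omega>)))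
      \<le> 2 * expectation (\<lambda>\<omega>. min 1 \<bar>Y n \<omega> - Z n \<omega>\<bar>)" by simp
  qed
  show "(\<lambda>n. 2 * expectation (\<lambda>\<omega>. min 1 \<bar>Y n \<omega> - Z n \<omega>\<bar>)) \<longlonglongrightarrow> 0"
    using tendsto_mult[OF tendsto_const, of _ 0 sequentially 2] D by (auto simp: to_zero_prob_def)
qed

end

section \<open>A central limit theorem for predictable sums\<close>

locale noise = prob_space M for M :: "'a measure" +
  fixes V :: "nat \<Rightarrow> 'a \<Rightarrow> real" and \<sigma>2 :: real
  assumes indep_V: "indep_vars (\<lambda>_. borel) V {1..}"
    and distr_V: "\<And>n. n \<ge> 1 \<Longrightarrow> distr M borel (V n) = distr M borel (V 1)"
    and mean_V: "\<And>n. n \<ge> 1 \<Longrightarrow> expectation (V n) = 0"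
    and square_V: "\<And>n. n \<ge> 1 \<Longrightarrow> expectation (\<lambda>\<omega>. (V n \<omega>)\<^sup>2) = \<sigma>2"
    and fourth_V: "\<And>n. n \<ge> 1 \<Longrightarrow> integrable M (\<lambda>\<omega>. (V n \<omega>) ^ 4)"
begin

section \<open>Independence of the noise from its past\<close>

lemma measurable_V: "n \<ge> 1 \<Longrightarrow> V n \<in> borel_measurable M"
  using indep_V by (auto simp: indep_vars_def)

lemma integrable_V2: "n \<ge> 1 \<Longrightarrow> integrable M (\<lambda>\<omega>. (V n \<omega>)\<^sup>2)"
  using integrable_of_square[of "\<lambda>\<omega>. (V n \<omega>)\<^sup>2"] fourth_V[of n] measurable_V[of n] by simp

lemma integrable_V: "n \<ge> 1 \<Longrightarrow> integrable M (V n)"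
  using integrable_of_square[of "V n"] integrable_V2[of n] measurable_V[of n] by simp

lemma \<sigma>2_nonneg: "\<sigma>2 \<ge> 0"
  using square_V[of 1] integral_nonneg_AE[of "\<lambda>\<omega>. (V 1 \<omega>)\<^sup>2" M] by simp

text \<open>The sigma-algebra of the noise strictly before time \<open>k\<close>, so that a process
  with \<open>h k\<close> measurable for \<open>past k\<close> is predictable.\<close>

definition past :: "nat \<Rightarrow> 'a measure" where
  "past k = vimage_algebra (space M) (\<lambda>\<omega>. \<lambda>j\<in>{1..<k}. V j \<omega>) (Pi\<^sub>M {1..<k} (\<lambda>_. borel))"

lemma space_past [simp]: "space (past k) = space M"
  by (simp add: past_def)

lemma measurable_restrict_V: "(\<lambda>\<omega>. \<lambda>j\<in>{1..<k}. V j \<omega>) \<in> measurable (past k) (Pi\<^sub>M {1..<k} (\<lambda>_. borel))"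
  unfolding past_def by (rule measurable_vimage_algebra1) (auto simp: space_PiM)

lemma measurable_V_past:
  assumes "1 \<le> j" "j < k" shows "V j \<in> borel_measurable (past k)"
proof -
  have "(\<lambda>\<omega>. (\<lambda>j\<in>{1..<k}. V j \<omega>) j) \<in> borel_measurable (past k)"
    using assms by (intro measurable_compose[OF measurable_restrict_V measurable_component_singleton]) auto
  then show ?thesis using assms by simp
qed

lemma measurable_past_M: "f \<in> measurable (past k) N \<Longrightarrow> f \<in> measurable M N"
proof -
  assume f: "f \<in> measurable (past k) N"
  have "(\<lambda>\<omega>. \<omega>) \<in> measurable M (past k)"
    unfolding past_def
    by (rule measurable_vimage_algebra2) (auto intro!: measurable_restrict measurable_V)
  from measurable_compose[OF this f] show ?thesis .
qed

lemma measurable_past_mono: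
  assumes f: "f \<in> measurable (past k) N" and "k \<le> l" shows "f \<in> measurable (past l) N"
proof -
  have "(\<lambda>\<omega>. \<omega>) \<in> measurable (past l) (past k)"
    unfolding past_def[of k]
    by (rule measurable_vimage_algebra2) (use \<open>k \<le> l\<close> in \<open>auto intro!: measurable_restrict measurable_V_past\<close>)
  from measurable_compose[OF this f] show ?thesis .
qed

text \<open>Disjoint blocks of an independent family are independent; here the blocks are the
  indices below \<open>k\<close> and \<open>k\<close> alone, and every event of \<open>V k\<close>
  is an event of the second block.\<close>

lemma indep_set_past:
  assumes k: "k \<ge> 1"
  shows "indep_set (sets (past k)) (sigma_sets (space M) {V k -` A \<inter> space M | A. A \<in> sets borel})"
proof -
  let ?K = "case_bool {1..<k} {k}"
  let ?Z = "\<lambda>\<omega>. \<lambda>j\<in>{1..<k}. V j \<omega>"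
  let ?P = "Pi\<^sub>M {1..<k} (\<lambda>_. borel :: real measure)"
  have "indep_vars (\<lambda>j. Pi\<^sub>M (?K j) (\<lambda>_. borel)) (\<lambda>j \<omega>. restrict (\<lambda>i. V i \<omega>) (?K j)) UNIV"
    by (rule indep_vars_restrict[OF indep_V]) (use k in \<open>auto simp: disjoint_family_on_def split: bool.split\<close>)
  also have "(\<lambda>j. Pi\<^sub>M (?K j) (\<lambda>_. borel :: real measure)) = case_bool ?P (Pi\<^sub>M {k} (\<lambda>_. borel))"
    by (auto simp: fun_eq_iff split: bool.split)
  also have "(\<lambda>j \<omega>. restrict (\<lambda>i. V i \<omega>) (?K j)) = case_bool ?Z (\<lambda>\<omega>. \<lambda>j\<in>{k}. V j \<omega>)"
    by (auto simp: fun_eq_iff split: bool.split)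
  finally have i: "indep_var ?P ?Z (Pi\<^sub>M {k} (\<lambda>_. borel)) (\<lambda>\<omega>. \<lambda>j\<in>{k}. V j \<omega>)"
    by (simp only: indep_var_def)
  let ?V = "\<lambda>\<omega>. \<lambda>j\<in>{k}. V j \<omega>" and ?Q = "Pi\<^sub>M {k} (\<lambda>_. borel :: real measure)"
  have s: "{V k -` A \<inter> space M | A. A \<in> sets borel} \<subseteq> {?V -` A \<inter> space M | A. A \<in> sets ?Q}"
  proof safe
    fix A :: "real set" assume A: "A \<in> sets borel"
    have "(\<lambda>g. g k) -` A \<inter> space ?Q \<in> sets ?Q"
      by (rule measurable_sets[OF _ A]) auto
    moreover have "V k -` A \<inter> space M = ?V -` ((\<lambda>g. g k) -` A \<inter> space ?Q) \<inter> space M"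
      by (auto simp: space_PiM)
    ultimately show "\<exists>B. V k -` A \<inter> space M = ?V -` B \<inter> space M \<and> B \<in> sets ?Q" by blast
  qed
  have p: "sets (past k) \<subseteq> sigma_sets (space M) {?Z -` A \<inter> space M | A. A \<in> sets ?P}"
    unfolding past_def by (subst sets_vimage_algebra2) (auto simp: space_PiM)
  have "indep_set (sigma_sets (space M) {?Z -` A \<inter> space M | A. A \<in> sets ?P})
      (sigma_sets (space M) {?V -` A \<inter> space M | A. A \<in> sets ?Q})"
    using i by (simp add: indep_var_eq)
  then show ?thesis
    unfolding indep_set_def
    by (rule indep_sets_mono_sets) (use p sigma_sets_mono'[OF s] in \<open>auto split: bool.split\<close>)
qed

lemma indep_var_past:
  assumes f: "f \<in> measurable (past k) N" and k: "k \<ge> 1"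
  shows "indep_var N f borel (V k)"
proof -
  have "{f -` A \<inter> space M | A. A \<in> sets N} \<subseteq> sets (past k)"
    using measurable_sets[OF f] by auto
  then have "sigma_sets (space M) {f -` A \<inter> space M | A. A \<in> sets N} \<subseteq> sets (past k)"
    using sets.sigma_sets_subset[of _ "past k"] by simp
  then have "indep_set (sigma_sets (space M) {f -` A \<inter> space M | A. A \<in> sets N})
      (sigma_sets (space M) {V k -` A \<inter> space M | A. A \<in> sets borel})"
    using indep_set_past[OF k] unfolding indep_set_def
    by (elim indep_sets_mono_sets) (auto split: bool.split)
  then show ?thesis
    using measurable_past_M[OF f] measurable_V[OF k] by (simp add: indep_var_eq)
qed

text \<open>Independence as a product law, so that Fubini applies to functions of the past and
  \<open>V k\<close> that do not factor, such as \<open>cis (s * V k)\<close> with random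
  \<open>s\<close>.\<close>

lemma joint_distr_past:
  assumes f: "f \<in> measurable (past k) N" and k: "k \<ge> 1"
  shows "distr M N f \<Otimes>\<^sub>M distr M borel (V k) = distr M (N \<Otimes>\<^sub>M borel) (\<lambda>\<omega>. (f \<omega>, V k \<omega>))"
proof (rule pair_measure_eqI)
  note [measurable] = measurable_past_M[OF f] measurable_V[OF k]
  show "sigma_finite_measure (distr M N f)" "sigma_finite_measure (distr M borel (V k))"
    using prob_space_distr[of f N] prob_space_distr[of "V k" borel]
    by (auto intro!: prob_space_imp_sigma_finite)
  show "sets (distr M N f \<Otimes>\<^sub>M distr M borel (V k)) = sets (distr M (N \<Otimes>\<^sub>M borel) (\<lambda>\<omega>. (f \<omega>, V k \<omega>)))"
    by (auto intro!: sets_pair_measure_cong)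
  fix A B assume "A \<in> sets (distr M N f)" "B \<in> sets (distr M borel (V k))"
  then have [measurable]: "A \<in> sets N" "B \<in> sets borel" by auto
  have fA: "f -` A \<inter> space M \<in> sets (past k)" using measurable_sets[OF f, of A] by simp
  have eq: "(\<lambda>\<omega>. (f \<omega>, V k \<omega>)) -` (A \<times> B) \<inter> space M = (f -` A \<inter> space M) \<inter> (V k -` B \<inter> space M)" by auto
  have "prob ((f -` A \<inter> space M) \<inter> (V k -` B \<inter> space M)) = prob (f -` A \<inter> space M) * prob (V k -` B \<inter> space M)"
    by (rule indep_setD[OF indep_set_past[OF k] fA]) (auto intro!: sigma_sets.Basic)
  then show "emeasure (distr M N f) A * emeasure (distr M borel (V k)) B
      = emeasure (distr M (N \<Otimes>\<^sub>M borel) (\<lambda>\<omega>. (f \<omega>, V k \<omega>))) (A \<times> B)"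
    by (simp add: emeasure_distr eq emeasure_eq_measure ennreal_mult)
qed

lemma
  fixes f :: "'a \<Rightarrow> real"
  assumes f: "f \<in> borel_measurable (past k)" "integrable M f" and k: "k \<ge> 1"
    and g: "g \<in> borel_measurable borel" "integrable M (\<lambda>\<omega>. g (V k \<omega>))"
  shows integrable_past_mult: "integrable M (\<lambda>\<omega>. f \<omega> * g (V k \<omega>))"
    and expectation_past_mult:
      "expectation (\<lambda>\<omega>. f \<omega> * g (V k \<omega>)) = expectation f * expectation (\<lambda>\<omega>. g (V k \<omega>))"
proof -
  have "indep_var borel f borel (\<lambda>\<omega>. g (V k \<omega>))"
    using indep_var_compose[OF indep_var_past[OF f(1) k] measurable_ident g(1)] by (simp add: comp_def)
  from indep_var_integrable[OF this f(2) g(2)] indep_var_lebesgue_integral[OF this f(2) g(2)]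
  show "integrable M (\<lambda>\<omega>. f \<omega> * g (V k \<omega>))"
    "expectation (\<lambda>\<omega>. f \<omega> * g (V k \<omega>)) = expectation f * expectation (\<lambda>\<omega>. g (V k \<omega>))" by simp_all
qed

text \<open>Given the past, \<open>G\<close> and \<open>s\<close> are constants, and integrating out
  \<open>V k\<close> leaves its characteristic function at \<open>s\<close>.\<close>

lemma expectation_past_cis:
  fixes G :: "'a \<Rightarrow> complex" and s :: "'a \<Rightarrow> real"
  assumes G: "G \<in> borel_measurable (past k)" and s: "s \<in> borel_measurable (past k)" and k: "k \<ge> 1"
    and B: "\<And>\<omega>. \<omega> \<in> space M \<Longrightarrow> norm (G \<omega>) \<le> B"
  shows "expectation (\<lambda>\<omega>. G \<omega> * cis (s \<omega> * V k \<omega>))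
    = expectation (\<lambda>\<omega>. G \<omega> * char (distr M borel (V k)) (s \<omega>))"
proof -
  let ?Z = "\<lambda>\<omega>. (G \<omega>, s \<omega>)"
  let ?N = "borel \<Otimes>\<^sub>M borel :: (complex \<times> real) measure"
  have Z: "?Z \<in> measurable (past k) ?N" using G s by measurable
  note ZM[measurable] = measurable_past_M[OF Z]
  note VM[measurable] = measurable_V[OF k]
  have [measurable]: "G \<in> borel_measurable M" using G by (rule measurable_past_M)
  have [measurable]: "s \<in> borel_measurable M" using s by (rule measurable_past_M)
  have D: "distr M ?N ?Z \<Otimes>\<^sub>M distr M borel (V k) = distr M (?N \<Otimes>\<^sub>M borel) (\<lambda>\<omega>. (?Z \<omega>, V k \<omega>))"
    by (rule joint_distr_past[OF Z k])
  interpret Z: prob_space "distr M ?N ?Z" by (rule prob_space_distr) measurable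
  interpret W: real_distribution "distr M borel (V k)" by (rule real_distribution_distr) measurable
  interpret P: pair_sigma_finite "distr M ?N ?Z" "distr M borel (V k)" by standard
  let ?f = "\<lambda>x::(complex \<times> real) \<times> real. fst (fst x) * cis (snd (fst x) * snd x)"
  have [measurable]: "?f \<in> borel_measurable (?N \<Otimes>\<^sub>M borel)" by measurable
  have int: "integrable M (\<lambda>\<omega>. ?f (?Z \<omega>, V k \<omega>))"
    by (rule integrable_const_bound[where B=B]) (use B in \<open>auto simp: norm_mult\<close>)
  then have int': "integrable (distr M ?N ?Z \<Otimes>\<^sub>M distr M borel (V k)) ?f"
    unfolding D by (subst integrable_distr_eq) auto
  have "expectation (\<lambda>\<omega>. G \<omega> * cis (s \<omega> * V k \<omega>)) = expectation (\<lambda>\<omega>. ?f (?Z \<omega>, V k \<omega>))"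
    by simp
  also have "\<dots> = (\<integral>x. ?f x \<partial>distr M (?N \<Otimes>\<^sub>M borel) (\<lambda>\<omega>. (?Z \<omega>, V k \<omega>)))"
    by (rule integral_distr[symmetric]) auto
  also have "\<dots> = (\<integral>z. (\<integral>v. ?f (z, v) \<partial>distr M borel (V k)) \<partial>distr M ?N ?Z)"
    unfolding D[symmetric] by (rule P.integral_fst'[OF int', symmetric])
  also have "\<dots> = (\<integral>z. fst z * char (distr M borel (V k)) (snd z) \<partial>distr M ?N ?Z)"
    by (intro Bochner_Integration.integral_cong)
      (auto simp: char_def cis_conv_exp split_beta)
  also have "\<dots> = expectation (\<lambda>\<omega>. G \<omega> * char (distr M borel (V k)) (s \<omega>))"
    by (subst integral_distr) auto
  finally show ?thesis .
qed

text \<open>Orthogonality of martingale increments: in the square of the sum, the cross term is a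
  past-measurable factor times the centred \<open>g (V k)\<close> and has expectation 0, so each
  step adds at most \<open>K * s\<close>.\<close>

lemma
  fixes h :: "nat \<Rightarrow> 'a \<Rightarrow> real" and g :: "real \<Rightarrow> real"
  assumes h: "\<And>k. k \<ge> 1 \<Longrightarrow> h k \<in> borel_measurable (past k)"
    and ih: "\<And>k. k \<ge> 1 \<Longrightarrow> integrable M (\<lambda>\<omega>. (h k \<omega>)\<^sup>2)"
    and Eh: "\<And>k. k \<ge> 1 \<Longrightarrow> expectation (\<lambda>\<omega>. (h k \<omega>)\<^sup>2) \<le> K"
    and g: "g \<in> borel_measurable borel"
    and ig: "\<And>k. k \<ge> 1 \<Longrightarrow> integrable M (\<lambda>\<omega>. (g (V k \<omega>))\<^sup>2)"
    and Eg: "\<And>k. k \<ge> 1 \<Longrightarrow> expectation (\<lambda>\<omega>. g (V k \<omega>)) = 0"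
    and Eg2: "\<And>k. k \<ge> 1 \<Longrightarrow> expectation (\<lambda>\<omega>. (g (V k \<omega>))\<^sup>2) \<le> s"
  shows measurable_martingale: "(\<lambda>\<omega>. \<Sum>k=1..n. h k \<omega> * g (V k \<omega>)) \<in> borel_measurable (past (Suc n))"
    and integrable_martingale_square: "integrable M (\<lambda>\<omega>. (\<Sum>k=1..n. h k \<omega> * g (V k \<omega>))\<^sup>2)"
    and expectation_martingale_square: "expectation (\<lambda>\<omega>. (\<Sum>k=1..n. h k \<omega> * g (V k \<omega>))\<^sup>2) \<le> real n * K * s"
proof -
  let ?S = "\<lambda>n \<omega>. \<Sum>k=1..n. h k \<omega> * g (V k \<omega>)"
  have meas: "?S n \<in> borel_measurable (past (Suc n))" for n
  proof (intro borel_measurable_sum borel_measurable_times)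
    fix k assume k: "k \<in> {1..n}"
    show "h k \<in> borel_measurable (past (Suc n))" using h[of k] k by (auto intro: measurable_past_mono)
    show "(\<lambda>\<omega>. g (V k \<omega>)) \<in> borel_measurable (past (Suc n))"
      using k by (intro measurable_compose[OF measurable_V_past g]) auto
  qed
  have s0: "s \<ge> 0" by (rule order_trans[OF _ Eg2[of 1]]) simp_all
  have "integrable M (\<lambda>\<omega>. (?S n \<omega>)\<^sup>2) \<and> expectation (\<lambda>\<omega>. (?S n \<omega>)\<^sup>2) \<le> real n * K * s"
  proof (induction n)
    case (Suc n)
    let ?k = "Suc n"
    have k: "?k \<ge> 1" by simp
    have hm: "h ?k \<in> borel_measurable (past ?k)" using h[OF k] .
    note [measurable] = measurable_past_M[OF meas[of n]] measurable_past_M[OF hm]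
      measurable_compose[OF measurable_V[OF k] g]
    have iSh: "integrable M (\<lambda>\<omega>. ?S n \<omega> * h ?k \<omega>)"
    proof (rule Bochner_Integration.integrable_bound)
      show "integrable M (\<lambda>\<omega>. (?S n \<omega>)\<^sup>2 + (h ?k \<omega>)\<^sup>2)" using Suc ih[OF k] by auto
      show "AE \<omega> in M. norm (?S n \<omega> * h ?k \<omega>) \<le> norm ((?S n \<omega>)\<^sup>2 + (h ?k \<omega>)\<^sup>2)"
        using abs_mult_le_squares by auto
    qed measurable
    have igk: "integrable M (\<lambda>\<omega>. g (V ?k \<omega>))"
      by (rule integrable_of_square[OF _ ig[OF k]]) measurable
    have m1: "(\<lambda>\<omega>. ?S n \<omega> * h ?k \<omega>) \<in> borel_measurable (past ?k)"
      using meas[of n] hm by (intro borel_measurable_times) auto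
    have m2: "(\<lambda>\<omega>. (h ?k \<omega>)\<^sup>2) \<in> borel_measurable (past ?k)" using hm by measurable
    have g2: "(\<lambda>x. (g x)\<^sup>2) \<in> borel_measurable borel" using g by measurable
    note c1 = integrable_past_mult[OF m1 iSh k g igk] expectation_past_mult[OF m1 iSh k g igk]
    note c2 = integrable_past_mult[OF m2 ih[OF k] k g2 ig[OF k]] expectation_past_mult[OF m2 ih[OF k] k g2 ig[OF k]]
    have eq: "(?S ?k \<omega>)\<^sup>2 = (?S n \<omega>)\<^sup>2 + 2 * (?S n \<omega> * h ?k \<omega> * g (V ?k \<omega>)) + (h ?k \<omega>)\<^sup>2 * (g (V ?k \<omega>))\<^sup>2" for \<omega>
      by (simp add: power2_sum power_mult_distrib)
    have i: "integrable M (\<lambda>\<omega>. (?S ?k \<omega>)\<^sup>2)"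
      unfolding eq using Suc c1(1) c2(1) by (intro Bochner_Integration.integrable_add integrable_mult_right) auto
    have "expectation (\<lambda>\<omega>. (?S ?k \<omega>)\<^sup>2) = expectation (\<lambda>\<omega>. (?S n \<omega>)\<^sup>2)
        + 2 * expectation (\<lambda>\<omega>. ?S n \<omega> * h ?k \<omega> * g (V ?k \<omega>)) + expectation (\<lambda>\<omega>. (h ?k \<omega>)\<^sup>2 * (g (V ?k \<omega>))\<^sup>2)"
      unfolding eq using Suc c1(1) c2(1) by (simp add: mult.assoc)
    also have "\<dots> \<le> real n * K * s + K * s"
    proof -
      have "expectation (\<lambda>\<omega>. (h ?k \<omega>)\<^sup>2) * expectation (\<lambda>\<omega>. (g (V ?k \<omega>))\<^sup>2) \<le> K * s"
        using Eh[OF k] Eg2[OF k] s0 order_trans[OF _ Eh[OF k], of 0] by (intro mult_mono) simp_all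
      then show ?thesis unfolding c1(2) c2(2) Eg[OF k] using Suc by simp
    qed
    finally show ?case using i by (simp add: algebra_simps)
  qed simp
  then show "integrable M (\<lambda>\<omega>. (?S n \<omega>)\<^sup>2)" "expectation (\<lambda>\<omega>. (?S n \<omega>)\<^sup>2) \<le> real n * K * s"
    "?S n \<in> borel_measurable (past (Suc n))"
    using meas by auto
qed

end

section \<open>The exponential martingale and the central limit theorem\<close>

lemma exp_minus_quadratic_bound:
  fixes x :: real
  assumes "x \<ge> 0"
  shows "\<bar>exp (- x) - (1 - x)\<bar> \<le> x\<^sup>2"
proof -
  have "1 - x \<le> exp (- x)" using exp_ge_add_one_self[of "-x"] by simp
  moreover have "exp (- x) \<le> 1 - x + x\<^sup>2"
  proof -
    have "exp (- x) \<le> 1 / (1 + x)"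
      using exp_ge_add_one_self[of x] assms by (simp add: exp_minus field_simps)
    also have "\<dots> \<le> 1 - x + x\<^sup>2"
    proof -
      have "(1 - x + x\<^sup>2) * (1 + x) = 1 + x ^ 3" by (simp add: power2_eq_square power3_eq_cube algebra_simps)
      then have "1 \<le> (1 - x + x\<^sup>2) * (1 + x)" using assms by simp
      then show ?thesis using assms by (simp add: pos_divide_le_eq)
    qed
    finally show ?thesis .
  qed
  ultimately show ?thesis by simp
qed

lemma exp_Lipschitz_below:
  fixes x y :: real
  assumes "x \<le> C" "y \<le> C"
  shows "\<bar>exp x - exp y\<bar> \<le> exp C * min 1 \<bar>x - y\<bar>"
proof -
  have *: "exp b - exp a \<le> exp C * min 1 (b - a) \<and> exp b - exp a \<ge> 0" if "a \<le> b" "b \<le> C" for a b :: real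
  proof -
    have "exp b - exp a = exp b * (1 - exp (a - b))" by (simp add: algebra_simps exp_add[symmetric])
    also have "\<dots> \<le> exp C * min 1 (b - a)"
    proof (rule mult_mono)
      have "1 - exp (a - b) \<le> b - a" using exp_ge_add_one_self[of "a - b"] by linarith
      then show "1 - exp (a - b) \<le> min 1 (b - a)" by simp
    qed (use that in auto)
    finally show ?thesis using that by simp
  qed
  show ?thesis
    using *[of x y] *[of y x] assms by (cases "x \<le> y") (auto simp: abs_minus_commute abs_if)
qed

context noise
begin

text \<open>The characteristic function and its Gaussian counterpart both have the expansion
  \<open>1 - \<sigma>2 * s\<^sup>2 / 2\<close>, with errors of order |s|^3 and s^4. The quotient
  form is the one that a step of the exponential martingale produces.\<close>

lemma char_V_approx:
  assumes k: "k \<ge> 1"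
  shows "norm (char (distr M borel (V k)) s * of_real (exp (\<sigma>2 * s\<^sup>2 / 2)) - 1)
    \<le> exp (\<sigma>2 * s\<^sup>2 / 2) * (expectation (\<lambda>\<omega>. \<bar>V 1 \<omega>\<bar> ^ 3) * \<bar>s\<bar> ^ 3 + \<sigma>2\<^sup>2 * s ^ 4)"
proof -
  let ?x = "\<sigma>2 * s\<^sup>2 / 2"
  let ?\<phi> = "char (distr M borel (V k)) s"
  have x0: "?x \<ge> 0" using \<sigma>2_nonneg by simp
  have [measurable]: "V 1 \<in> borel_measurable M" "V (Suc 0) \<in> borel_measurable M"
    using measurable_V[of 1] by simp_all
  have i3: "integrable M (\<lambda>\<omega>. \<bar>V 1 \<omega>\<bar> ^ 3)"
  proof (rule Bochner_Integration.integrable_bound)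
    show "integrable M (\<lambda>\<omega>. 1 + (V 1 \<omega>) ^ 4)" using fourth_V[of 1] by auto
    show "AE \<omega> in M. norm (\<bar>V 1 \<omega>\<bar> ^ 3) \<le> norm (1 + (V 1 \<omega>) ^ 4)"
      using abs_cube_le by (auto intro!: AE_I2)
  qed measurable
  have "norm (?\<phi> - (1 - s\<^sup>2 * \<sigma>2 / 2)) \<le> (s\<^sup>2 / 6) * expectation (\<lambda>\<omega>. min (6 * (V 1 \<omega>)\<^sup>2) (\<bar>s\<bar> * \<bar>V 1 \<omega>\<bar> ^ 3))"
  proof (rule char_approx3')
    show "variance (V 1) = \<sigma>2" using mean_V[of 1] square_V[of 1] by simp
  qed (use integrable_V[of 1] integrable_V2[of 1] mean_V[of 1] distr_V[OF k] in auto)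
  also have "\<dots> \<le> (s\<^sup>2 / 6) * expectation (\<lambda>\<omega>. \<bar>s\<bar> * \<bar>V 1 \<omega>\<bar> ^ 3)"
  proof (rule mult_left_mono)
    have "integrable M (\<lambda>\<omega>. min (6 * (V 1 \<omega>)\<^sup>2) (\<bar>s\<bar> * \<bar>V 1 \<omega>\<bar> ^ 3))"
      by (rule Bochner_Integration.integrable_bound[of _ "\<lambda>\<omega>. \<bar>s\<bar> * \<bar>V 1 \<omega>\<bar> ^ 3"]) (use i3 in auto)
    then show "expectation (\<lambda>\<omega>. min (6 * (V 1 \<omega>)\<^sup>2) (\<bar>s\<bar> * \<bar>V 1 \<omega>\<bar> ^ 3)) \<le> expectation (\<lambda>\<omega>. \<bar>s\<bar> * \<bar>V 1 \<omega>\<bar> ^ 3)"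
      using i3 by (intro integral_mono) auto
  qed simp
  also have "\<dots> = (expectation (\<lambda>\<omega>. \<bar>V 1 \<omega>\<bar> ^ 3) * \<bar>s\<bar> ^ 3) / 6"
    by (simp add: power2_eq_square power3_eq_cube flip: abs_mult)
  also have "\<dots> \<le> expectation (\<lambda>\<omega>. \<bar>V 1 \<omega>\<bar> ^ 3) * \<bar>s\<bar> ^ 3"
  proof -
    have "expectation (\<lambda>\<omega>. \<bar>V 1 \<omega>\<bar> ^ 3) * \<bar>s\<bar> ^ 3 \<ge> 0" by simp
    then show ?thesis by linarith
  qed
  finally have 1: "norm (?\<phi> - (1 - of_real ?x)) \<le> expectation (\<lambda>\<omega>. \<bar>V 1 \<omega>\<bar> ^ 3) * \<bar>s\<bar> ^ 3"
    by (simp add: mult.commute)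
  have "norm ((1 - of_real ?x) - complex_of_real (exp (- ?x))) = \<bar>exp (- ?x) - (1 - ?x)\<bar>"
    by (metis (no_types) norm_minus_commute norm_of_real of_real_1 of_real_diff)
  also have "\<dots> \<le> ?x\<^sup>2" by (rule exp_minus_quadratic_bound[OF x0])
  also have "?x\<^sup>2 \<le> \<sigma>2\<^sup>2 * s ^ 4"
    by (simp add: power_divide power_mult_distrib flip: power_mult)
  finally have 2: "norm ((1 - of_real ?x) - complex_of_real (exp (- ?x))) \<le> \<sigma>2\<^sup>2 * s ^ 4" .
  have "?\<phi> * of_real (exp ?x) - 1 = of_real (exp ?x) * ((?\<phi> - (1 - of_real ?x)) + ((1 - of_real ?x) - of_real (exp (- ?x))))"
    by (simp add: algebra_simps flip: of_real_mult exp_add)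
  also have "norm \<dots> = exp ?x * norm ((?\<phi> - (1 - of_real ?x)) + ((1 - of_real ?x) - complex_of_real (exp (- ?x))))"
    by (simp only: norm_mult norm_of_real abs_exp_cancel)
  also have "\<dots> \<le> exp ?x * (expectation (\<lambda>\<omega>. \<bar>V 1 \<omega>\<bar> ^ 3) * \<bar>s\<bar> ^ 3 + \<sigma>2\<^sup>2 * s ^ 4)"
    using order_trans[OF norm_triangle_ineq add_mono[OF 1 2]] by (intro mult_left_mono) auto
  finally show ?thesis .
qed

text \<open>The compensated product \<open>W\<close> is almost a martingale: conditionally on the
  past, one step multiplies it by a characteristic function times the inverse Gaussian factor, which
  is close to 1. The errors add up from \<open>W 0 = 1\<close>. The deterministic bound
  \<open>C\<close> on the sum of squares keeps the compensator bounded.\<close>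

lemma expectation_exponential_martingale:
  fixes s :: "nat \<Rightarrow> 'a \<Rightarrow> real"
  assumes s: "\<And>k. k \<ge> 1 \<Longrightarrow> s k \<in> borel_measurable (past k)"
    and C: "\<And>n \<omega>. \<omega> \<in> space M \<Longrightarrow> (\<Sum>k=1..n. (s k \<omega>)\<^sup>2) \<le> C"
    and i4: "\<And>k. k \<ge> 1 \<Longrightarrow> integrable M (\<lambda>\<omega>. (s k \<omega>) ^ 4)"
    and i3: "\<And>k. k \<ge> 1 \<Longrightarrow> integrable M (\<lambda>\<omega>. \<bar>s k \<omega>\<bar> ^ 3)"
    and b3: "\<And>k. k \<ge> 1 \<Longrightarrow> expectation (\<lambda>\<omega>. \<bar>s k \<omega>\<bar> ^ 3) \<le> b"
    and b4: "\<And>k. k \<ge> 1 \<Longrightarrow> expectation (\<lambda>\<omega>. (s k \<omega>) ^ 4) \<le> b"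
  shows "norm (expectation (\<lambda>\<omega>. cis (\<Sum>k=1..n. s k \<omega> * V k \<omega>) * of_real (exp (\<sigma>2 / 2 * (\<Sum>k=1..n. (s k \<omega>)\<^sup>2)))) - 1)
    \<le> real n * (exp (\<sigma>2 * C) * ((expectation (\<lambda>\<omega>. \<bar>V 1 \<omega>\<bar> ^ 3) + \<sigma>2\<^sup>2) * b))"
proof -
  define W where "W n \<omega> = cis (\<Sum>k=1..n. s k \<omega> * V k \<omega>) * of_real (exp (\<sigma>2 / 2 * (\<Sum>k=1..n. (s k \<omega>)\<^sup>2)))" for n \<omega>
  let ?E3 = "expectation (\<lambda>\<omega>. \<bar>V 1 \<omega>\<bar> ^ 3)"
  \<comment> \<open>Half of the exponent \<open>\<sigma>2 * C\<close> bounds \<open>W n\<close>, the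
    other half the new compensating factor.\<close>
  let ?D = "exp (\<sigma>2 * C) * ((?E3 + \<sigma>2\<^sup>2) * b)"
  have E3: "?E3 \<ge> 0" by simp
  have Wm: "W n \<in> borel_measurable (past (Suc n))" for n
  proof -
    have [measurable]: "s k \<in> borel_measurable (past (Suc n))" if "k \<in> {1..n}" for k
      using that s[of k] by (auto intro: measurable_past_mono)
    have [measurable]: "V k \<in> borel_measurable (past (Suc n))" if "k \<in> {1..n}" for k
      using that by (intro measurable_V_past) auto
    show ?thesis unfolding W_def[abs_def] by measurable
  qed
  have Wb: "norm (W n \<omega>) \<le> exp (\<sigma>2 / 2 * C)" if "\<omega> \<in> space M" for n \<omega>
    using C[OF that, of n] \<sigma>2_nonneg by (simp add: W_def norm_mult mult_left_mono)
  have iW: "integrable M (W n)" for n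
    by (rule integrable_const_bound[OF AE_I2[OF Wb] measurable_past_M[OF Wm]])
  have step: "norm (expectation (W (Suc n)) - expectation (W n)) \<le> ?D" for n
  proof -
    let ?k = "Suc n"
    have k: "?k \<ge> 1" by simp
    let ?\<phi> = "char (distr M borel (V ?k))"
    let ?e = "\<lambda>\<omega>. exp (\<sigma>2 * (s ?k \<omega>)\<^sup>2 / 2)"
    note sm[measurable] = s[OF k]
    note [measurable] = Wm[of n]
    have [measurable]: "s ?k \<in> borel_measurable M" using measurable_past_M[OF sm] .
    interpret R: real_distribution "distr M borel (V ?k)"
      by (rule real_distribution_distr[OF measurable_V]) simp
    have [measurable]: "?\<phi> \<in> borel_measurable borel" by (rule R.char_measurable)
    have sC: "(s ?k \<omega>)\<^sup>2 \<le> C" if "\<omega> \<in> space M" for \<omega>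
    proof -
      have "(s ?k \<omega>)\<^sup>2 \<le> (\<Sum>k=1..?k. (s k \<omega>)\<^sup>2)" by (rule member_le_sum) auto
      then show ?thesis using C[OF that, of ?k] by linarith
    qed
    have eb: "?e \<omega> \<le> exp (\<sigma>2 / 2 * C)" if "\<omega> \<in> space M" for \<omega>
      using mult_left_mono[OF sC[OF that], of "\<sigma>2"] \<sigma>2_nonneg by simp
    have W_Suc: "W ?k \<omega> = (W n \<omega> * of_real (?e \<omega>)) * cis (s ?k \<omega> * V ?k \<omega>)" for \<omega>
      by (simp add: W_def cis_mult[symmetric] exp_add algebra_simps)
    have "expectation (W ?k) = expectation (\<lambda>\<omega>. (W n \<omega> * of_real (?e \<omega>)) * ?\<phi> (s ?k \<omega>))"
      unfolding W_Suc
    proof (rule expectation_past_cis[OF _ sm k])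
      show "(\<lambda>\<omega>. W n \<omega> * complex_of_real (?e \<omega>)) \<in> borel_measurable (past ?k)" by measurable
      show "norm (W n \<omega> * complex_of_real (?e \<omega>)) \<le> exp (\<sigma>2 / 2 * C) * exp (\<sigma>2 / 2 * C)" if "\<omega> \<in> space M" for \<omega>
        unfolding norm_mult using Wb[OF that, of n] eb[OF that] by (intro mult_mono) auto
    qed
    also have "\<dots> - expectation (W n) = expectation (\<lambda>\<omega>. (W n \<omega> * of_real (?e \<omega>)) * ?\<phi> (s ?k \<omega>) - W n \<omega>)"
    proof (rule Bochner_Integration.integral_diff[symmetric, OF _ iW])
      have [measurable]: "W n \<in> borel_measurable M" using measurable_past_M[OF Wm] .
      show "integrable M (\<lambda>\<omega>. (W n \<omega> * of_real (?e \<omega>)) * ?\<phi> (s ?k \<omega>))"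
      proof (rule integrable_const_bound[where B="exp (\<sigma>2 / 2 * C) * exp (\<sigma>2 / 2 * C) * 1"])
        show "AE \<omega> in M. norm ((W n \<omega> * of_real (?e \<omega>)) * ?\<phi> (s ?k \<omega>)) \<le> exp (\<sigma>2 / 2 * C) * exp (\<sigma>2 / 2 * C) * 1"
          unfolding norm_mult using Wb eb R.cmod_char_le_1
          by (intro AE_I2 mult_mono) auto
      qed measurable
    qed
    finally have "norm (expectation (W ?k) - expectation (W n))
        = norm (expectation (\<lambda>\<omega>. (W n \<omega> * of_real (?e \<omega>)) * ?\<phi> (s ?k \<omega>) - W n \<omega>))" by simp
    also have "\<dots> \<le> expectation (\<lambda>\<omega>. norm ((W n \<omega> * of_real (?e \<omega>)) * ?\<phi> (s ?k \<omega>) - W n \<omega>))"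
      by (rule integral_norm_bound)
    also have "\<dots> \<le> expectation (\<lambda>\<omega>. exp (\<sigma>2 * C) * (?E3 * \<bar>s ?k \<omega>\<bar> ^ 3 + \<sigma>2\<^sup>2 * (s ?k \<omega>) ^ 4))"
    proof (rule integral_mono')
      show "integrable M (\<lambda>\<omega>. exp (\<sigma>2 * C) * (?E3 * \<bar>s ?k \<omega>\<bar> ^ 3 + \<sigma>2\<^sup>2 * (s ?k \<omega>) ^ 4))"
        using i3[OF k] i4[OF k] by auto
      fix \<omega> assume w: "\<omega> \<in> space M"
      have "norm ((W n \<omega> * of_real (?e \<omega>)) * ?\<phi> (s ?k \<omega>) - W n \<omega>)
          = norm (W n \<omega>) * norm (?\<phi> (s ?k \<omega>) * of_real (?e \<omega>) - 1)"
        by (simp add: algebra_simps flip: norm_mult)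
      also have "\<dots> \<le> exp (\<sigma>2 / 2 * C) * (?e \<omega> * (?E3 * \<bar>s ?k \<omega>\<bar> ^ 3 + \<sigma>2\<^sup>2 * (s ?k \<omega>) ^ 4))"
        by (rule mult_mono[OF Wb[OF w] char_V_approx[OF k]]) auto
      also have "\<dots> \<le> exp (\<sigma>2 / 2 * C) * (exp (\<sigma>2 / 2 * C) * (?E3 * \<bar>s ?k \<omega>\<bar> ^ 3 + \<sigma>2\<^sup>2 * (s ?k \<omega>) ^ 4))"
        using eb[OF w] E3 by (intro mult_left_mono mult_right_mono) auto
      also have "\<dots> = exp (\<sigma>2 * C) * (?E3 * \<bar>s ?k \<omega>\<bar> ^ 3 + \<sigma>2\<^sup>2 * (s ?k \<omega>) ^ 4)"
        by (simp add: mult.assoc[symmetric] exp_add[symmetric])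
      finally show "norm ((W n \<omega> * of_real (?e \<omega>)) * ?\<phi> (s ?k \<omega>) - W n \<omega>)
        \<le> exp (\<sigma>2 * C) * (?E3 * \<bar>s ?k \<omega>\<bar> ^ 3 + \<sigma>2\<^sup>2 * (s ?k \<omega>) ^ 4)" .
    qed simp
    also have "\<dots> = exp (\<sigma>2 * C) * (?E3 * expectation (\<lambda>\<omega>. \<bar>s ?k \<omega>\<bar> ^ 3) + \<sigma>2\<^sup>2 * expectation (\<lambda>\<omega>. (s ?k \<omega>) ^ 4))"
      using i3[OF k] i4[OF k] by simp
    also have "\<dots> \<le> exp (\<sigma>2 * C) * (?E3 * b + \<sigma>2\<^sup>2 * b)"
      using b3[OF k] b4[OF k] E3 by (intro mult_left_mono add_mono) auto
    finally show ?thesis by (simp add: algebra_simps)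
  qed
  have "norm (expectation (W n) - 1) \<le> real n * ?D"
  proof (induction n)
    case 0
    then show ?case by (simp add: W_def prob_space)
  next
    case (Suc n)
    have "norm (expectation (W (Suc n)) - 1) \<le> norm (expectation (W (Suc n)) - expectation (W n)) + norm (expectation (W n) - 1)"
      by (metis diff_add_cancel add_diff_eq norm_triangle_ineq)
    also have "\<dots> \<le> ?D + real n * ?D" using step[of n] Suc by linarith
    finally show ?case by (simp add: algebra_simps)
  qed
  then show ?thesis unfolding W_def[abs_def] .
qed

text \<open>
  The summands are cut off as soon as their sum of squares exceeds \<open>C n\<close>; the cut-off is
  predictable, and it is inactive unless the empirical mean of the squares is at distance at
  least \<open>1\<close> from its limit.
\<close>
theorem predictable_clt:
  fixes h :: "nat \<Rightarrow> 'a \<Rightarrow> real"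
  assumes h: "\<And>k. k \<ge> 1 \<Longrightarrow> h k \<in> borel_measurable (past k)"
    and i4: "\<And>k. k \<ge> 1 \<Longrightarrow> integrable M (\<lambda>\<omega>. (h k \<omega>) ^ 4)"
    and b4: "\<And>k. k \<ge> 1 \<Longrightarrow> expectation (\<lambda>\<omega>. (h k \<omega>) ^ 4) \<le> K"
    and Q: "to_zero_prob M (\<lambda>n \<omega>. (\<Sum>k=1..n. (h k \<omega>)\<^sup>2) / real n - q)"
  shows "(\<lambda>n. expectation (\<lambda>\<omega>. cis ((\<Sum>k=1..n. h k \<omega> * V k \<omega>) / sqrt (real n)))) \<longlonglongrightarrow> of_real (exp (- (\<sigma>2 * q) / 2))"
proof -
  define C where "C = \<bar>q\<bar> + 1"
  have C: "C > 0" "q \<le> C" by (auto simp: C_def)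
  let ?c = "\<sigma>2 / 2"
  have c0: "?c \<ge> 0" using \<sigma>2_nonneg by simp
  \<comment> \<open>The test includes the term \<open>k\<close> itself: \<open>h k\<close> is known
    before \<open>V k\<close>, so predictability survives, and the running sum of squares of
    \<open>g\<close> never exceeds \<open>C * n\<close>.\<close>
  define g where "g n k \<omega> = (if (\<Sum>j=1..k. (h j \<omega>)\<^sup>2) \<le> C * real n then h k \<omega> else 0)" for n k \<omega>
  define s where "s n k \<omega> = g n k \<omega> / sqrt (real n)" for n k \<omega>
  define W where "W n \<omega> = cis (\<Sum>k=1..n. s n k \<omega> * V k \<omega>) * of_real (exp (?c * (\<Sum>k=1..n. (s n k \<omega>)\<^sup>2)))" for n \<omega>
  define T where "T n \<omega> = (\<Sum>k=1..n. h k \<omega> * V k \<omega>) / sqrt (real n)" for n \<omega>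
  have hM: "h k \<in> borel_measurable M" if "k \<ge> 1" for k using measurable_past_M[OF h[OF that]] .
  have gm: "g n k \<in> borel_measurable (past k)" if k: "k \<ge> 1" for n k
  proof -
    have [measurable]: "h j \<in> borel_measurable (past k)" if "j \<in> {1..k}" for j
      using that h[of j] by (auto intro: measurable_past_mono)
    have [measurable]: "h k \<in> borel_measurable (past k)" using h[OF k] .
    show ?thesis unfolding g_def[abs_def] by measurable
  qed
  have gsum: "(\<Sum>k=1..m. (g n k \<omega>)\<^sup>2) \<le> C * real n \<and> (\<Sum>k=1..m. (g n k \<omega>)\<^sup>2) \<le> (\<Sum>k=1..m. (h k \<omega>)\<^sup>2)" for n m \<omega>
  proof (induction m)
    case 0
    then show ?case using C by simp
  next
    case (Suc m)
    then show ?case by (auto simp: g_def add_increasing2)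
  qed
  have sm: "s n k \<in> borel_measurable (past k)" if "k \<ge> 1" for n k
    using gm[OF that, of n] unfolding s_def[abs_def] by measurable
  have ssum: "(\<Sum>k=1..m. (s n k \<omega>)\<^sup>2) \<le> C" for n m \<omega>
  proof (cases "n = 0")
    case False
    have "(\<Sum>k=1..m. (s n k \<omega>)\<^sup>2) = (\<Sum>k=1..m. (g n k \<omega>)\<^sup>2) / real n"
      by (simp add: s_def power_divide sum_divide_distrib)
    also have "\<dots> \<le> C * real n / real n" using gsum by (intro divide_right_mono) auto
    finally show ?thesis using False by simp
  qed (use C in \<open>simp add: s_def\<close>)
  \<comment> \<open>From |h|^3 \<le> 1 + h^4. Third and fourth moments of \<open>s\<close> are both
    put over \<open>n * sqrt n\<close>, so \<open>n\<close> steps of the exponential martingale cost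
    a constant over \<open>sqrt n\<close>.\<close>
  let ?K = "1 + \<bar>K\<bar>"
  have i3: "integrable M (\<lambda>\<omega>. \<bar>s n k \<omega>\<bar> ^ 3)" "expectation (\<lambda>\<omega>. \<bar>s n k \<omega>\<bar> ^ 3) \<le> ?K / (real n * sqrt (real n))"
    and is4: "integrable M (\<lambda>\<omega>. (s n k \<omega>) ^ 4)" "expectation (\<lambda>\<omega>. (s n k \<omega>) ^ 4) \<le> ?K / (real n * sqrt (real n))"
    if k: "k \<ge> 1" for n k
  proof -
    note [measurable] = measurable_past_M[OF sm[OF k, of n]] hM[OF k]
    have n3: "sqrt (real n) ^ 3 = real n * sqrt (real n)" by (simp add: power3_eq_cube)
    have n4: "sqrt (real n) ^ 4 = real n * real n"
      by (simp add: power4_eq_xxxx mult.assoc)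
    have nn: "sqrt (real n) \<le> real n"
      by (cases "n = 0") (auto simp: real_sqrt_le_iff intro!: real_le_lsqrt simp: power2_eq_square)
    have gh: "\<bar>g n k \<omega>\<bar> \<le> \<bar>h k \<omega>\<bar>" for \<omega> by (simp add: g_def)
    have s3: "\<bar>s n k \<omega>\<bar> ^ 3 \<le> (1 + (h k \<omega>) ^ 4) / (real n * sqrt (real n))" for \<omega>
    proof -
      have "\<bar>s n k \<omega>\<bar> ^ 3 = \<bar>g n k \<omega>\<bar> ^ 3 / (real n * sqrt (real n))"
        by (simp add: s_def power_divide n3)
      also have "\<dots> \<le> (1 + (h k \<omega>) ^ 4) / (real n * sqrt (real n))"
        using order_trans[OF power_mono[OF gh, where n=3] abs_cube_le] by (intro divide_right_mono) auto
      finally show ?thesis .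
    qed
    have s4: "(s n k \<omega>) ^ 4 \<le> (1 + (h k \<omega>) ^ 4) / (real n * sqrt (real n))" for \<omega>
    proof (cases "n = 0")
      case False
      have "(s n k \<omega>) ^ 4 = \<bar>g n k \<omega>\<bar> ^ 4 / (real n * real n)"
        by (simp add: s_def power_divide n4)
      also have "\<dots> \<le> (1 + (h k \<omega>) ^ 4) / (real n * sqrt (real n))"
        using power_mono[OF gh, where n=4] False nn by (intro frac_le mult_left_mono) (auto intro: add_increasing)
      finally show ?thesis .
    qed (simp add: s_def)
    have ib: "integrable M (\<lambda>\<omega>. (1 + (h k \<omega>) ^ 4) / (real n * sqrt (real n)))"
      using i4[OF k] by auto
    have Eb: "expectation (\<lambda>\<omega>. (1 + (h k \<omega>) ^ 4) / (real n * sqrt (real n))) \<le> ?K / (real n * sqrt (real n))"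
      using i4[OF k] b4[OF k] by (auto simp: prob_space intro!: divide_right_mono)
    show I3: "integrable M (\<lambda>\<omega>. \<bar>s n k \<omega>\<bar> ^ 3)"
      by (rule Bochner_Integration.integrable_bound[OF ib]) (use s3 in \<open>auto intro!: AE_I2 order_trans[OF _ abs_ge_self]\<close>)
    show I4: "integrable M (\<lambda>\<omega>. (s n k \<omega>) ^ 4)"
      by (rule Bochner_Integration.integrable_bound[OF ib]) (use s4 in \<open>auto intro!: AE_I2 order_trans[OF _ abs_ge_self]\<close>)
    show "expectation (\<lambda>\<omega>. \<bar>s n k \<omega>\<bar> ^ 3) \<le> ?K / (real n * sqrt (real n))"
      by (rule order_trans[OF integral_mono[OF I3 ib s3] Eb])
    show "expectation (\<lambda>\<omega>. (s n k \<omega>) ^ 4) \<le> ?K / (real n * sqrt (real n))"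
      by (rule order_trans[OF integral_mono[OF I4 ib s4] Eb])
  qed
  let ?B = "exp (\<sigma>2 * C) * ((expectation (\<lambda>\<omega>. \<bar>V 1 \<omega>\<bar> ^ 3) + \<sigma>2\<^sup>2) * ?K)"
  have W1: "norm (expectation (W n) - 1) \<le> ?B / sqrt (real n)" for n
  proof (cases "n = 0")
    case False
    have "norm (expectation (W n) - 1)
      \<le> real n * (exp (\<sigma>2 * C) * ((expectation (\<lambda>\<omega>. \<bar>V 1 \<omega>\<bar> ^ 3) + \<sigma>2\<^sup>2) * (?K / (real n * sqrt (real n)))))"
      unfolding W_def using sm ssum is4(1) i3(1) i3(2) is4(2)
      by (intro expectation_exponential_martingale) auto
    also have "\<dots> = ?B / sqrt (real n)" using False by (simp add: field_simps)
    finally show ?thesis .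
  qed (simp add: W_def[abs_def] prob_space)
  have "(\<lambda>n. ?B / sqrt (real n)) \<longlonglongrightarrow> 0"
    by (intro tendsto_divide_0[OF tendsto_const] filterlim_at_top_imp_at_infinity
        filterlim_compose[OF sqrt_at_top filterlim_real_sequentially])
  then have "(\<lambda>n. expectation (W n) - 1) \<longlonglongrightarrow> 0"
    by (rule Lim_null_comparison[rotated]) (rule always_eventually, rule allI, rule W1)
  moreover have "(\<lambda>n. expectation (\<lambda>\<omega>. cis (T n \<omega>)) * of_real (exp (?c * q)) - expectation (W n)) \<longlonglongrightarrow> 0"
  proof (rule Lim_null_comparison)
    let ?d = "\<lambda>n \<omega>. min 1 \<bar>(\<Sum>k=1..n. (h k \<omega>)\<^sup>2) / real n - q\<bar>"
    \<comment> \<open>The summand 2 pays for the two terms, each at most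
      \<open>exp (?c * C)\<close>, when the cut-off may be active; \<open>?c\<close> is the slope of
      the exponent when it is not.\<close>
    let ?D = "(2 + ?c) * exp (?c * C)"
    show "(\<lambda>n. ?D * expectation (?d n)) \<longlonglongrightarrow> 0"
      using tendsto_mult[OF tendsto_const, of _ 0 sequentially ?D] Q by (auto simp: to_zero_prob_def)
    show "eventually (\<lambda>n. norm (expectation (\<lambda>\<omega>. cis (T n \<omega>)) * of_real (exp (?c * q)) - expectation (W n))
      \<le> ?D * expectation (?d n)) sequentially"
      using eventually_gt_at_top[of 0]
    proof eventually_elim
      fix n :: nat assume n: "0 < n"
      have [measurable]: "h k \<in> borel_measurable M" if "k \<in> {1..n}" for k using that hM by auto
      have [measurable]: "V k \<in> borel_measurable M" if "k \<in> {1..n}" for k using that measurable_V by auto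
      have [measurable]: "s n k \<in> borel_measurable M" if "k \<in> {1..n}" for k
        using that measurable_past_M[OF sm] by auto
      have [measurable]: "T n \<in> borel_measurable M" unfolding T_def[abs_def] by measurable
      have Wm[measurable]: "W n \<in> borel_measurable M" unfolding W_def[abs_def] by measurable
      have dm[measurable]: "(\<lambda>\<omega>. (\<Sum>k=1..n. (h k \<omega>)\<^sup>2) / real n - q) \<in> borel_measurable M" by measurable
      have Wb: "norm (W n \<omega>) \<le> exp (?c * C)" for \<omega>
      proof -
        have "?c * (\<Sum>k=1..n. (s n k \<omega>)\<^sup>2) \<le> ?c * C" by (rule mult_left_mono[OF ssum c0])
        then show ?thesis by (simp add: W_def norm_mult)
      qed
      have iW: "integrable M (W n)" by (rule integrable_const_bound[OF AE_I2[OF Wb] Wm])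
      have iT: "integrable M (\<lambda>\<omega>. cis (T n \<omega>) * of_real (exp (?c * q)))" by auto
      have pt: "norm (cis (T n \<omega>) * of_real (exp (?c * q)) - W n \<omega>) \<le> ?D * ?d n \<omega>" for \<omega>
      proof -
        define Qn where "Qn = (\<Sum>k=1..n. (h k \<omega>)\<^sup>2) / real n"
        have eq: "exp (?c * q) \<le> exp (?c * C)" using C c0 by (simp add: mult_left_mono)
        show ?thesis
        proof (cases "Qn \<le> C")
          case True
          have "g n k \<omega> = h k \<omega>" if "k \<in> {1..n}" for k
          proof -
            have "(\<Sum>j=1..k. (h j \<omega>)\<^sup>2) \<le> (\<Sum>j=1..n. (h j \<omega>)\<^sup>2)"
              using that by (intro sum_mono2) auto
            also have "\<dots> \<le> C * real n" using True n by (simp add: Qn_def field_simps)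
            finally show ?thesis by (simp add: g_def)
          qed
          then have s_eq: "s n k \<omega> = h k \<omega> / sqrt (real n)" if "k \<in> {1..n}" for k
            using that by (simp add: s_def)
          have "(\<Sum>k=1..n. s n k \<omega> * V k \<omega>) = T n \<omega>"
            unfolding T_def sum_divide_distrib by (intro sum.cong refl) (simp add: s_eq)
          moreover have "(\<Sum>k=1..n. (s n k \<omega>)\<^sup>2) = Qn"
            unfolding Qn_def sum_divide_distrib by (intro sum.cong refl) (simp add: s_eq power_divide)
          ultimately have "W n \<omega> = cis (T n \<omega>) * of_real (exp (?c * Qn))" by (simp add: W_def)
          then have "cis (T n \<omega>) * of_real (exp (?c * q)) - W n \<omega> = cis (T n \<omega>) * of_real (exp (?c * q) - exp (?c * Qn))"
            by (simp add: algebra_simps)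
          then have "norm (cis (T n \<omega>) * of_real (exp (?c * q)) - W n \<omega>) = \<bar>exp (?c * q) - exp (?c * Qn)\<bar>"
            by (simp only: norm_mult norm_cis norm_of_real) simp
          also have "\<dots> \<le> exp (?c * C) * min 1 \<bar>?c * q - ?c * Qn\<bar>"
            using C True c0 by (intro exp_Lipschitz_below mult_left_mono) auto
          also have "\<bar>?c * q - ?c * Qn\<bar> = ?c * \<bar>Qn - q\<bar>"
            by (simp only: right_diff_distrib[symmetric] abs_mult abs_of_nonneg[OF c0] abs_minus_commute)
          also have "min 1 (?c * \<bar>Qn - q\<bar>) \<le> (2 + ?c) * min 1 \<bar>Qn - q\<bar>"
          proof (cases "\<bar>Qn - q\<bar> \<le> 1")
            case True
            then have "min 1 \<bar>Qn - q\<bar> = \<bar>Qn - q\<bar>" by simp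
            moreover have "min 1 (?c * \<bar>Qn - q\<bar>) \<le> ?c * \<bar>Qn - q\<bar>" by simp
            ultimately show ?thesis using abs_ge_zero[of "Qn - q"] by (simp only: distrib_right)
          next
            case False
            then show ?thesis using c0 by (simp add: min_def)
          qed
          finally show ?thesis by (simp add: Qn_def mult_ac)
        next
          case False
          then have d: "min 1 \<bar>Qn - q\<bar> = 1" by (simp add: C_def)
          have "norm (cis (T n \<omega>) * of_real (exp (?c * q)) - W n \<omega>)
              \<le> norm (cis (T n \<omega>) * of_real (exp (?c * q))) + norm (W n \<omega>)" by (rule norm_triangle_ineq4)
          also have "\<dots> \<le> exp (?c * C) + exp (?c * C)"
            using eq Wb by (intro add_mono) (auto simp: norm_mult)
          also have "\<dots> \<le> ?D * 1" using c0 by (simp add: distrib_right)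
          finally show ?thesis using d by (simp add: Qn_def)
        qed
      qed
      have "expectation (\<lambda>\<omega>. cis (T n \<omega>)) * of_real (exp (?c * q)) - expectation (W n)
        = expectation (\<lambda>\<omega>. cis (T n \<omega>) * of_real (exp (?c * q)) - W n \<omega>)"
        by (subst Bochner_Integration.integral_diff[OF iT iW]) simp
      also have "norm \<dots> \<le> expectation (\<lambda>\<omega>. norm (cis (T n \<omega>) * of_real (exp (?c * q)) - W n \<omega>))"
        by (rule integral_norm_bound)
      also have "\<dots> \<le> expectation (\<lambda>\<omega>. ?D * ?d n \<omega>)"
        by (intro integral_mono integrable_norm Bochner_Integration.integrable_diff iT iW
            integrable_mult_right integrable_min_one pt dm)
      finally show "norm (expectation (\<lambda>\<omega>. cis (T n \<omega>)) * of_real (exp (?c * q)) - expectation (W n))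
        \<le> ?D * expectation (?d n)" by simp
    qed
  qed
  ultimately have "(\<lambda>n. (expectation (\<lambda>\<omega>. cis (T n \<omega>)) * of_real (exp (?c * q)) - expectation (W n)) + (expectation (W n) - 1) + 1) \<longlonglongrightarrow> 0 + 0 + 1"
    by (intro tendsto_add tendsto_const) auto
  then have "(\<lambda>n. expectation (\<lambda>\<omega>. cis (T n \<omega>)) * of_real (exp (?c * q))) \<longlonglongrightarrow> 1" by simp
  then have "(\<lambda>n. expectation (\<lambda>\<omega>. cis (T n \<omega>)) * of_real (exp (?c * q)) * of_real (exp (- (?c * q)))) \<longlonglongrightarrow> 1 * of_real (exp (- (?c * q)))"
    by (intro tendsto_mult tendsto_const)
  moreover have "complex_of_real (exp (?c * q)) * of_real (exp (- (?c * q))) = 1"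
    by (simp flip: of_real_mult exp_add)
  ultimately show ?thesis by (simp add: T_def mult.assoc)
qed

end

section \<open>The Yule-Walker system\<close>

text \<open>The coefficients of the inverse satisfy the recursion given by \<open>f\<close>. Summing
  absolute values up to any index gives \<open>G \<le> 1 + ?s * G\<close> for the partial sum
  \<open>G\<close>, hence the uniform bound \<open>1 / (1 - ?s)\<close>.\<close>

lemma fps_inverse_absolutely_summable:
  fixes f :: "real fps"
  assumes f0: "fps_nth f 0 = 1" and supp: "\<And>n. n > N \<Longrightarrow> fps_nth f n = 0"
    and less: "(\<Sum>i=1..N. \<bar>fps_nth f i\<bar>) < 1"
  shows "summable (\<lambda>n. \<bar>fps_nth (inverse f) n\<bar>)"
proof -
  let ?g = "fps_nth (inverse f)"
  let ?s = "\<Sum>i=1..N. \<bar>fps_nth f i\<bar>"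
  have inv: "f * inverse f = 1" using f0 by (simp add: inverse_mult_eq_1')
  have rec: "\<bar>?g n\<bar> \<le> (if n = 0 then 1 else 0) + (\<Sum>i=1..N. \<bar>fps_nth f i\<bar> * (if i \<le> n then \<bar>?g (n - i)\<bar> else 0))" for n
  proof -
    have "(if n = 0 then 1 else 0) = (\<Sum>i=0..n. fps_nth f i * ?g (n - i))"
      using arg_cong[OF inv, of "\<lambda>h. fps_nth h n"] by (simp add: fps_mult_nth)
    also have "\<dots> = ?g n + (\<Sum>i=1..n. fps_nth f i * ?g (n - i))"
      by (subst sum.atLeast_Suc_atMost) (auto simp: f0)
    also have "(\<Sum>i=1..n. fps_nth f i * ?g (n - i)) = (\<Sum>i=1..N. fps_nth f i * (if i \<le> n then ?g (n - i) else 0))"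
      by (rule sum.mono_neutral_cong) (auto simp: supp)
    finally have "?g n = (if n = 0 then 1 else 0) - (\<Sum>i=1..N. fps_nth f i * (if i \<le> n then ?g (n - i) else 0))"
      by simp
    also have "\<bar>\<dots>\<bar> \<le> \<bar>if n = 0 then 1 else 0\<bar> + \<bar>\<Sum>i=1..N. fps_nth f i * (if i \<le> n then ?g (n - i) else 0)\<bar>"
      by (rule abs_triangle_ineq4)
    also have "\<bar>\<Sum>i=1..N. fps_nth f i * (if i \<le> n then ?g (n - i) else 0)\<bar>
        \<le> (\<Sum>i=1..N. \<bar>fps_nth f i\<bar> * (if i \<le> n then \<bar>?g (n - i)\<bar> else 0))"
      by (rule order_trans[OF sum_abs]) (auto intro!: sum_mono simp: abs_mult)
    finally show ?thesis by simp
  qed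
  have bd: "(\<Sum>n<m. \<bar>?g n\<bar>) \<le> 1 / (1 - ?s)" for m
  proof -
    let ?G = "\<Sum>n<m. \<bar>?g n\<bar>"
    have "?G \<le> (\<Sum>n<m. (if n = 0 then 1 else 0) + (\<Sum>i=1..N. \<bar>fps_nth f i\<bar> * (if i \<le> n then \<bar>?g (n - i)\<bar> else 0)))"
      by (intro sum_mono rec)
    also have "\<dots> = (\<Sum>n<m. if n = 0 then 1 else 0) + (\<Sum>i=1..N. \<bar>fps_nth f i\<bar> * (\<Sum>n<m. if i \<le> n then \<bar>?g (n - i)\<bar> else 0))"
      unfolding sum.distrib sum_distrib_left by (subst sum.swap) simp
    also have "\<dots> \<le> 1 + (\<Sum>i=1..N. \<bar>fps_nth f i\<bar> * ?G)"
    proof (rule add_mono[OF _ sum_mono[OF mult_left_mono]])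
      show "(\<Sum>n<m. if n = 0 then 1 else 0) \<le> (1::real)" by simp
      fix i
      have "(\<Sum>n<m. if i \<le> n then \<bar>?g (n - i)\<bar> else 0) = (\<Sum>n\<in>{i..<m}. \<bar>?g (n - i)\<bar>)"
        by (rule sum.mono_neutral_cong_right) auto
      also have "\<dots> = (\<Sum>n<m - i. \<bar>?g n\<bar>)"
        by (rule sum.reindex_bij_witness[where i="\<lambda>n. n + i" and j="\<lambda>n. n - i"]) auto
      also have "\<dots> \<le> ?G" by (rule sum_mono2) auto
      finally show "(\<Sum>n<m. if i \<le> n then \<bar>?g (n - i)\<bar> else 0) \<le> ?G" .
    qed auto
    also have "\<dots> = 1 + ?s * ?G" by (simp add: sum_distrib_right)
    finally have "?G \<le> 1 + ?s * ?G" .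
    moreover have "x \<le> 1 / (1 - y)" if "x \<le> 1 + y * x" "y < 1" for x y :: real
      using that by (simp add: field_simps)
    ultimately show ?thesis using less by blast
  qed
  show ?thesis
    by (rule summableI_nonneg_bounded[where x="1 / (1 - ?s)"]) (use bd in auto)
qed

abbreviation lag :: "nat \<Rightarrow> nat \<Rightarrow> nat" where
  "lag i j \<equiv> nat \<bar>int i - int j\<bar>"

text \<open>Continues \<open>L\<close> beyond \<open>N\<close> by the autoregressive recursion; this
  carries a finite solution of the system \<open>B\<close> over to a sequence indexed by all
  lags.\<close>

fun ext_rec :: "(nat \<Rightarrow> real) \<Rightarrow> nat \<Rightarrow> (nat \<Rightarrow> real) \<Rightarrow> nat \<Rightarrow> real" where
  "ext_rec a N L k = (if k \<le> N then L k else - (\<Sum>l=1..N. a l * ext_rec a N L (k - l)))"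

declare ext_rec.simps [simp del]

locale ar_coeffs =
  fixes \<theta> :: "real ^ 'p::{finite,linorder}" and \<rho> :: real and P :: nat
  assumes card_P [simp]: "CARD('p) = P" and theta_less: "(\<Sum>i\<in>UNIV. \<bar>\<theta> $ i\<bar>) < 1" and rho_less: "\<bar>\<rho>\<bar> < 1"
begin

abbreviation a where "a \<equiv> a_coeff \<theta> \<rho>"
abbreviation tau where "tau \<equiv> coord \<theta>"

lemma P_pos: "P \<ge> 1"
  unfolding card_P[symmetric] by (simp add: Suc_le_eq card_gt_0_iff del: card_P)

lemma sum_idx: "(\<Sum>i\<in>UNIV. f (idx (i::'p))) = (\<Sum>k=1..P. f k)"
  using sum.reindex_bij_betw[OF bij_betw_idx[where 'p='p], of f] unfolding card_P .

lemma idx_range: "1 \<le> idx (i::'p)" "idx (i::'p) \<le> P"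
proof -
  have "idx i \<in> {1..CARD('p)}" by (rule bij_betw_apply[OF bij_betw_idx UNIV_I])
  then show "1 \<le> idx i" "idx i \<le> P" by simp_all
qed

lemma idx_inject: "idx i = idx j \<longleftrightarrow> i = (j::'p)"
  by (rule inj_eq[OF bij_betw_imp_inj_on[OF bij_betw_idx]])

lemma ex_idx:
  assumes "1 \<le> k" "k \<le> P"
  shows "\<exists>i::'p. idx i = k"
proof -
  have "k \<in> range (idx :: 'p \<Rightarrow> nat)"
    unfolding bij_betw_imp_surj_on[OF bij_betw_idx] using assms by simp
  then show ?thesis by (rule imageE) (rule exI, rule sym)
qed

lemma tau_less: "(\<Sum>k=1..P. \<bar>tau k\<bar>) < 1"
  using theta_less sum_idx[of "\<lambda>k. \<bar>tau k\<bar>"] by (simp add: coord_idx)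

lemma a_0 [simp]: "a 0 = 1" by (simp add: a_coeff_def)
lemma a_neg [simp]: "d < 0 \<Longrightarrow> a d = 0" by (simp add: a_coeff_def)
lemma a_large [simp]: "d > int P + 1 \<Longrightarrow> a d = 0" by (simp add: a_coeff_def)
lemma a_last: "a (int P + 1) = tau P * \<rho>" by (simp add: a_coeff_def theta_last_def)

lemma coord_beta:
  assumes "1 \<le> k" "k \<le> P"
  shows "coord (beta \<theta> \<rho>) k = (if k = 1 then tau k + \<rho> else tau k - tau (k - 1) * \<rho>)"
proof -
  obtain i :: 'p where i: "idx i = k" using ex_idx assms by blast
  have b: "coord (beta \<theta> \<rho>) k = beta \<theta> \<rho> $ i"
    using coord_idx[of "beta \<theta> \<rho>" i] unfolding i .
  have t: "tau k = \<theta> $ i" using coord_idx[of \<theta> i] unfolding i .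
  show ?thesis unfolding b t unfolding beta_def vec_lambda_beta i by (rule refl)
qed

section \<open>Impulse response, autocovariances and invertibility of the Yule-Walker matrix\<close>

definition T_fps :: "real fps" where
  "T_fps = Abs_fps (\<lambda>n. if n = 0 then 1 else if n \<le> P then - tau n else 0)"

definition R_fps :: "real fps" where
  "R_fps = Abs_fps (\<lambda>n. if n = 0 then 1 else if n = 1 then - \<rho> else 0)"

definition c where "c = fps_nth (inverse (T_fps * R_fps))"

lemma a_eq_fps: "fps_nth (T_fps * R_fps) n = a (int n)"
proof (cases n)
  case 0
  then show ?thesis by (simp add: T_fps_def R_fps_def fps_mult_nth)
next
  case (Suc m)
  have "fps_nth (T_fps * R_fps) n = (\<Sum>i=0..n. fps_nth T_fps (n - i) * fps_nth R_fps i)"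
    by (subst mult.commute) (simp add: fps_mult_nth mult.commute)
  also have "\<dots> = fps_nth T_fps n + fps_nth T_fps m * (- \<rho>)"
    unfolding Suc by (subst sum.atLeast_Suc_atMost, simp, subst sum.atLeast_Suc_atMost)
      (auto simp: R_fps_def)
  also have "\<dots> = a (int n)"
    using P_pos Suc by (auto simp: a_coeff_def T_fps_def coord_beta theta_last_def nat_add_distrib)
  finally show ?thesis .
qed

text \<open>The criterion is applied to the two factors separately and combined by a Cauchy product:
  the coefficients of the product may have absolute sum above 1 beyond the leading one.\<close>

lemma summable_c: "summable (\<lambda>n. \<bar>c n\<bar>)"
proof -
  have "summable (\<lambda>n. \<bar>fps_nth (inverse T_fps) n\<bar>)"
    by (rule fps_inverse_absolutely_summable[where N=P]) (use tau_less in \<open>auto simp: T_fps_def\<close>)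
  moreover have "summable (\<lambda>n. \<bar>fps_nth (inverse R_fps) n\<bar>)"
    by (rule fps_inverse_absolutely_summable[where N=1]) (use rho_less in \<open>auto simp: R_fps_def\<close>)
  ultimately have S: "summable (\<lambda>k. \<Sum>i\<le>k. \<bar>fps_nth (inverse T_fps) i\<bar> * \<bar>fps_nth (inverse R_fps) (k - i)\<bar>)"
    by (intro summable_Cauchy_product) auto
  have le: "\<bar>c k\<bar> \<le> (\<Sum>i\<le>k. \<bar>fps_nth (inverse T_fps) i\<bar> * \<bar>fps_nth (inverse R_fps) (k - i)\<bar>)" for k
    unfolding c_def fps_inverse_mult
    by (simp add: fps_mult_nth atMost_atLeast0 flip: abs_mult)
  show ?thesis by (rule summable_comparison_test'[OF S, where N=0]) (simp add: le)
qed

text \<open>The causal impulse response on all integers; extension by 0 lets recursions and shifts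
  hold without boundary cases.\<close>

definition ci :: "int \<Rightarrow> real" where "ci k = (if k < 0 then 0 else c (nat k))"

lemma ci_neg [simp]: "k < 0 \<Longrightarrow> ci k = 0" by (simp add: ci_def)
lemma ci_int [simp]: "ci (int k) = c k" by (simp add: ci_def)

lemma c_rec: "(\<Sum>l=0..P+1. a (int l) * ci (d - int l)) = (if d = 0 then 1 else 0)"
proof (cases "d < 0")
  case False
  then obtain n where n: "d = int n" by (metis nonneg_int_cases not_less)
  have f0: "fps_nth (T_fps * R_fps) 0 \<noteq> 0" unfolding a_eq_fps by simp
  have "(if n = 0 then 1 else 0) = fps_nth (T_fps * R_fps * inverse (T_fps * R_fps)) n"
    by (simp only: inverse_mult_eq_1'[OF f0] fps_one_nth)
  also have "\<dots> = (\<Sum>i=0..n. a (int i) * c (n - i))"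
    by (simp only: fps_mult_nth[of "T_fps * R_fps"] a_eq_fps c_def)
  also have "\<dots> = (\<Sum>i=0..P+1. a (int i) * ci (d - int i))"
  proof (rule sum.mono_neutral_cong)
    show "a (int i) * c (n - i) = 0" if "i \<in> {0..n} - {0..P+1}" for i using that by auto
    show "a (int i) * ci (d - int i) = 0" if "i \<in> {0..P+1} - {0..n}" for i using that n by auto
    show "a (int i) * c (n - i) = a (int i) * ci (d - int i)" if "i \<in> {0..n} \<inter> {0..P+1}" for i
      using that n by (simp add: ci_def nat_diff_distrib)
  qed auto
  finally show ?thesis using n by (simp split: if_splits)
qed auto

lemma c_0: "c 0 = 1"
  using c_rec[of 0] by (subst (asm) sum.atLeast_Suc_atMost) (auto simp: ci_def)

definition cbound where "cbound = (\<Sum>n. \<bar>c n\<bar>)"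

lemma sum_c_le: "finite I \<Longrightarrow> (\<Sum>n\<in>I. \<bar>c n\<bar>) \<le> cbound"
  unfolding cbound_def by (rule sum_le_suminf[OF summable_c]) auto

lemma cbound_ge: "\<bar>c n\<bar> \<le> cbound" "1 \<le> cbound"
  using sum_c_le[of "{n}"] sum_c_le[of "{0}"] by (auto simp: c_0)

lemma ci_le: "\<bar>ci k\<bar> \<le> cbound"
  using cbound_ge by (auto simp: ci_def intro: order_trans[OF _ cbound_ge(2)])

text \<open>The autocovariance at lag \<open>k\<close> of the stationary solution driven by noise of
  variance 1.\<close>

definition lam :: "nat \<Rightarrow> real" where "lam k = (\<Sum>m. c m * c (m + k))"

lemma summable_ci_prod: "summable (\<lambda>m::nat. ci (int m - int i) * ci (int m + d))"
proof -
  have "summable (\<lambda>m. \<bar>ci (int (m + i) - int i)\<bar> * cbound)"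
    using summable_mult2[OF summable_c] by simp
  then have "summable (\<lambda>m. \<bar>ci (int m - int i)\<bar> * cbound)"
    by (subst (asm) summable_iff_shift[where k=i])
  then show ?thesis
    by (rule summable_comparison_test'[where N=0]) (auto simp: abs_mult intro!: mult_left_mono ci_le)
qed

text \<open>The terms below the larger of the two indices vanish by causality; shifting the sum by
  that index leaves only the lag.\<close>

lemma lam_shift: "(\<Sum>m. ci (int m - int i) * ci (int m - int j)) = lam (lag i j)"
proof -
  have *: "(\<Sum>m. ci (int m - int i) * ci (int m - int j)) = lam (lag i j)" if "i \<le> j" for i j
  proof -
    have s: "summable (\<lambda>m. ci (int m - int i) * ci (int m - int j))"
      using summable_ci_prod[of i "- int j"] by simp
    have "(\<Sum>m. ci (int m - int i) * ci (int m - int j))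
        = (\<Sum>m. ci (int (m + j) - int i) * ci (int (m + j) - int j)) + (\<Sum>m<j. ci (int m - int i) * ci (int m - int j))"
      by (rule suminf_split_initial_segment[OF s])
    also have "(\<Sum>m<j. ci (int m - int i) * ci (int m - int j)) = 0" by simp
    also have "(\<Sum>m. ci (int (m + j) - int i) * ci (int (m + j) - int j)) = lam (lag i j)"
    proof -
      have "ci (int (m + j) - int i) = c (m + lag i j)" for m
        using that by (simp add: ci_def nat_diff_distrib nat_add_distrib)
      then show ?thesis by (simp add: lam_def mult.commute)
    qed
    finally show ?thesis by simp
  qed
  show ?thesis
    using *[of i j] *[of j i] by (cases "i \<le> j") (auto simp: mult.commute abs_minus_commute)
qed

text \<open>Under the sum over \<open>m\<close> the coefficients \<open>a\<close> meet their own
  impulse response, which collapses to a unit pulse at \<open>m = 0\<close>; what remains is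
  \<open>ci (- d)\<close>.\<close>

lemma lam_yule_walker: "(\<Sum>l=0..P+1. a (int l) * lam (lag d l)) = (if d = 0 then 1 else 0)"
proof -
  have s: "summable (\<lambda>m. ci (int m - int l) * ci (int m - int d))" for l
    using summable_ci_prod[of l "- int d"] by simp
  have "(\<Sum>l=0..P+1. a (int l) * lam (lag d l))
      = (\<Sum>l=0..P+1. a (int l) * (\<Sum>m. ci (int m - int l) * ci (int m - int d)))"
    by (simp add: lam_shift abs_minus_commute)
  also have "\<dots> = (\<Sum>l=0..P+1. (\<Sum>m. a (int l) * (ci (int m - int l) * ci (int m - int d))))"
    by (simp add: suminf_mult[OF s])
  also have "\<dots> = (\<Sum>m. \<Sum>l=0..P+1. a (int l) * (ci (int m - int l) * ci (int m - int d)))"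
    by (rule suminf_sum[symmetric]) (rule summable_mult[OF s])
  also have "\<dots> = (\<Sum>m. (if m = 0 then 1 else 0) * ci (int m - int d))"
  proof (rule suminf_cong)
    fix m
    have "(\<Sum>l=0..P+1. a (int l) * (ci (int m - int l) * ci (int m - int d)))
      = (\<Sum>l=0..P+1. a (int l) * ci (int m - int l)) * ci (int m - int d)"
      by (simp only: sum_distrib_right mult.assoc)
    then show "(\<Sum>l=0..P+1. a (int l) * (ci (int m - int l) * ci (int m - int d))) = (if m = 0 then 1 else 0) * ci (int m - int d)"
      by (simp only: c_rec) simp
  qed
  also have "\<dots> = (\<Sum>m\<in>{0}. (if m = 0 then 1 else 0) * ci (int m - int d))"
    by (rule suminf_finite) auto
  also have "\<dots> = (if d = 0 then 1 else 0)" by (simp add: ci_def c_0)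
  finally show ?thesis .
qed

text \<open>A row of \<open>B\<close> is the convolution of \<open>a\<close> with the even extension
  of \<open>L\<close>, folded at 0: the column j \<ge> 1 collects the indices
  \<open>l = d - j\<close> and \<open>l = d + j\<close>, and the column 0 only
  \<open>l = d\<close>.\<close>

lemma B_row:
  assumes d: "d \<le> P + 1"
  shows "(\<Sum>j=0..P+1. B_entry \<theta> \<rho> d j * L j) = (\<Sum>l=0..P+1. a (int l) * L (lag d l))"
proof -
  have "(\<Sum>j=0..P+1. B_entry \<theta> \<rho> d j * L j)
      = a (int d) * L 0 + ((\<Sum>j=1..P+1. a (int d - int j) * L j) + (\<Sum>j=1..P+1. a (int d + int j) * L j))"
    by (subst sum.atLeast_Suc_atMost) (auto simp: B_entry_def distrib_right sum.distrib)
  also have "(\<Sum>j=1..P+1. a (int d - int j) * L j) = (\<Sum>l\<in>{0..<d}. a (int l) * L (lag d l))"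
  proof -
    have "(\<Sum>j=1..P+1. a (int d - int j) * L j) = (\<Sum>j=1..d. a (int d - int j) * L j)"
      by (rule sum.mono_neutral_right) (use d in auto)
    also have "\<dots> = (\<Sum>l\<in>{0..<d}. a (int l) * L (lag d l))"
      by (rule sum.reindex_bij_witness[where i="\<lambda>l. d - l" and j="\<lambda>j. d - j"]) (auto simp: of_nat_diff)
    finally show ?thesis .
  qed
  also have "(\<Sum>j=1..P+1. a (int d + int j) * L j) = (\<Sum>l\<in>{d<..P+1}. a (int l) * L (lag d l))"
  proof -
    have "(\<Sum>j=1..P+1. a (int d + int j) * L j) = (\<Sum>j=1..P+1-d. a (int d + int j) * L j)"
      by (rule sum.mono_neutral_right) (use d in auto)
    also have "\<dots> = (\<Sum>l\<in>{d<..P+1}. a (int l) * L (lag d l))"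
      by (rule sum.reindex_bij_witness[where i="\<lambda>l. l - d" and j="\<lambda>j. d + j"]) (use d in \<open>auto simp: of_nat_diff\<close>)
    finally show ?thesis .
  qed
  also have "a (int d) * L 0 + ((\<Sum>l\<in>{0..<d}. a (int l) * L (lag d l)) + (\<Sum>l\<in>{d<..P+1}. a (int l) * L (lag d l)))
      = (\<Sum>l\<in>insert d ({0..<d} \<union> {d<..P+1}). a (int l) * L (lag d l))"
    by (subst sum.insert, simp, simp, subst sum.union_disjoint) auto
  also have "insert d ({0..<d} \<union> {d<..P+1}) = {0..P+1}" using d by auto
  finally show ?thesis .
qed

text \<open>The factorisation of the autoregressive polynomial, applied to a sequence: the
  \<theta>-residual minus \<rho> times the shifted \<theta>-residual.\<close>

lemma sum_a_split:
  "(\<Sum>l=0..P+1. a (int l) * f (int l)) = (f 0 - (\<Sum>i=1..P. tau i * f (int i)))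
    - \<rho> * (f 1 - (\<Sum>i=1..P. tau i * f (int i + 1)))"
proof -
  have a_eq: "a (int l) = (if l = 0 then 1 else if l \<le> P then - tau l else 0)
      + (if l = 0 then 0 else - \<rho> * (if l = 1 then 1 else if l \<le> P + 1 then - tau (l - 1) else 0))" for l
  proof -
    consider "l = 0" | "l = 1" | "2 \<le> l" "l \<le> P" | "l = Suc P" | "l > Suc P" by linarith
    then show ?thesis
    proof cases
      case 2
      then show ?thesis using P_pos coord_beta[of 1] by (simp add: a_coeff_def)
    next
      case 3
      then show ?thesis using coord_beta[of l] by (simp add: a_coeff_def)
    next
      case 4
      then show ?thesis using P_pos a_last by (simp add: add.commute)
    qed auto
  qed
  have "(\<Sum>l=0..P+1. a (int l) * f (int l))
      = (\<Sum>l=0..P+1. (if l = 0 then 1 else if l \<le> P then - tau l else 0) * f (int l))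
      + (\<Sum>l=0..P+1. (if l = 0 then 0 else - \<rho> * (if l = 1 then 1 else if l \<le> P + 1 then - tau (l - 1) else 0)) * f (int l))"
    by (simp only: a_eq distrib_right sum.distrib)
  also have "(\<Sum>l=0..P+1. (if l = 0 then 1 else if l \<le> P then - tau l else 0) * f (int l))
      = f 0 - (\<Sum>i=1..P. tau i * f (int i))"
  proof -
    have "(\<Sum>l=1..P+1. (if l = 0 then 1 else if l \<le> P then - tau l else 0) * f (int l)) = (\<Sum>i=1..P. - (tau i * f (int i)))"
      by (rule sum.mono_neutral_cong_right) auto
    then show ?thesis by (subst sum.atLeast_Suc_atMost) (auto simp: sum_negf)
  qed
  also have "(\<Sum>l=0..P+1. (if l = 0 then 0 else - \<rho> * (if l = 1 then 1 else if l \<le> P + 1 then - tau (l - 1) else 0)) * f (int l))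
      = - \<rho> * (f 1 - (\<Sum>i=1..P. tau i * f (int i + 1)))"
  proof -
    have "(\<Sum>l=0..P+1. (if l = 0 then 0 else - \<rho> * (if l = 1 then 1 else if l \<le> P + 1 then - tau (l - 1) else 0)) * f (int l))
      = (\<Sum>l=0..P. - \<rho> * ((if l = 0 then 1 else - tau l) * f (int l + 1)))"
      (is "sum ?g _ = sum ?h _")
    proof -
      have "sum ?g {0..P+1} = sum ?g {Suc 0..Suc P}" by (rule sum.mono_neutral_right) auto
      also have "\<dots> = (\<Sum>l=0..P. ?g (Suc l))" by (rule sum.shift_bounds_cl_Suc_ivl)
      also have "\<dots> = sum ?h {0..P}" by (intro sum.cong refl) (simp add: add.commute)
      finally show ?thesis .
    qed
    also have "\<dots> = - \<rho> * ((\<Sum>l=0..P. (if l = 0 then 1 else - tau l) * f (int l + 1)))"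
      by (simp only: sum_distrib_left)
    also have "(\<Sum>l=0..P. (if l = 0 then 1 else - tau l) * f (int l + 1)) = f 1 - (\<Sum>i=1..P. tau i * f (int i + 1))"
      by (subst sum.atLeast_Suc_atMost) (auto simp: sum_negf[symmetric] intro!: sum.cong)
    finally show ?thesis .
  qed
  finally show ?thesis by simp
qed

text \<open>\<open>L\<close> is extended to an even sequence \<open>e\<close> on the integers with
  vanishing residual \<open>u\<close> at nonnegative times. Evenness forces \<open>u\<close> to
  vanish at negative times too, so \<open>e\<close> solves the recursion everywhere. Stability then
  makes \<open>e\<close> bounded forwards, by evenness bounded altogether, and a bounded two-sided
  solution is 0.\<close>

lemma homogeneous_zero:
  assumes L: "\<And>d. d \<le> P + 1 \<Longrightarrow> (\<Sum>l=0..P+1. a (int l) * L (lag d l)) = 0"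
    and j: "j \<le> P + 1"
  shows "L j = 0"
proof -
  define e where "e d = ext_rec (\<lambda>l. a (int l)) (P + 1) L (nat \<bar>d\<bar>)" for d :: int
  have e_even: "e (- d) = e d" for d by (simp add: e_def)
  have e_L: "e d = L (nat \<bar>d\<bar>)" if "\<bar>d\<bar> \<le> int P + 1" for d
    using that by (simp add: e_def ext_rec.simps nat_le_iff)
  define u where "u d = (\<Sum>l=0..P+1. a (int l) * e (d - int l))" for d
  have u_nonneg: "u d = 0" if "d \<ge> 0" for d
  proof (cases "d \<le> int P + 1")
    case True
    then have "u d = (\<Sum>l=0..P+1. a (int l) * L (lag (nat d) l))"
      unfolding u_def using that by (intro sum.cong refl) (auto simp: e_L)
    then show ?thesis using L[of "nat d"] True by (simp add: nat_le_iff)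
  next
    case False
    have "e d = - (\<Sum>l=1..P+1. a (int l) * e (d - int l))"
      unfolding e_def using False
      by (subst ext_rec.simps) (auto intro!: sum.cong simp: nat_diff_distrib)
    then show ?thesis unfolding u_def by (subst sum.atLeast_Suc_atMost) auto
  qed
  \<comment> \<open>Filtering \<open>u\<close> by the time-reversed coefficients makes the total
    filter symmetric, so \<open>v\<close> inherits the evenness of \<open>e\<close>.\<close>
  define v where "v d = (\<Sum>l=0..P+1. a (int l) * u (d + int l))" for d
  have v_even: "v (- d) = v d" for d
  proof -
    have "v (- d) = (\<Sum>l=0..P+1. \<Sum>k=0..P+1. a (int l) * (a (int k) * e (d + int k - int l)))"
      unfolding v_def u_def sum_distrib_left
    proof (intro sum.cong refl)
      fix l k
      have "- d + int l - int k = - (d + int k - int l)" by simp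
      then show "a (int l) * (a (int k) * e (- d + int l - int k)) = a (int l) * (a (int k) * e (d + int k - int l))"
        by (simp only: e_even)
    qed
    also have "\<dots> = (\<Sum>k=0..P+1. \<Sum>l=0..P+1. a (int l) * (a (int k) * e (d + int k - int l)))"
      by (rule sum.swap)
    also have "\<dots> = v d"
      unfolding v_def u_def sum_distrib_left by (simp only: mult.left_commute)
    finally show ?thesis .
  qed
  have v_nonneg: "v d = 0" if "d \<ge> 0" for d
    unfolding v_def using that by (intro sum.neutral) (auto simp: u_nonneg)
  have v0: "v d = 0" for d
    using v_nonneg[of d] v_nonneg[of "- d"] v_even[of d] by (cases "d \<ge> 0") auto
  \<comment> \<open>Since \<open>a 0 = 1\<close>, \<open>v d = 0\<close> expresses
    \<open>u d\<close> through later values of \<open>u\<close>; the zeros spread backwards one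
    index at a time.\<close>
  have un: "\<forall>d \<ge> - int n. u d = 0" for n
  proof (induction n)
    case (Suc n)
    have "u d = 0" if "d = - int (Suc n)" for d
    proof -
      have "v d = u d + (\<Sum>l=1..P+1. a (int l) * u (d + int l))"
        unfolding v_def by (subst sum.atLeast_Suc_atMost) auto
      also have "(\<Sum>l=1..P+1. a (int l) * u (d + int l)) = 0"
        using Suc that by (intro sum.neutral) auto
      finally show ?thesis using v0 by simp
    qed
    moreover have "d \<ge> - int n \<or> d = - int (Suc n)" if "d \<ge> - int (Suc n)" for d using that by auto
    ultimately show ?case using Suc by blast
  qed (auto intro: u_nonneg)
  have u0: "u d = 0" for d
    using un[of "nat (- d)"] by auto
  define w where "w d = e d - (\<Sum>i=1..P. tau i * e (d - int i))" for d
  have w_rec: "w d = \<rho> * w (d - 1)" for d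
    using u0[of d] sum_a_split[of "\<lambda>l. e (d - l)"] unfolding u_def w_def by (simp add: algebra_simps)
  have w_pow: "w d = \<rho> ^ n * w (d - int n)" for d n
    by (induction n) (use w_rec[of "d - int _"] in \<open>auto simp: algebra_simps\<close>)
  let ?s = "\<Sum>k=1..P. \<bar>tau k\<bar>"
  have s1: "?s < 1" by (rule tau_less)
  have s0: "?s \<ge> 0" by (auto intro: sum_nonneg)
  have sum_bd: "\<bar>\<Sum>i=1..P. tau i * e (d - int i)\<bar> \<le> ?s * K" if "\<And>i. 1 \<le> i \<Longrightarrow> i \<le> P \<Longrightarrow> \<bar>e (d - int i)\<bar> \<le> K" for d K
    unfolding sum_distrib_right
    by (rule order_trans[OF sum_abs]) (auto intro!: sum_mono mult_left_mono that simp: abs_mult)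
  obtain K where K: "\<And>d. \<bar>e d\<bar> \<le> K"
  proof -
    \<comment> \<open>\<open>K\<close> dominates the starting values and satisfies
      \<open>\<bar>w 0\<bar> + ?s * K \<le> K\<close>, which the induction needs because |w n| \<le>
      |w 0| for n \<ge> 0.\<close>
    define K where "K = Max ((\<lambda>k. \<bar>e (int k)\<bar>) ` {0..P}) + \<bar>w 0\<bar> / (1 - ?s)"
    have q: "\<bar>w 0\<bar> / (1 - ?s) \<ge> 0" using s1 by simp
    have K1: "\<bar>e (int k)\<bar> \<le> K" if "k \<le> P" for k
    proof -
      have "\<bar>e (int k)\<bar> \<le> Max ((\<lambda>k. \<bar>e (int k)\<bar>) ` {0..P})" using that by (intro Max_ge) auto
      then show ?thesis using q by (simp add: K_def)
    qed
    have K2: "\<bar>w 0\<bar> \<le> (1 - ?s) * K"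
    proof -
      have "0 \<le> Max ((\<lambda>k. \<bar>e (int k)\<bar>) ` {0..P})" by (rule order_trans[OF _ Max_ge[of _ "\<bar>e (int 0)\<bar>"]]) (auto intro!: image_eqI[where x=0])
      then have "\<bar>w 0\<bar> / (1 - ?s) \<le> K" by (simp add: K_def)
      then show ?thesis using s1 by (simp add: pos_divide_le_eq mult.commute)
    qed
    have "\<bar>e (int n)\<bar> \<le> K" for n
    proof (induction n rule: less_induct)
      case (less n)
      show ?case
      proof (cases "n \<le> P")
        case False
        have "\<bar>w (int n)\<bar> = \<bar>\<rho>\<bar> ^ n * \<bar>w 0\<bar>" using w_pow[of "int n" n] by (simp add: abs_mult power_abs)
        also have "\<dots> \<le> 1 * \<bar>w 0\<bar>" using rho_less by (intro mult_right_mono power_le_one) auto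
        finally have "\<bar>w (int n)\<bar> \<le> (1 - ?s) * K" using K2 by simp
        moreover have "\<bar>\<Sum>i=1..P. tau i * e (int n - int i)\<bar> \<le> ?s * K"
        proof (rule sum_bd)
          fix i assume "1 \<le> i" "i \<le> P"
          then show "\<bar>e (int n - int i)\<bar> \<le> K" using less[of "n - i"] False by (simp add: of_nat_diff)
        qed
        ultimately show ?thesis by (simp add: w_def algebra_simps)
      qed (rule K1)
    qed
    then have "\<bar>e d\<bar> \<le> K" for d
      using e_even by (cases d rule: int_cases2) auto
    then show ?thesis by (rule that)
  qed
  have w_bd: "\<bar>w d\<bar> \<le> K + ?s * K" for d
    using order_trans[OF abs_triangle_ineq4 add_mono[OF K[of d] sum_bd[of d K]]] K unfolding w_def by blast
  \<comment> \<open>\<open>w d\<close> is \<open>\<rho> ^ n\<close> times a bounded value from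
    \<open>n\<close> steps earlier, for every \<open>n\<close>.\<close>
  have w0: "w d = 0" for d
  proof -
    have "(\<lambda>n. \<bar>\<rho>\<bar> ^ n * (K + ?s * K)) \<longlonglongrightarrow> 0 * (K + ?s * K)"
      using rho_less by (intro tendsto_mult LIMSEQ_realpow_zero tendsto_const) auto
    moreover have "\<bar>w d\<bar> \<le> \<bar>\<rho>\<bar> ^ n * (K + ?s * K)" for n
      using w_pow[of d n] w_bd[of "d - int n"] by (simp add: abs_mult power_abs mult_left_mono)
    ultimately have "\<bar>w d\<bar> \<le> 0" by (intro LIMSEQ_le_const[of _ 0]) auto
    then show ?thesis by simp
  qed
  \<comment> \<open>With \<open>w = 0\<close>, every value of \<open>e\<close> is a
    \<theta>-combination of earlier ones, so the bound contracts by \<open>?s\<close> at each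
    iteration.\<close>
  have e_bd: "\<bar>e d\<bar> \<le> ?s ^ n * K" for d n
  proof (induction n arbitrary: d)
    case (Suc n)
    have "e d = (\<Sum>i=1..P. tau i * e (d - int i))" using w0[of d] by (simp add: w_def)
    then show ?case using sum_bd[of d "?s ^ n * K"] Suc by (simp add: mult.assoc)
  qed (use K in simp)
  have "(\<lambda>n. ?s ^ n * K) \<longlonglongrightarrow> 0 * K"
    using s0 s1 by (intro tendsto_mult LIMSEQ_realpow_zero tendsto_const) auto
  then have "\<bar>e (int j)\<bar> \<le> 0" using e_bd by (intro LIMSEQ_le_const[of _ 0]) auto
  then show ?thesis using e_L[of "int j"] j by simp
qed

text \<open>\<open>lam\<close>, cut off after \<open>P + 1\<close>, solves the system, and
  \<open>homogeneous_zero\<close> applied to a difference makes it the only solution, as the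
  description operator requires.\<close>

lemma Lambda_eq: "k \<le> P + 1 \<Longrightarrow> Lambda \<theta> \<rho> k = lam k"
proof -
  define L0 where "L0 k = (if k \<le> P + 1 then lam k else 0)" for k
  have abs_le: "lag d l \<le> P + 1" if "d \<le> P + 1" "l \<le> P + 1" for d l
    using that by auto
  have row0: "(\<Sum>j=0..P+1. B_entry \<theta> \<rho> d j * L0 j) = (if d = 0 then 1 else 0)" if d: "d \<le> P + 1" for d
  proof -
    have "(\<Sum>l=0..P+1. a (int l) * L0 (lag d l)) = (\<Sum>l=0..P+1. a (int l) * lam (lag d l))"
      using d abs_le by (intro sum.cong refl) (auto simp: L0_def)
    then show ?thesis by (simp only: B_row[OF d] lam_yule_walker)
  qed
  have "Lambda \<theta> \<rho> = L0"
    unfolding Lambda_def card_P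
  proof (rule the_equality)
    show "(\<forall>d\<in>{0..P + 1}. (\<Sum>j=0..P + 1. B_entry \<theta> \<rho> d j * L0 j) = (if d = 0 then 1 else 0)) \<and> (\<forall>j>P + 1. L0 j = 0)"
      using row0 by (simp add: L0_def)
    fix L assume L: "(\<forall>d\<in>{0..P + 1}. (\<Sum>j=0..P + 1. B_entry \<theta> \<rho> d j * L j) = (if d = 0 then 1 else 0)) \<and> (\<forall>j>P + 1. L j = 0)"
    have "L j - L0 j = 0" if j: "j \<le> P + 1" for j
    proof (rule homogeneous_zero[OF _ j, of "\<lambda>j. L j - L0 j"])
      fix d assume d: "d \<le> P + 1"
      have "(\<Sum>j=0..P+1. B_entry \<theta> \<rho> d j * (L j - L0 j)) = 0"
        using L row0[OF d] d by (simp add: right_diff_distrib sum_subtractf)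
      then show "(\<Sum>l=0..P+1. a (int l) * (L (lag d l) - L0 (lag d l))) = 0"
        by (simp only: B_row[OF d])
    qed
    then show "L = L0" using L by (intro ext) (metis L0_def eq_iff_diff_eq_0 not_le)
  qed
  then show "k \<le> P + 1 \<Longrightarrow> ?thesis" by (simp add: L0_def)
qed

lemma Delta_nth: "Delta \<theta> \<rho> $ i $ j = lam (lag (idx i) (idx j))"
  using idx_range[of i] idx_range[of j] by (simp add: Delta_def Lambda_eq)

text \<open>\<Delta> is a Gram matrix of shifted impulse responses, so its quadratic form is the sum
  of squares of the filtered vector \<open>y\<close>. At the first nonzero coordinate of
  \<open>x\<close> only that coordinate contributes, with weight \<open>c 0 = 1\<close>.\<close>

lemma Delta_pos_def: "pos_def (Delta \<theta> \<rho>)"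
  unfolding pos_def_def
proof (intro conjI allI impI)
  show "transpose (Delta \<theta> \<rho>) = Delta \<theta> \<rho>"
    by (simp add: vec_eq_iff transpose_def Delta_nth abs_minus_commute)
  fix x :: "real^'p::{finite,linorder}" assume x: "x \<noteq> 0"
  define y where "y m = (\<Sum>i\<in>UNIV. x $ i * ci (int m - int (idx i)))" for m :: nat
  have s: "summable (\<lambda>m. ci (int m - int k) * ci (int m - int l))" for k l
    using summable_ci_prod[of k "- int l"] by simp
  have y2: "(y m)\<^sup>2 = (\<Sum>i\<in>UNIV. \<Sum>j\<in>UNIV. (x $ i * x $ j) * (ci (int m - int (idx i)) * ci (int m - int (idx j))))" for m
    unfolding y_def power2_eq_square sum_product by (intro sum.cong refl) (simp add: mult_ac)
  have sy: "summable (\<lambda>m. (y m)\<^sup>2)"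
    unfolding y2 by (intro summable_sum summable_mult s)
  have "x \<bullet> (Delta \<theta> \<rho> *v x) = (\<Sum>i\<in>UNIV. \<Sum>j\<in>UNIV. (x $ i * x $ j) * (\<Sum>m. ci (int m - int (idx i)) * ci (int m - int (idx j))))"
    by (simp add: inner_vec_def matrix_vector_mult_def Delta_nth lam_shift sum_distrib_left mult_ac)
  also have "\<dots> = (\<Sum>m. (y m)\<^sup>2)"
    unfolding y2 by (simp add: suminf_sum suminf_mult summable_sum summable_mult s)
  finally have q: "x \<bullet> (Delta \<theta> \<rho> *v x) = (\<Sum>m. (y m)\<^sup>2)" .
  obtain i0 where i0: "x $ i0 \<noteq> 0" "\<And>i. x $ i \<noteq> 0 \<Longrightarrow> idx i0 \<le> idx i"
  proof -
    have "\<exists>i. x $ i \<noteq> 0" using x by (auto simp: vec_eq_iff)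
    then show ?thesis using that ex_has_least_nat[of "\<lambda>i. x $ i \<noteq> 0" _ idx] by blast
  qed
  have "y (idx i0) = (\<Sum>i\<in>UNIV. if i = i0 then x $ i0 else 0)"
    unfolding y_def
  proof (intro sum.cong refl)
    fix i
    show "x $ i * ci (int (idx i0) - int (idx i)) = (if i = i0 then x $ i0 else 0)"
    proof (cases "i = i0")
      case False
      then have "x $ i = 0 \<or> idx i0 < idx i" using i0(2)[of i] idx_inject[of i0 i] by (auto simp: le_less)
      then show ?thesis using False by auto
    qed (simp add: ci_def c_0)
  qed
  then have "(y (idx i0))\<^sup>2 > 0" using i0 by simp
  then show "0 < x \<bullet> (Delta \<theta> \<rho> *v x)"
    unfolding q by (intro suminf_pos2[OF sy]) auto
qed

text \<open>The type \<open>'p option option\<close> has \<open>P + 2\<close> elements, so over it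
  \<open>B\<close> is an honest square matrix and a trivial kernel yields a left inverse.\<close>

lemma B_inverse:
  obtains Ci where "\<And>r j. j \<le> P + 1 \<Longrightarrow>
    r j = (\<Sum>d=0..P+1. Ci j d * (\<Sum>l=0..P+1. a (int l) * r (lag d l)))"
proof -
  have "card (UNIV :: 'p option option set) = card {0..P+1}" by (simp add: card_UNIV_option)
  then obtain f where f: "bij_betw f (UNIV :: 'p option option set) {0..P+1}"
    by (metis finite_same_card_bij finite finite_atLeastAtMost)
  have sum_f: "(\<Sum>x\<in>UNIV. g (f x)) = (\<Sum>k=0..P+1. g k)" for g :: "nat \<Rightarrow> real"
    by (rule sum.reindex_bij_betw[OF f])
  have f_range: "f x \<le> P + 1" for x using f by (auto simp: bij_betw_def)
  have f_inv: "f (inv_into UNIV f k) = k" if "k \<le> P + 1" for k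
    using f that by (simp add: bij_betw_def f_inv_into_f)
  define Bm where "Bm = (\<chi> x y. B_entry \<theta> \<rho> (f x) (f y))"
  have Bv: "(Bm *v z) $ x = (\<Sum>l=0..P+1. a (int l) * z $ inv_into UNIV f (lag (f x) l))" for z x
  proof -
    have inj: "inj f" using f by (simp add: bij_betw_def)
    have "(Bm *v z) $ x = (\<Sum>y\<in>UNIV. B_entry \<theta> \<rho> (f x) (f y) * z $ inv_into UNIV f (f y))"
      by (simp add: Bm_def matrix_vector_mult_def inv_f_f[OF inj])
    also have "\<dots> = (\<Sum>j=0..P+1. B_entry \<theta> \<rho> (f x) j * z $ inv_into UNIV f j)" by (rule sum_f)
    finally show ?thesis by (simp only: B_row[OF f_range])
  qed
  have "\<exists>C. C ** Bm = mat 1"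
    unfolding matrix_left_invertible_ker
  proof (intro allI impI)
    fix z assume z: "Bm *v z = 0"
    have "z $ inv_into UNIV f j = 0" if "j \<le> P + 1" for j
    proof (rule homogeneous_zero[OF _ that])
      fix d assume d: "d \<le> P + 1"
      show "(\<Sum>l=0..P+1. a (int l) * z $ inv_into UNIV f (lag d l)) = 0"
        using Bv[of z "inv_into UNIV f d"] z f_inv[OF d] by simp
    qed
    moreover have "z $ x = z $ inv_into UNIV f (f x)" for x
      using f by (simp add: bij_betw_def inv_f_f)
    ultimately show "z = 0" using f_range by (simp add: vec_eq_iff)
  qed
  then obtain C where C: "C ** Bm = mat 1" by blast
  show ?thesis
  proof (rule that[of "\<lambda>j d. C $ inv_into UNIV f j $ inv_into UNIV f d"])
    fix r :: "nat \<Rightarrow> real" and j assume j: "j \<le> P + 1"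
    define z where "z = (\<chi> x. r (f x))"
    have Bz: "(Bm *v z) $ x = (\<Sum>l=0..P+1. a (int l) * r (lag (f x) l))" for x
      unfolding Bv using f_range[of x]
      by (intro sum.cong refl) (auto simp: z_def f_inv)
    have "r j = z $ inv_into UNIV f j" using j by (simp add: z_def f_inv)
    also have "\<dots> = (C *v (Bm *v z)) $ inv_into UNIV f j"
      by (simp add: matrix_vector_mul_assoc C)
    also have "\<dots> = (\<Sum>y\<in>UNIV. C $ inv_into UNIV f j $ y * (Bm *v z) $ y)"
      by (subst (1) matrix_vector_mult_def) simp
    also have "\<dots> = (\<Sum>y\<in>UNIV. C $ inv_into UNIV f j $ inv_into UNIV f (f y) * (\<Sum>l=0..P+1. a (int l) * r (lag (f y) l)))"
      using f by (simp only: Bz) (simp add: bij_betw_def inv_f_f)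
    also have "\<dots> = (\<Sum>d=0..P+1. C $ inv_into UNIV f j $ inv_into UNIV f d * (\<Sum>l=0..P+1. a (int l) * r (lag d l)))"
      by (rule sum_f)
    finally show "r j = (\<Sum>d=0..P+1. C $ inv_into UNIV f j $ inv_into UNIV f d * (\<Sum>l=0..P+1. a (int l) * r (lag d l)))" .
  qed
qed

end

section \<open>Empirical covariances\<close>

text \<open>Cauchy-Schwarz with weights |w i|, applied twice. It bounds fourth moments of moving
  averages by those of single terms, uniformly when the weights are summable.\<close>

lemma weighted_power4_le:
  fixes w x :: "'i \<Rightarrow> real"
  shows "(\<Sum>i\<in>I. w i * x i) ^ 4 \<le> (\<Sum>i\<in>I. \<bar>w i\<bar>) ^ 3 * (\<Sum>i\<in>I. \<bar>w i\<bar> * x i ^ 4)"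
proof -
  have cs: "(\<Sum>i\<in>I. w i * y i)\<^sup>2 \<le> (\<Sum>i\<in>I. \<bar>w i\<bar>) * (\<Sum>i\<in>I. \<bar>w i\<bar> * (y i)\<^sup>2)" for w y :: "'i \<Rightarrow> real"
  proof -
    have "(\<Sum>i\<in>I. w i * y i) = (\<Sum>i\<in>I. sqrt \<bar>w i\<bar> * (sgn (w i) * sqrt \<bar>w i\<bar> * y i))"
      by (intro sum.cong refl) (simp add: mult.left_commute[of "sqrt _"] sgn_if)
    also have "\<dots>\<^sup>2 \<le> (\<Sum>i\<in>I. (sqrt \<bar>w i\<bar>)\<^sup>2) * (\<Sum>i\<in>I. (sgn (w i) * sqrt \<bar>w i\<bar> * y i)\<^sup>2)"
      by (rule Cauchy_Schwarz_ineq_sum)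
    also have "(\<Sum>i\<in>I. (sgn (w i) * sqrt \<bar>w i\<bar> * y i)\<^sup>2) = (\<Sum>i\<in>I. \<bar>w i\<bar> * (y i)\<^sup>2)"
      by (intro sum.cong refl) (auto simp: power_mult_distrib sgn_if)
    finally show ?thesis by simp
  qed
  let ?W = "\<Sum>i\<in>I. \<bar>w i\<bar>"
  have "(\<Sum>i\<in>I. w i * x i) ^ 4 = ((\<Sum>i\<in>I. w i * x i)\<^sup>2)\<^sup>2" by (simp flip: power_mult)
  also have "\<dots> \<le> (?W * (\<Sum>i\<in>I. \<bar>w i\<bar> * (x i)\<^sup>2))\<^sup>2"
    by (rule power_mono[OF cs]) simp
  also have "\<dots> = ?W\<^sup>2 * (\<Sum>i\<in>I. \<bar>w i\<bar> * (x i)\<^sup>2)\<^sup>2" by (simp add: power_mult_distrib)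
  also have "\<dots> \<le> ?W\<^sup>2 * (?W * (\<Sum>i\<in>I. \<bar>w i\<bar> * ((x i)\<^sup>2)\<^sup>2))"
    using cs[of "\<lambda>i. \<bar>w i\<bar>" "\<lambda>i. (x i)\<^sup>2"] by (intro mult_left_mono) auto
  also have "\<dots> = ?W ^ 3 * (\<Sum>i\<in>I. \<bar>w i\<bar> * x i ^ 4)"
    by (simp add: power2_eq_square power3_eq_cube power4_eq_xxxx mult.assoc)
  finally show ?thesis .
qed

section \<open>Sequences negligible against the square root of the sample size\<close>

context prob_space begin

text \<open>The error class for unnormalised sums: such terms disappear from the normal equations
  after scaling by \<open>sqrt n\<close>, and from averages a fortiori.\<close>

definition negligible_seq :: "(nat \<Rightarrow> 'a \<Rightarrow> real) \<Rightarrow> bool" where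
  "negligible_seq e \<longleftrightarrow> to_zero_prob M (\<lambda>n \<omega>. e n \<omega> / sqrt (real n))"

lemma negligible_seq_L1:
  assumes int: "\<And>n. integrable M (e n)" and K: "\<And>n. expectation (\<lambda>\<omega>. \<bar>e n \<omega>\<bar>) \<le> K"
  shows "negligible_seq e"
  unfolding negligible_seq_def
proof (rule to_zero_prob_L1)
  show "integrable M (\<lambda>\<omega>. e n \<omega> / sqrt (real n))" for n using int by simp
  have "(\<lambda>n. K / sqrt (real n)) \<longlonglongrightarrow> 0"
    by (intro tendsto_divide_0[OF tendsto_const] filterlim_at_top_imp_at_infinity
        filterlim_compose[OF sqrt_at_top filterlim_real_sequentially])
  then show "(\<lambda>n. expectation (\<lambda>\<omega>. \<bar>e n \<omega> / sqrt (real n)\<bar>)) \<longlonglongrightarrow> 0"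
    by (rule Lim_null_comparison[rotated]) (simp add: K divide_right_mono)
qed

lemma negligible_seq_add: "negligible_seq e \<Longrightarrow> negligible_seq f \<Longrightarrow> negligible_seq (\<lambda>n \<omega>. e n \<omega> + f n \<omega>)"
  unfolding negligible_seq_def using to_zero_prob_add by (simp add: add_divide_distrib)

lemma negligible_seq_diff: "negligible_seq e \<Longrightarrow> negligible_seq f \<Longrightarrow> negligible_seq (\<lambda>n \<omega>. e n \<omega> - f n \<omega>)"
  unfolding negligible_seq_def using to_zero_prob_diff by (simp add: diff_divide_distrib)

lemma negligible_seq_cmult: "negligible_seq e \<Longrightarrow> negligible_seq (\<lambda>n \<omega>. c * e n \<omega>)"
  unfolding negligible_seq_def using to_zero_prob_cmult[of "\<lambda>n \<omega>. e n \<omega> / sqrt (real n)" c] by simp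

lemma negligible_seq_sum: "(\<And>i. i \<in> I \<Longrightarrow> negligible_seq (e i)) \<Longrightarrow> negligible_seq (\<lambda>n \<omega>. \<Sum>i\<in>I. e i n \<omega>)"
  unfolding negligible_seq_def sum_divide_distrib by (rule to_zero_prob_sum)

lemma negligible_seq_const: "negligible_seq (\<lambda>n \<omega>. c)"
  by (rule negligible_seq_L1[where K="\<bar>c\<bar>"]) (auto simp: prob_space)

lemma negligible_seq_zero_prob:
  assumes "negligible_seq e"
  shows "to_zero_prob M (\<lambda>n \<omega>. e n \<omega> / real n)"
proof (rule to_zero_prob_mono)
  show z: "to_zero_prob M (\<lambda>n \<omega>. e n \<omega> / sqrt (real n))" using assms by (simp add: negligible_seq_def)
  have [measurable]: "(\<lambda>\<omega>. e n \<omega> / sqrt (real n)) \<in> borel_measurable M" for n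
    using z by (simp add: to_zero_prob_def)
  have eq: "e n \<omega> / real n = (e n \<omega> / sqrt (real n)) / sqrt (real n)" for n \<omega>
    by (simp add: divide_divide_eq_left)
  show "(\<lambda>\<omega>. e n \<omega> / real n) \<in> borel_measurable M" for n unfolding eq by measurable
  show "\<bar>e n \<omega> / real n\<bar> \<le> \<bar>e n \<omega> / sqrt (real n)\<bar>" for n \<omega>
  proof (cases "n = 0")
    case False
    then have s1: "sqrt (real n) \<ge> 1" by simp
    have "\<bar>x / s\<bar> \<le> \<bar>x\<bar>" if "s \<ge> 1" for x s :: real
    proof -
      have "\<bar>x / s\<bar> = \<bar>x\<bar> / s" using that by simp
      also have "\<dots> \<le> \<bar>x\<bar> / 1" by (rule divide_left_mono) (use that in auto)
      finally show ?thesis by simp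
    qed
    from this[OF s1] show ?thesis unfolding eq .
  qed simp
qed

lemma
  assumes [measurable]: "f \<in> borel_measurable M" "g \<in> borel_measurable M"
    and "integrable M (\<lambda>\<omega>. (f \<omega>)\<^sup>2)" "integrable M (\<lambda>\<omega>. (g \<omega> :: real)\<^sup>2)"
  shows integrable_product_of_squares: "integrable M (\<lambda>\<omega>. f \<omega> * g \<omega>)"
    and expectation_product_le: "expectation (\<lambda>\<omega>. \<bar>f \<omega> * g \<omega>\<bar>) \<le> expectation (\<lambda>\<omega>. (f \<omega>)\<^sup>2) + expectation (\<lambda>\<omega>. (g \<omega>)\<^sup>2)"
proof -
  show i: "integrable M (\<lambda>\<omega>. f \<omega> * g \<omega>)"
    by (rule Bochner_Integration.integrable_bound[of _ "\<lambda>\<omega>. (f \<omega>)\<^sup>2 + (g \<omega>)\<^sup>2"])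
      (use assms abs_mult_le_squares in auto)
  have "expectation (\<lambda>\<omega>. \<bar>f \<omega> * g \<omega>\<bar>) \<le> expectation (\<lambda>\<omega>. (f \<omega>)\<^sup>2 + (g \<omega>)\<^sup>2)"
    using i assms(3,4) by (intro integral_mono abs_mult_le_squares) auto
  then show "expectation (\<lambda>\<omega>. \<bar>f \<omega> * g \<omega>\<bar>) \<le> expectation (\<lambda>\<omega>. (f \<omega>)\<^sup>2) + expectation (\<lambda>\<omega>. (g \<omega>)\<^sup>2)"
    using assms(3,4) by simp
qed

end

lemma mat_1_minus_scale_mult:
  fixes J :: "real^'n^'n"
  shows "(mat 1 - g *\<^sub>R J) *v b = b - g *\<^sub>R (J *v b)"
  by (simp only: matrix_vector_mult_diff_rdistrib matrix_vector_mul_lid scaleR_matrix_vector_assoc)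

context ar_coeffs begin

lemma sum_ci_le:
  fixes f :: "nat \<Rightarrow> int"
  assumes "finite I" "inj_on f I"
  shows "(\<Sum>x\<in>I. \<bar>ci (f x)\<bar>) \<le> cbound"
proof -
  let ?J = "{x\<in>I. f x \<ge> 0}"
  have inj: "inj_on (\<lambda>x. nat (f x)) ?J"
    using assms(2) by (auto simp: inj_on_def)
  have "(\<Sum>x\<in>I. \<bar>ci (f x)\<bar>) = (\<Sum>x\<in>?J. \<bar>ci (f x)\<bar>)"
    by (rule sum.mono_neutral_right) (use assms in \<open>auto simp: ci_def\<close>)
  also have "\<dots> = (\<Sum>x\<in>?J. \<bar>c (nat (f x))\<bar>)"
    by (intro sum.cong) (auto simp: ci_def)
  also have "\<dots> = (\<Sum>k\<in>(\<lambda>x. nat (f x)) ` ?J. \<bar>c k\<bar>)"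
    by (simp add: sum.reindex[OF inj])
  also have "\<dots> \<le> cbound" by (rule sum_c_le) (use assms in auto)
  finally show ?thesis .
qed

definition gam where "gam = theta_last \<theta> * \<rho>"

lemma gam_less: "\<bar>gam\<bar> < 1"
proof -
  have "\<bar>tau P\<bar> \<le> (\<Sum>k=1..P. \<bar>tau k\<bar>)"
    using P_pos by (intro member_le_sum) auto
  then have "\<bar>tau P\<bar> \<le> 1" using tau_less by linarith
  then have "\<bar>gam\<bar> \<le> 1 * \<bar>\<rho>\<bar>" unfolding gam_def theta_last_def abs_mult card_P by (rule mult_right_mono) simp
  then show ?thesis using rho_less by simp
qed

lemma alpha_gam: "alpha \<theta> \<rho> * (1 - gam\<^sup>2) = 1"
proof -
  have nz: "1 - gam \<noteq> 0" "1 + gam \<noteq> 0" using gam_less by auto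
  have "1 - gam\<^sup>2 = (1 - gam) * (1 + gam)" by (simp add: power2_eq_square algebra_simps)
  moreover have "alpha \<theta> \<rho> = 1 / ((1 - gam) * (1 + gam))" by (simp only: alpha_def gam_def)
  moreover have "1 / x * x = 1" if "x \<noteq> 0" for x :: real using that by simp
  ultimately show ?thesis using nz by (metis mult_eq_0_iff)
qed

abbreviation bet where "bet \<equiv> coord (beta \<theta> \<rho>)"

lemma theta_star_nth:
  "theta_star \<theta> \<rho> $ i = alpha \<theta> \<rho> * (bet (idx i) - gam * bet (P + 1 - idx i))"
proof -
  have "P + 1 - idx i \<in> {1..P}" using idx_range[of i] by auto
  then obtain j :: 'p where j: "idx j = P + 1 - idx i" using ex_idx by auto
  have eq: "idx i + idx k = Suc P \<longleftrightarrow> k = j" for k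
    using j idx_range[of i] idx_inject[of k j] by auto
  have "(exchange_mat *v beta \<theta> \<rho>) $ i = (\<Sum>k\<in>UNIV. if k = j then beta \<theta> \<rho> $ k else 0)"
    by (simp add: exchange_mat_def matrix_vector_mult_def eq if_distrib[of "\<lambda>x. x * _"] cong: if_cong)
  also have "\<dots> = bet (P + 1 - idx i)" unfolding j[symmetric] by (simp add: coord_idx)
  finally have J: "(exchange_mat *v beta \<theta> \<rho>) $ i = bet (P + 1 - idx i)" .
  show ?thesis
    unfolding theta_star_def gam_def[symmetric] mat_1_minus_scale_mult vector_scaleR_component
      vector_minus_component J coord_idx real_scaleR_def by (rule refl)
qed

text \<open>Row \<open>d\<close> reads \<open>N d = r d - (\<Sum>j. bet j * r (lag d j)) + gam * r
  (P + 1 - d)\<close>. Subtracting \<open>gam\<close> times row \<open>P + 1 - d\<close>, whose last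
  term is \<open>gam * r d\<close>, cancels the unwanted lag and leaves
  \<open>(1 - gam\<^sup>2) * r d\<close>; \<alpha> is the inverse of that factor. Reflecting the
  summation index turns the sum of the second row into one over the same lags.\<close>

lemma yule_walker_reflect:
  fixes r :: "nat \<Rightarrow> real"
  defines "N \<equiv> \<lambda>d. \<Sum>l=0..P+1. a (int l) * r (lag d l)"
  assumes d: "1 \<le> d" "d \<le> P"
  shows "r d - (\<Sum>j=1..P. r (lag d j) * (alpha \<theta> \<rho> * (bet j - gam * bet (P + 1 - j))))
    = alpha \<theta> \<rho> * (N d - gam * N (P + 1 - d))"
proof -
  have N: "N d = r d - (\<Sum>j=1..P. bet j * r (lag d j)) + gam * r (P + 1 - d)"
    if "1 \<le> d" "d \<le> P" for d
  proof -
    have "N d = r d + (\<Sum>l=1..P+1. a (int l) * r (lag d l))"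
      unfolding N_def by (subst sum.atLeast_Suc_atMost) auto
    also have "(\<Sum>l=1..P+1. a (int l) * r (lag d l))
        = (\<Sum>l=1..P. a (int l) * r (lag d l)) + a (int P + 1) * r (lag d (P + 1))"
      by (simp add: add.commute)
    also have "(\<Sum>l=1..P. a (int l) * r (lag d l)) = (\<Sum>j=1..P. - (bet j * r (lag d j)))"
      by (intro sum.cong refl) (auto simp: a_coeff_def)
    also have "lag d (P + 1) = P + 1 - d" using that by auto
    finally show ?thesis by (simp add: sum_negf a_last gam_def theta_last_def)
  qed
  have d': "1 \<le> P + 1 - d" "P + 1 - d \<le> P" "P + 1 - (P + 1 - d) = d" using d by auto
  have reflect: "(\<Sum>j=1..P. bet j * r (lag (P + 1 - d) j)) = (\<Sum>j=1..P. bet (P + 1 - j) * r (lag d j))"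
    by (rule sum.reindex_bij_witness[where i="\<lambda>j. P + 1 - j" and j="\<lambda>j. P + 1 - j"])
      (use d in \<open>auto simp: of_nat_diff intro!: arg_cong[where f=r]\<close>)
  have "(\<Sum>j=1..P. r (lag d j) * (alpha \<theta> \<rho> * (bet j - gam * bet (P + 1 - j))))
      = alpha \<theta> \<rho> * ((\<Sum>j=1..P. bet j * r (lag d j)) - gam * (\<Sum>j=1..P. bet (P + 1 - j) * r (lag d j)))"
    unfolding sum_distrib_left sum_subtractf[symmetric] by (intro sum.cong refl) (simp add: algebra_simps)
  moreover have "alpha \<theta> \<rho> * (N d - gam * N (P + 1 - d)) = (alpha \<theta> \<rho> * (1 - gam\<^sup>2)) * r d
      - alpha \<theta> \<rho> * ((\<Sum>j=1..P. bet j * r (lag d j)) - gam * (\<Sum>j=1..P. bet (P + 1 - j) * r (lag d j)))"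
    unfolding N[OF d] N[OF d'(1,2)] d'(3) reflect by (simp add: algebra_simps power2_eq_square)
  ultimately show ?thesis by (simp only: alpha_gam mult_1_left)
qed

end

section \<open>Empirical covariances of the noise-driven process\<close>

locale ar_noise = noise M V \<sigma>2 + ar_coeffs \<theta> \<rho> P
  for M :: "'a measure" and V \<sigma>2 and \<theta> :: "real ^ 'p::{finite,linorder}" and \<rho> P
begin

text \<open>The solution driven by the noise alone, started from zero values.\<close>

definition U :: "int \<Rightarrow> 'a \<Rightarrow> real" where
  "U k \<omega> = (\<Sum>j=1..nat k. ci (k - int j) * V j \<omega>)"

lemma U_nonpos [simp]: "k \<le> 0 \<Longrightarrow> U k \<omega> = 0" by (simp add: U_def)

lemma U_rec: "n \<ge> 1 \<Longrightarrow> (\<Sum>l=0..P+1. a (int l) * U (int n - int l) \<omega>) = V n \<omega>"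
proof -
  assume n: "n \<ge> 1"
  have "(\<Sum>l=0..P+1. a (int l) * U (int n - int l) \<omega>)
      = (\<Sum>l=0..P+1. \<Sum>j=1..n. (a (int l) * ci ((int n - int j) - int l)) * V j \<omega>)"
  proof (intro sum.cong refl)
    fix l
    have "U (int n - int l) \<omega> = (\<Sum>j=1..n. ci ((int n - int l) - int j) * V j \<omega>)"
      unfolding U_def by (rule sum.mono_neutral_left) auto
    also have "a (int l) * \<dots> = (\<Sum>j=1..n. (a (int l) * ci ((int n - int j) - int l)) * V j \<omega>)"
      by (simp add: sum_distrib_left mult.assoc algebra_simps)
    finally show "a (int l) * U (int n - int l) \<omega> = (\<Sum>j=1..n. (a (int l) * ci ((int n - int j) - int l)) * V j \<omega>)" .
  qed
  also have "\<dots> = (\<Sum>j=1..n. (\<Sum>l=0..P+1. a (int l) * ci ((int n - int j) - int l)) * V j \<omega>)"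
    by (subst sum.swap) (simp only: sum_distrib_right)
  also have "\<dots> = (\<Sum>j=1..n. if j = n then V n \<omega> else 0)"
    unfolding c_rec by (intro sum.cong refl) auto
  also have "\<dots> = V n \<omega>" using n by simp
  finally show ?thesis .
qed

lemma measurable_U_past: "k < int m \<Longrightarrow> U k \<in> borel_measurable (past m)"
proof -
  assume k: "k < int m"
  have [measurable]: "V j \<in> borel_measurable (past m)" if "j \<in> {1..nat k}" for j
    using that k by (intro measurable_V_past) auto
  show ?thesis unfolding U_def[abs_def] by measurable
qed

lemma measurable_U [measurable]: "U k \<in> borel_measurable M"
  using measurable_past_M[OF measurable_U_past[of k "Suc (nat k)"]] by simp

definition K4 where "K4 = cbound ^ 4 * expectation (\<lambda>\<omega>. V 1 \<omega> ^ 4)"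

lemma expectation_V4: "j \<ge> 1 \<Longrightarrow> expectation (\<lambda>\<omega>. V j \<omega> ^ 4) = expectation (\<lambda>\<omega>. V 1 \<omega> ^ 4)"
proof -
  assume j: "j \<ge> 1"
  have "expectation (\<lambda>\<omega>. V j \<omega> ^ 4) = (\<integral>x. x ^ 4 \<partial>distr M borel (V j))"
    using measurable_V[OF j] by (subst integral_distr) auto
  also have "\<dots> = (\<integral>x. x ^ 4 \<partial>distr M borel (V 1))" by (simp only: distr_V[OF j])
  also have "\<dots> = expectation (\<lambda>\<omega>. V 1 \<omega> ^ 4)"
    using measurable_V[of 1] by (subst integral_distr) auto
  finally show ?thesis .
qed

text \<open>The bound is uniform in \<open>k\<close> because the weights of the moving average sum
  to at most \<open>cbound\<close>.\<close>

lemma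
  shows integrable_U4: "integrable M (\<lambda>\<omega>. U k \<omega> ^ 4)"
    and expectation_U4: "expectation (\<lambda>\<omega>. U k \<omega> ^ 4) \<le> K4"
proof -
  let ?I = "{1..nat k}"
  let ?w = "\<lambda>j. \<bar>ci (k - int j)\<bar>"
  let ?F = "\<lambda>\<omega>. cbound ^ 3 * (\<Sum>j\<in>?I. ?w j * V j \<omega> ^ 4)"
  have W: "(\<Sum>j\<in>?I. ?w j) \<le> cbound" by (rule sum_ci_le) (auto simp: inj_on_def)
  have cb: "cbound \<ge> 0" using cbound_ge(2) by simp
  have le: "U k \<omega> ^ 4 \<le> ?F \<omega>" for \<omega>
  proof -
    have "U k \<omega> ^ 4 \<le> (\<Sum>j\<in>?I. ?w j) ^ 3 * (\<Sum>j\<in>?I. ?w j * V j \<omega> ^ 4)"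
      unfolding U_def by (rule weighted_power4_le)
    also have "\<dots> \<le> ?F \<omega>"
      using W by (intro mult_right_mono power_mono) (auto intro!: sum_nonneg)
    finally show ?thesis .
  qed
  have iF: "integrable M ?F"
    by (intro integrable_mult_right Bochner_Integration.integrable_sum) (auto intro: fourth_V)
  show i: "integrable M (\<lambda>\<omega>. U k \<omega> ^ 4)"
    by (rule Bochner_Integration.integrable_bound[OF iF]) (use le in \<open>auto intro!: AE_I2 order_trans[OF _ abs_ge_self]\<close>)
  have "expectation (\<lambda>\<omega>. U k \<omega> ^ 4) \<le> expectation ?F" by (intro integral_mono i iF le)
  also have "\<dots> = cbound ^ 3 * (\<Sum>j\<in>?I. ?w j * expectation (\<lambda>\<omega>. V j \<omega> ^ 4))"
    by (subst integral_mult_right_zero, subst Bochner_Integration.integral_sum) (auto intro: fourth_V)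
  also have "(\<Sum>j\<in>?I. ?w j * expectation (\<lambda>\<omega>. V j \<omega> ^ 4)) = (\<Sum>j\<in>?I. ?w j) * expectation (\<lambda>\<omega>. V 1 \<omega> ^ 4)"
    unfolding sum_distrib_right by (intro sum.cong refl arg_cong2[where f="(*)"] expectation_V4) simp
  also have "cbound ^ 3 * \<dots> \<le> cbound ^ 3 * (cbound * expectation (\<lambda>\<omega>. V 1 \<omega> ^ 4))"
    using W cb by (intro mult_left_mono mult_right_mono) auto
  also have "\<dots> = K4" by (simp add: K4_def power3_eq_cube power4_eq_xxxx mult.assoc)
  finally show "expectation (\<lambda>\<omega>. U k \<omega> ^ 4) \<le> K4" .
qed

definition K2 where "K2 = 1 + K4"

lemma
  shows integrable_U2: "integrable M (\<lambda>\<omega>. (U k \<omega>)\<^sup>2)"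
    and expectation_U2: "expectation (\<lambda>\<omega>. (U k \<omega>)\<^sup>2) \<le> K2"
proof -
  have le: "x\<^sup>2 \<le> 1 + x ^ 4" for x :: real
  proof -
    have "2 * x\<^sup>2 \<le> 1 + x ^ 4"
      using zero_le_power2[of "x\<^sup>2 - 1"] by (simp add: power2_diff flip: power_mult)
    moreover have "0 \<le> x\<^sup>2" by simp
    ultimately show ?thesis by linarith
  qed
  show i: "integrable M (\<lambda>\<omega>. (U k \<omega>)\<^sup>2)"
    by (rule Bochner_Integration.integrable_bound[of _ "\<lambda>\<omega>. 1 + U k \<omega> ^ 4"])
      (use integrable_U4[of k] le in auto)
  have "expectation (\<lambda>\<omega>. (U k \<omega>)\<^sup>2) \<le> expectation (\<lambda>\<omega>. 1 + U k \<omega> ^ 4)"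
    using i integrable_U4[of k] by (intro integral_mono le) auto
  also have "\<dots> \<le> K2" using expectation_U4[of k] integrable_U4[of k] by (simp add: K2_def prob_space)
  finally show "expectation (\<lambda>\<omega>. (U k \<omega>)\<^sup>2) \<le> K2" .
qed

definition C :: "nat \<Rightarrow> nat \<Rightarrow> nat \<Rightarrow> 'a \<Rightarrow> real" where
  "C n i j \<omega> = (\<Sum>k=1..n. U (int k - int i) \<omega> * U (int k - int j) \<omega>)"

definition N :: "nat \<Rightarrow> nat \<Rightarrow> 'a \<Rightarrow> real" where
  "N n d \<omega> = (\<Sum>k=1..n. U (int k - int d) \<omega> * V k \<omega>)"

lemma C_sym: "C n i j \<omega> = C n j i \<omega>" by (simp add: C_def mult.commute)

text \<open>Shifting both lags drops the newest product; the one that enters at the other end lies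
  at nonpositive times, where \<open>U\<close> is 0.\<close>

lemma C_Suc: "C n (Suc i) (Suc j) \<omega> = C n i j \<omega> - U (int n - int i) \<omega> * U (int n - int j) \<omega>"
proof (induction n)
  case (Suc n)
  have "int (Suc n) - int (Suc i) = int n - int i" for i by simp
  then show ?case using Suc by (simp add: C_def)
qed (simp add: C_def)

lemma C_shift_negligible: "negligible_seq (\<lambda>n \<omega>. C n (i + m) (j + m) \<omega> - C n i j \<omega>)"
proof (induction m)
  case 0
  then show ?case using negligible_seq_const[of 0] by simp
next
  case (Suc m)
  have "negligible_seq (\<lambda>n \<omega>. U (int n - int (i + m)) \<omega> * U (int n - int (j + m)) \<omega>)"
  proof (rule negligible_seq_L1)
    show "integrable M (\<lambda>\<omega>. U (int n - int (i + m)) \<omega> * U (int n - int (j + m)) \<omega>)" for n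
      by (rule integrable_product_of_squares) (auto intro: integrable_U2)
    show "expectation (\<lambda>\<omega>. \<bar>U (int n - int (i + m)) \<omega> * U (int n - int (j + m)) \<omega>\<bar>) \<le> K2 + K2" for n
      by (rule order_trans[OF expectation_product_le add_mono]) (auto intro: integrable_U2 expectation_U2)
  qed
  from negligible_seq_diff[OF Suc this] show ?case by (simp add: C_Suc algebra_simps)
qed

lemma C_toeplitz_negligible: "negligible_seq (\<lambda>n \<omega>. C n i j \<omega> - C n 0 (lag i j) \<omega>)"
proof -
  have *: "negligible_seq (\<lambda>n \<omega>. C n i j \<omega> - C n 0 (lag i j) \<omega>)" if "i \<le> j" for i j
  proof -
    have "lag i j = j - i" using that by auto
    then show ?thesis using C_shift_negligible[of 0 i "j - i"] that by simp
  qed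
  show ?thesis
    using *[of i j] *[of j i] by (cases "i \<le> j") (auto simp: C_sym[of _ i j] abs_minus_commute)
qed

lemma sum_a_C: "(\<Sum>l=0..P+1. a (int l) * C n l d \<omega>) = N n d \<omega>"
proof -
  have "(\<Sum>l=0..P+1. a (int l) * C n l d \<omega>)
      = (\<Sum>k=1..n. \<Sum>l=0..P+1. a (int l) * U (int k - int l) \<omega> * U (int k - int d) \<omega>)"
    unfolding C_def sum_distrib_left by (subst sum.swap) (simp only: mult.assoc)
  also have "\<dots> = (\<Sum>k=1..n. V k \<omega> * U (int k - int d) \<omega>)"
    unfolding sum_distrib_right[symmetric] by (intro sum.cong refl) (simp only: U_rec atLeastAtMost_iff)
  finally show ?thesis by (simp only: N_def mult.commute)
qed

lemma yule_walker_negligible: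
  "negligible_seq (\<lambda>n \<omega>. (\<Sum>l=0..P+1. a (int l) * C n 0 (lag d l) \<omega>) - N n d \<omega>)"
proof -
  have "negligible_seq (\<lambda>n \<omega>. \<Sum>l=0..P+1. (- a (int l)) * (C n l d \<omega> - C n 0 (lag l d) \<omega>))"
    by (intro negligible_seq_sum negligible_seq_cmult C_toeplitz_negligible)
  moreover have "(\<Sum>l=0..P+1. (- a (int l)) * (C n l d \<omega> - C n 0 (lag l d) \<omega>))
      = (\<Sum>l=0..P+1. a (int l) * C n 0 (lag d l) \<omega>) - N n d \<omega>" for n \<omega>
    unfolding sum_a_C[symmetric] sum_subtractf[symmetric]
    by (intro sum.cong refl) (simp add: algebra_simps abs_minus_commute)
  ultimately show ?thesis by simp
qed

text \<open>The second moment of the sum grows at most linearly, so dividing by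
  \<open>sqrt n\<close> keeps it bounded in mean.\<close>

lemma martingale_to_zero:
  assumes h: "\<And>k. k \<ge> 1 \<Longrightarrow> h k \<in> borel_measurable (past k)"
    and ih: "\<And>k. k \<ge> 1 \<Longrightarrow> integrable M (\<lambda>\<omega>. (h k \<omega>)\<^sup>2)"
    and Eh: "\<And>k. k \<ge> 1 \<Longrightarrow> expectation (\<lambda>\<omega>. (h k \<omega>)\<^sup>2) \<le> K"
    and g: "g \<in> borel_measurable borel"
    and ig: "\<And>k. k \<ge> 1 \<Longrightarrow> integrable M (\<lambda>\<omega>. (g (V k \<omega>))\<^sup>2)"
    and Eg: "\<And>k. k \<ge> 1 \<Longrightarrow> expectation (\<lambda>\<omega>. g (V k \<omega>)) = 0"
    and Eg2: "\<And>k. k \<ge> 1 \<Longrightarrow> expectation (\<lambda>\<omega>. (g (V k \<omega>))\<^sup>2) \<le> s"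
  shows "to_zero_prob M (\<lambda>n \<omega>. (\<Sum>k=1..n. h k \<omega> * g (V k \<omega>)) / real n)"
    and "integrable M (\<lambda>\<omega>. (\<Sum>k=1..n. h k \<omega> * g (V k \<omega>)) / sqrt (real n))"
    and "expectation (\<lambda>\<omega>. \<bar>(\<Sum>k=1..n. h k \<omega> * g (V k \<omega>)) / sqrt (real n)\<bar>) \<le> sqrt (K * s)"
proof -
  let ?S = "\<lambda>n \<omega>. \<Sum>k=1..n. h k \<omega> * g (V k \<omega>)"
  have Sm: "?S n \<in> borel_measurable M" for n
    by (rule measurable_past_M[OF measurable_martingale[OF h ih Eh g ig Eg Eg2]])
  have iS2: "integrable M (\<lambda>\<omega>. (?S n \<omega>)\<^sup>2)" for n
    by (rule integrable_martingale_square[OF h ih Eh g ig Eg Eg2])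
  have iS: "integrable M (?S n)" for n by (rule integrable_of_square[OF Sm iS2])
  show i: "integrable M (\<lambda>\<omega>. ?S n \<omega> / sqrt (real n))" for n using iS[of n] by simp
  have Ks: "K * s \<ge> 0"
    using order_trans[OF _ Eh[of 1], of 0] order_trans[OF _ Eg2[of 1], of 0] by simp
  have b: "expectation (\<lambda>\<omega>. \<bar>?S n \<omega> / sqrt (real n)\<bar>) \<le> sqrt (K * s)" for n
  proof (cases "n = 0")
    case False
    have "expectation (\<lambda>\<omega>. \<bar>?S n \<omega>\<bar>) \<le> sqrt (expectation (\<lambda>\<omega>. (?S n \<omega>)\<^sup>2))"
      by (rule expectation_abs_le_sqrt[OF Sm iS2])
    also have "\<dots> \<le> sqrt (real n * K * s)"
      using expectation_martingale_square[OF h ih Eh g ig Eg Eg2, of n] by simp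
    also have "\<dots> = sqrt (real n) * sqrt (K * s)" by (simp add: real_sqrt_mult)
    finally show ?thesis using False by (simp add: divide_le_eq mult.commute)
  qed (use Ks in simp)
  show "expectation (\<lambda>\<omega>. \<bar>?S n \<omega> / sqrt (real n)\<bar>) \<le> sqrt (K * s)" by (rule b)
  \<comment> \<open>The sequence already carries one factor \<open>1 / sqrt n\<close>; negligibility
    supplies the second.\<close>
  have "negligible_seq (\<lambda>n \<omega>. ?S n \<omega> / sqrt (real n))" by (rule negligible_seq_L1[OF i b])
  then show "to_zero_prob M (\<lambda>n \<omega>. ?S n \<omega> / real n)" by (simp add: negligible_seq_def)
qed

text \<open>A lag d \<ge> 1 is what makes the factor in front of \<open>V k\<close>
  predictable.\<close>

lemma N_properties:
  assumes "d \<ge> 1"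
  shows N_to_zero: "to_zero_prob M (\<lambda>n \<omega>. N n d \<omega> / real n)"
    and integrable_N: "integrable M (\<lambda>\<omega>. N n d \<omega> / sqrt (real n))"
    and expectation_N: "expectation (\<lambda>\<omega>. \<bar>N n d \<omega> / sqrt (real n)\<bar>) \<le> sqrt (K2 * \<sigma>2)"
  unfolding N_def using assms
  by (intro martingale_to_zero[where g="\<lambda>x. x" and K=K2 and s=\<sigma>2] measurable_U_past integrable_U2 expectation_U2
      integrable_V2 mean_V eq_refl[OF square_V]; simp)+

text \<open>At lag 0 the factor \<open>U k\<close> contains \<open>V k\<close>. The recursion
  isolates it: \<open>U k - V k\<close> is predictable, so \<open>N\<close> splits into a martingale
  and the sum of the squares of the noise. Once centred, these squares form a second martingale,
  whose variance is controlled by the fourth moment. The value 0 at \<open>n = 0\<close> matches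
  division by zero and keeps the identity valid for every \<open>n\<close>.\<close>

lemma N_0_tendsto: "to_zero_prob M (\<lambda>n \<omega>. N n 0 \<omega> / real n - (if n = 0 then 0 else \<sigma>2))"
proof -
  let ?h = "\<lambda>k \<omega>. U (int k) \<omega> - V k \<omega>"
  have h_eq: "?h k \<omega> = (\<Sum>l=1..P+1. - a (int l) * U (int k - int l) \<omega>)" if "k \<ge> 1" for k \<omega>
    using U_rec[OF that, of \<omega>] by (subst (asm) sum.atLeast_Suc_atMost) (auto simp: sum_negf)
  have hm: "?h k \<in> borel_measurable (past k)" if k: "k \<ge> 1" for k
  proof -
    have "(\<lambda>\<omega>. \<Sum>l=1..P+1. - a (int l) * U (int k - int l) \<omega>) \<in> borel_measurable (past k)"
      by (intro borel_measurable_sum borel_measurable_times borel_measurable_const measurable_U_past) (use k in auto)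
    then show ?thesis using h_eq[OF k] by (simp cong: measurable_cong)
  qed
  have hb: "(?h k \<omega>)\<^sup>2 \<le> 2 * (U (int k) \<omega>)\<^sup>2 + 2 * (V k \<omega>)\<^sup>2" for k \<omega>
    using zero_le_power2[of "U (int k) \<omega> + V k \<omega>"] by (simp add: power2_diff power2_sum)
  have ih: "integrable M (\<lambda>\<omega>. (?h k \<omega>)\<^sup>2)" if k: "k \<ge> 1" for k
    by (rule Bochner_Integration.integrable_bound[of _ "\<lambda>\<omega>. 2 * (U (int k) \<omega>)\<^sup>2 + 2 * (V k \<omega>)\<^sup>2"])
      (use integrable_U2 integrable_V2[OF k] hb measurable_V[OF k] in auto)
  have Eh: "expectation (\<lambda>\<omega>. (?h k \<omega>)\<^sup>2) \<le> 2 * K2 + 2 * \<sigma>2" if k: "k \<ge> 1" for k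
  proof -
    have "expectation (\<lambda>\<omega>. (?h k \<omega>)\<^sup>2) \<le> expectation (\<lambda>\<omega>. 2 * (U (int k) \<omega>)\<^sup>2 + 2 * (V k \<omega>)\<^sup>2)"
      using ih[OF k] integrable_U2 integrable_V2[OF k] by (intro integral_mono hb) auto
    also have "\<dots> = 2 * expectation (\<lambda>\<omega>. (U (int k) \<omega>)\<^sup>2) + 2 * \<sigma>2"
      using integrable_U2[of "int k"] integrable_V2[OF k] by (simp add: square_V[OF k])
    finally show ?thesis using expectation_U2[of "int k"] by linarith
  qed
  have z1: "to_zero_prob M (\<lambda>n \<omega>. (\<Sum>k=1..n. ?h k \<omega> * V k \<omega>) / real n)"
    by (rule martingale_to_zero(1)[where g="\<lambda>x. x" and s=\<sigma>2, OF hm ih Eh])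
      (auto intro: integrable_V2 mean_V simp: square_V)
  let ?g = "\<lambda>x::real. x\<^sup>2 - \<sigma>2"
  have gb: "(?g x)\<^sup>2 \<le> 2 * x ^ 4 + 2 * \<sigma>2\<^sup>2" for x
    using zero_le_power2[of "x\<^sup>2 + \<sigma>2"] by (simp add: power2_diff power2_sum flip: power_mult)
  have ig: "integrable M (\<lambda>\<omega>. (?g (V k \<omega>))\<^sup>2)" if k: "k \<ge> 1" for k
    by (rule Bochner_Integration.integrable_bound[of _ "\<lambda>\<omega>. 2 * V k \<omega> ^ 4 + 2 * \<sigma>2\<^sup>2"])
      (use fourth_V[OF k] gb measurable_V[OF k] in auto)
  have Eg: "expectation (\<lambda>\<omega>. ?g (V k \<omega>)) = 0" if k: "k \<ge> 1" for k
    using integrable_V2[OF k] square_V[OF k] by (simp add: prob_space)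
  have Eg2: "expectation (\<lambda>\<omega>. (?g (V k \<omega>))\<^sup>2) \<le> 2 * expectation (\<lambda>\<omega>. V 1 \<omega> ^ 4) + 2 * \<sigma>2\<^sup>2" if k: "k \<ge> 1" for k
  proof -
    have "expectation (\<lambda>\<omega>. (?g (V k \<omega>))\<^sup>2) \<le> expectation (\<lambda>\<omega>. 2 * V k \<omega> ^ 4 + 2 * \<sigma>2\<^sup>2)"
      using ig[OF k] fourth_V[OF k] by (intro integral_mono gb) auto
    also have "\<dots> = 2 * expectation (\<lambda>\<omega>. V 1 \<omega> ^ 4) + 2 * \<sigma>2\<^sup>2"
      unfolding expectation_V4[OF k, symmetric] using fourth_V[OF k] by (simp add: prob_space)
    finally show ?thesis .
  qed
  have z2: "to_zero_prob M (\<lambda>n \<omega>. (\<Sum>k=1..n. 1 * ?g (V k \<omega>)) / real n)"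
    by (rule martingale_to_zero(1)[where K=1, OF _ _ _ _ ig Eg Eg2]) (auto simp: prob_space)
  have eq: "N n 0 \<omega> / real n - (if n = 0 then 0 else \<sigma>2)
      = (\<Sum>k=1..n. ?h k \<omega> * V k \<omega>) / real n + (\<Sum>k=1..n. 1 * ?g (V k \<omega>)) / real n" for n \<omega>
  proof -
    have "(\<Sum>k=1..n. ?h k \<omega> * V k \<omega>) + (\<Sum>k=1..n. 1 * ?g (V k \<omega>)) = (\<Sum>k=1..n. U (int k) \<omega> * V k \<omega> - \<sigma>2)"
      unfolding sum.distrib[symmetric] by (intro sum.cong refl) (simp add: algebra_simps power2_eq_square)
    also have "\<dots> = N n 0 \<omega> - real n * \<sigma>2" by (simp add: sum_subtractf N_def)
    finally show ?thesis by (auto simp: field_simps)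
  qed
  show ?thesis unfolding eq by (rule to_zero_prob_add[OF z1 z2])
qed

lemma C_0_tendsto:
  assumes j: "j \<le> P + 1"
  shows "to_zero_prob M (\<lambda>n \<omega>. C n 0 j \<omega> / real n - (if n = 0 then 0 else \<sigma>2 * lam j))"
proof -
  obtain Ci where Ci: "\<And>r j. j \<le> P + 1 \<Longrightarrow>
    r j = (\<Sum>d=0..P+1. Ci j d * (\<Sum>l=0..P+1. a (int l) * r (lag d l)))"
    using B_inverse by blast
  let ?s = "\<lambda>n::nat. if n = 0 then 0 else \<sigma>2"
  let ?Y = "\<lambda>n d \<omega>. (\<Sum>l=0..P+1. a (int l) * C n 0 (lag d l) \<omega>)"
  have d0: "to_zero_prob M (\<lambda>n \<omega>. ?Y n d \<omega> / real n - (if d = 0 then ?s n else 0))" for d :: nat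
  proof -
    have z: "to_zero_prob M (\<lambda>n \<omega>. (?Y n d \<omega> - N n d \<omega>) / real n)"
      by (rule negligible_seq_zero_prob[OF yule_walker_negligible])
    have z': "to_zero_prob M (\<lambda>n \<omega>. N n d \<omega> / real n - (if d = 0 then ?s n else 0))"
      using N_0_tendsto N_to_zero[of d] by (cases "d = 0") auto
    show ?thesis using to_zero_prob_add[OF z z'] by (simp add: diff_divide_distrib)
  qed
  have "C n 0 j \<omega> / real n - ?s n * lam j
      = (\<Sum>d=0..P+1. Ci j d * (?Y n d \<omega> / real n - (if d = 0 then ?s n else 0)))" for n \<omega>
  proof -
    have "C n 0 j \<omega> / real n - ?s n * lam j = (\<Sum>d=0..P+1. Ci j d *
        (\<Sum>l=0..P+1. a (int l) * (C n 0 (lag d l) \<omega> / real n - ?s n * lam (lag d l))))"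
      by (rule Ci[OF j, of "\<lambda>j. C n 0 j \<omega> / real n - ?s n * lam j"])
    also have "\<dots> = (\<Sum>d=0..P+1. Ci j d * (?Y n d \<omega> / real n - ?s n * (\<Sum>l=0..P+1. a (int l) * lam (lag d l))))"
      unfolding sum_divide_distrib sum_distrib_left sum_subtractf[symmetric]
      by (intro sum.cong refl) (simp add: algebra_simps)
    also have "\<dots> = (\<Sum>d=0..P+1. Ci j d * (?Y n d \<omega> / real n - (if d = 0 then ?s n else 0)))"
      unfolding lam_yule_walker by (intro sum.cong refl) simp
    finally show ?thesis .
  qed
  moreover have "to_zero_prob M (\<lambda>n \<omega>. \<Sum>d=0..P+1. Ci j d * (?Y n d \<omega> / real n - (if d = 0 then ?s n else 0)))"
    by (intro to_zero_prob_sum to_zero_prob_cmult d0)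
  moreover have "(if n = 0 then 0 else \<sigma>2 * lam j) = ?s n * lam j" for n :: nat by simp
  ultimately show ?thesis by simp
qed

lemma to_zero_prob_drop_0:
  assumes "to_zero_prob M (\<lambda>n \<omega>. Y n \<omega> - (if n = 0 then 0 else q))"
  shows "to_zero_prob M (\<lambda>n \<omega>. Y n \<omega> - q)"
proof -
  have z: "to_zero_prob M (\<lambda>n \<omega>. if n = 0 then q else 0)"
  proof (rule to_zero_prob_L1)
    have "eventually (\<lambda>n. expectation (\<lambda>\<omega>. \<bar>if n = 0 then q else 0\<bar>) = 0) sequentially"
      using eventually_gt_at_top[of 0] by eventually_elim simp
    then show "(\<lambda>n. expectation (\<lambda>\<omega>. \<bar>if n = 0 then q else 0\<bar>)) \<longlonglongrightarrow> 0"
      by (rule tendsto_eventually)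
  qed simp
  have "Y n \<omega> - (if n = 0 then 0 else q) - (if n = 0 then q else 0) = Y n \<omega> - q" for n \<omega> by simp
  with to_zero_prob_diff[OF assms z] show ?thesis by simp
qed

lemma C_tendsto:
  assumes "i \<le> P + 1" "j \<le> P + 1"
  shows "to_zero_prob M (\<lambda>n \<omega>. C n i j \<omega> / real n - \<sigma>2 * lam (lag i j))"
proof (rule to_zero_prob_drop_0)
  have "lag i j \<le> P + 1" using assms by auto
  from to_zero_prob_add[OF negligible_seq_zero_prob[OF C_toeplitz_negligible[of i j]] C_0_tendsto[OF this]]
  show "to_zero_prob M (\<lambda>n \<omega>. C n i j \<omega> / real n - (if n = 0 then 0 else \<sigma>2 * lam (lag i j)))"
    by (simp add: diff_divide_distrib)
qed

text \<open>\<open>predictable_clt\<close> for \<open>h k = (\<Sum>i. w i * U (k - i))\<close>,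
  predictable because all lags are at least 1. The mean of its squares is a quadratic form in the
  empirical covariances; this gives one factor \<open>\<sigma>2\<close>, and the variance of
  \<open>V k\<close> gives the other.\<close>

lemma N_clt:
  fixes w :: "nat \<Rightarrow> real"
  shows "(\<lambda>n. expectation (\<lambda>\<omega>. cis (\<Sum>i=1..P. w i * (N n i \<omega> / sqrt (real n)))))
    \<longlonglongrightarrow> of_real (exp (- (\<sigma>2 * (\<sigma>2 * (\<Sum>i=1..P. \<Sum>j=1..P. w i * w j * lam (lag i j)))) / 2))"
proof -
  let ?h = "\<lambda>k \<omega>. \<Sum>i=1..P. w i * U (int k - int i) \<omega>"
  let ?q = "\<sigma>2 * (\<Sum>i=1..P. \<Sum>j=1..P. w i * w j * lam (lag i j))"
  let ?W = "\<Sum>i=1..P. \<bar>w i\<bar>"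
  let ?F = "\<lambda>k \<omega>. ?W ^ 3 * (\<Sum>i=1..P. \<bar>w i\<bar> * U (int k - int i) \<omega> ^ 4)"
  have hm: "?h k \<in> borel_measurable (past k)" if "k \<ge> 1" for k
    by (intro borel_measurable_sum borel_measurable_times borel_measurable_const measurable_U_past) (use that in auto)
  have le: "?h k \<omega> ^ 4 \<le> ?F k \<omega>" for k \<omega> by (rule weighted_power4_le)
  have iF: "integrable M (?F k)" for k
    by (intro integrable_mult_right Bochner_Integration.integrable_sum) (auto intro: integrable_U4)
  have i4: "integrable M (\<lambda>\<omega>. ?h k \<omega> ^ 4)" for k
    by (rule Bochner_Integration.integrable_bound[OF iF]) (use le in \<open>auto intro!: AE_I2 order_trans[OF _ abs_ge_self]\<close>)
  have b4: "expectation (\<lambda>\<omega>. ?h k \<omega> ^ 4) \<le> ?W ^ 3 * (\<Sum>i=1..P. \<bar>w i\<bar> * K4)" for k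
  proof -
    have "expectation (\<lambda>\<omega>. ?h k \<omega> ^ 4) \<le> expectation (?F k)" by (intro integral_mono i4 iF le)
    also have "\<dots> = ?W ^ 3 * (\<Sum>i=1..P. \<bar>w i\<bar> * expectation (\<lambda>\<omega>. U (int k - int i) \<omega> ^ 4))"
      by (subst integral_mult_right_zero, subst Bochner_Integration.integral_sum) (auto intro: integrable_U4)
    also have "\<dots> \<le> ?W ^ 3 * (\<Sum>i=1..P. \<bar>w i\<bar> * K4)"
      by (intro mult_left_mono sum_mono expectation_U4) (auto intro: sum_nonneg)
    finally show ?thesis .
  qed
  have Q: "to_zero_prob M (\<lambda>n \<omega>. (\<Sum>k=1..n. (?h k \<omega>)\<^sup>2) / real n - ?q)"
  proof -
    have "(\<Sum>k=1..n. (?h k \<omega>)\<^sup>2) / real n - ?q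
        = (\<Sum>i=1..P. \<Sum>j=1..P. (w i * w j) * (C n i j \<omega> / real n - \<sigma>2 * lam (lag i j)))" for n \<omega>
    proof -
      have "(\<Sum>k=1..n. (?h k \<omega>)\<^sup>2)
          = (\<Sum>k=1..n. \<Sum>i=1..P. \<Sum>j=1..P. w i * w j * (U (int k - int i) \<omega> * U (int k - int j) \<omega>))"
        unfolding power2_eq_square sum_product by (intro sum.cong refl) (simp add: mult_ac)
      also have "\<dots> = (\<Sum>i=1..P. \<Sum>k=1..n. \<Sum>j=1..P. w i * w j * (U (int k - int i) \<omega> * U (int k - int j) \<omega>))"
        by (rule sum.swap)
      also have "\<dots> = (\<Sum>i=1..P. \<Sum>j=1..P. \<Sum>k=1..n. w i * w j * (U (int k - int i) \<omega> * U (int k - int j) \<omega>))"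
        by (intro sum.cong refl sum.swap)
      finally have "(\<Sum>k=1..n. (?h k \<omega>)\<^sup>2) = (\<Sum>i=1..P. \<Sum>j=1..P. w i * w j * C n i j \<omega>)"
        by (simp only: C_def sum_distrib_left)
      then have "(\<Sum>k=1..n. (?h k \<omega>)\<^sup>2) / real n - ?q
          = (\<Sum>i=1..P. \<Sum>j=1..P. w i * w j * C n i j \<omega>) / real n - ?q" by (simp only:)
      also have "\<dots> = (\<Sum>i=1..P. \<Sum>j=1..P. (w i * w j) * (C n i j \<omega> / real n - \<sigma>2 * lam (lag i j)))"
        by (simp add: sum_divide_distrib sum_distrib_left sum_subtractf right_diff_distrib mult_ac)
      finally show ?thesis .
    qed
    moreover have "to_zero_prob M (\<lambda>n \<omega>. \<Sum>i=1..P. \<Sum>j=1..P. (w i * w j) * (C n i j \<omega> / real n - \<sigma>2 * lam (lag i j)))"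
      by (intro to_zero_prob_sum to_zero_prob_cmult C_tendsto) auto
    ultimately show ?thesis by simp
  qed
  have "(\<Sum>k=1..n. ?h k \<omega> * V k \<omega>) / sqrt (real n) = (\<Sum>i=1..P. w i * (N n i \<omega> / sqrt (real n)))" for n \<omega>
  proof -
    have "(\<Sum>k=1..n. ?h k \<omega> * V k \<omega>) = (\<Sum>i=1..P. \<Sum>k=1..n. w i * U (int k - int i) \<omega> * V k \<omega>)"
      unfolding sum_distrib_right by (rule sum.swap)
    also have "\<dots> = (\<Sum>i=1..P. w i * N n i \<omega>)" by (simp only: N_def sum_distrib_left mult.assoc)
    finally show ?thesis by (simp add: sum_divide_distrib)
  qed
  with predictable_clt[OF hm i4 b4 Q] show ?thesis by simp
qed

end

section \<open>The least squares estimator\<close>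

lemma borel_measurable_det [measurable (raw)]:
  fixes A :: "'a \<Rightarrow> real^'n^'n"
  assumes "\<And>i j. (\<lambda>\<omega>. A \<omega> $ i $ j) \<in> borel_measurable M"
  shows "(\<lambda>\<omega>. det (A \<omega>)) \<in> borel_measurable M"
  unfolding det_def
  by (intro borel_measurable_sum borel_measurable_times borel_measurable_const borel_measurable_prod assms)

lemma S_mat_nth: "S_mat X S n \<omega> $ i $ j = (\<Sum>k=0..n. Phi X k \<omega> $ i * Phi X k \<omega> $ j) + S $ i $ j"
  by (simp add: S_mat_def outer_def)

text \<open>The outer products are positive semidefinite and \<open>S\<close> makes the sum
  definite, so the estimator involves a genuine inverse at every outcome and every
  \<open>n\<close>.\<close>

lemma S_mat_pos_def:
  assumes "pos_def S"
  shows "pos_def (S_mat X S n \<omega>)"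
  unfolding pos_def_def
proof (intro conjI allI impI)
  have "S $ j $ i = S $ i $ j" for i j
    using assms unfolding pos_def_def transpose_def by (metis vec_lambda_beta)
  then show "transpose (S_mat X S n \<omega>) = S_mat X S n \<omega>"
    by (simp add: vec_eq_iff transpose_def S_mat_nth mult.commute)
  fix x :: "real^'a::{finite,linorder}" assume x: "x \<noteq> 0"
  have outer: "outer u u *v x = (u \<bullet> x) *\<^sub>R u" for u :: "real^'a::{finite,linorder}"
    by (simp add: vec_eq_iff outer_def matrix_vector_mult_def inner_vec_def sum_distrib_left mult_ac)
  have sumv: "sum f I *v x = (\<Sum>k\<in>I. f k *v x)" for f :: "nat \<Rightarrow> real^'a::{finite,linorder}^'a::{finite,linorder}" and I
    by (induction I rule: infinite_finite_induct) (auto simp: matrix_vector_mult_add_rdistrib)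
  have "x \<bullet> (S_mat X S n \<omega> *v x) = (\<Sum>k=0..n. (Phi X k \<omega> \<bullet> x)\<^sup>2) + x \<bullet> (S *v x)"
    by (simp add: S_mat_def matrix_vector_mult_add_rdistrib sumv outer inner_add_right inner_sum_right
        power2_eq_square inner_commute)
  moreover have "x \<bullet> (S *v x) > 0" using assms x by (simp add: pos_def_def)
  moreover have "(\<Sum>k=0..n. (Phi X k \<omega> \<bullet> x)\<^sup>2) \<ge> 0" by (intro sum_nonneg) simp
  ultimately show "0 < x \<bullet> (S_mat X S n \<omega> *v x)" by linarith
qed

section \<open>The observed process and its normal equations\<close>

locale least_squares = ar_noise M V \<sigma>2 \<theta> \<rho> P
  for M :: "'a measure" and V \<sigma>2 and \<theta> :: "real ^ 'p::{finite,linorder}" and \<rho> P +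
  fixes X :: "int \<Rightarrow> 'a \<Rightarrow> real" and eps :: "nat \<Rightarrow> 'a \<Rightarrow> real"
    and S :: "real ^ 'p::{finite,linorder} ^ 'p::{finite,linorder}"
  assumes X_rec: "\<And>n \<omega>. n \<ge> 1 \<Longrightarrow> \<omega> \<in> space M \<Longrightarrow>
      X (int n) \<omega> = (\<Sum>i\<in>UNIV. \<theta> $ i * X (int n - int (idx i)) \<omega>) + eps n \<omega>"
    and eps_rec: "\<And>n \<omega>. n \<ge> 1 \<Longrightarrow> \<omega> \<in> space M \<Longrightarrow> eps n \<omega> = \<rho> * eps (n - 1) \<omega> + V n \<omega>"
    and X_0: "\<And>\<omega>. \<omega> \<in> space M \<Longrightarrow> X 0 \<omega> = eps 0 \<omega>"
    and X_neg: "\<And>k \<omega>. k \<in> {1..P} \<Longrightarrow> \<omega> \<in> space M \<Longrightarrow> X (- int k) \<omega> = 0"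
    and measurable_eps [measurable]: "eps 0 \<in> borel_measurable M"
    and integrable_eps: "integrable M (\<lambda>\<omega>. (eps 0 \<omega>)\<^sup>2)"
    and S_pos: "pos_def S"
    and \<sigma>2_pos: "\<sigma>2 > 0"
begin

lemma sum_theta: "(\<Sum>i\<in>UNIV. \<theta> $ i * f (int (idx i))) = (\<Sum>k=1..P. tau k * f (int k))"
  using sum_idx[of "\<lambda>k. tau k * f (int k)"] by (simp only: coord_idx)

lemma X_recurrence:
  assumes n: "n \<ge> 1" and w: "\<omega> \<in> space M"
  shows "(\<Sum>l=0..P+1. a (int l) * X (int n - int l) \<omega>) = V n \<omega>"
proof -
  have 1: "X (int n) \<omega> - (\<Sum>k=1..P. tau k * X (int n - int k) \<omega>) = eps n \<omega>"
    using X_rec[OF n w] sum_theta[of "\<lambda>k. X (int n - k) \<omega>"] by simp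
  have 2: "X (int n - 1) \<omega> - (\<Sum>k=1..P. tau k * X (int n - (int k + 1)) \<omega>) = eps (n - 1) \<omega>"
  \<comment> \<open>The \<theta>-recursion is assumed from time 1 on; at time 0 it holds because
    \<open>X 0 = eps 0\<close> and the earlier values vanish.\<close>
  proof (cases "n = 1")
    case True
    have "(\<Sum>k=1..P. tau k * X (- int k) \<omega>) = 0" using X_neg[OF _ w] by (intro sum.neutral) auto
    then show ?thesis using True X_0[OF w] by simp
  next
    case False
    then have m: "n - 1 \<ge> 1" "int (n - 1) = int n - 1" using n by auto
    have "int (n - 1) - k = int n - (k + 1)" for k using m by simp
    then show ?thesis
      using X_rec[OF m(1) w] sum_theta[of "\<lambda>k. X (int (n - 1) - k) \<omega>"] m(2) by (simp add: diff_diff_eq add.commute)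
  qed
  have "(\<Sum>l=0..P+1. a (int l) * X (int n - int l) \<omega>) = eps n \<omega> - \<rho> * eps (n - 1) \<omega>"
    using sum_a_split[of "\<lambda>l. X (int n - l) \<omega>"] 1 2 by simp
  then show ?thesis using eps_rec[OF n w] by simp
qed

text \<open>Both sides satisfy the same recursion with leading coefficient 1 and agree at the times
  from \<open>- P\<close> to 0, where \<open>U\<close> vanishes and \<open>ci\<close> is the unit
  pulse.\<close>

lemma X_eq:
  assumes k: "k \<ge> - int P" and w: "\<omega> \<in> space M"
  shows "X k \<omega> = U k \<omega> + ci k * eps 0 \<omega>"
proof -
  have nonpos: "X k \<omega> = U k \<omega> + ci k * eps 0 \<omega>" if "k \<le> 0" "k \<ge> - int P" for k
  proof (cases "k = 0")
    case False
    then have "X (- int (nat (- k))) \<omega> = 0" using that by (intro X_neg[OF _ w]) auto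
    then show ?thesis using that False by simp
  qed (use X_0[OF w] c_0 in \<open>simp add: ci_def\<close>)
  have "X (int n) \<omega> = U (int n) \<omega> + ci (int n) * eps 0 \<omega>" for n
  proof (induction n rule: less_induct)
    case (less n)
    show ?case
    proof (cases "n = 0")
      case False
      then have n: "n \<ge> 1" by simp
      let ?Z = "\<lambda>k. U k \<omega> + ci k * eps 0 \<omega>"
      have "(\<Sum>l=0..P+1. a (int l) * ?Z (int n - int l))
          = (\<Sum>l=0..P+1. a (int l) * U (int n - int l) \<omega>) + (\<Sum>l=0..P+1. a (int l) * ci (int n - int l)) * eps 0 \<omega>"
        by (simp only: distrib_left sum.distrib sum_distrib_right mult.assoc)
      also have "\<dots> = V n \<omega>" unfolding U_rec[OF n] c_rec using n by simp
      finally have Z: "(\<Sum>l=0..P+1. a (int l) * ?Z (int n - int l)) = (\<Sum>l=0..P+1. a (int l) * X (int n - int l) \<omega>)"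
        using X_recurrence[OF n w] by simp
      have split: "(\<Sum>l=0..P+1. f l) = f 0 + (\<Sum>l=1..P+1. f l)" for f :: "nat \<Rightarrow> real"
        by (subst sum.atLeast_Suc_atMost) auto
      have rest: "(\<Sum>l=1..P+1. a (int l) * ?Z (int n - int l)) = (\<Sum>l=1..P+1. a (int l) * X (int n - int l) \<omega>)"
      proof (intro sum.cong refl arg_cong2[where f="(*)"])
        fix l assume l: "l \<in> {1..P+1}"
        show "?Z (int n - int l) = X (int n - int l) \<omega>"
        proof (cases "l \<le> n")
          case True
          then have eq: "int n - int l = int (n - l)" by (simp add: of_nat_diff)
          show ?thesis unfolding eq by (rule less[symmetric]) (use l n in auto)
        next
          case False
          \<comment> \<open>n \<ge> 1 and l \<le> P + 1 keep the index at \<open>- P\<close> or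
            above, within the known initial values.\<close>
          then show ?thesis using nonpos[of "int n - int l"] l n by simp
        qed
      qed
      from Z have "a (int 0) * ?Z (int n - int 0) = a (int 0) * X (int n - int 0) \<omega>"
        unfolding split rest by (rule add_right_imp_eq)
      then show ?thesis by simp
    qed (use nonpos[of 0] in simp)
  qed
  note pos = this
  show ?thesis
  proof (cases "k \<ge> 0")
    case True
    then show ?thesis using pos[of "nat k"] by simp
  next
    case False
    then show ?thesis using nonpos[of k] k by simp
  qed
qed

definition CX :: "nat \<Rightarrow> nat \<Rightarrow> nat \<Rightarrow> 'a \<Rightarrow> real" where
  "CX n i j \<omega> = (\<Sum>k=1..n. X (int k - int i) \<omega> * X (int k - int j) \<omega>)"

lemma measurable_X: "k \<ge> - int P \<Longrightarrow> X k \<in> borel_measurable M"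
proof -
  assume k: "k \<ge> - int P"
  have "(\<lambda>\<omega>. U k \<omega> + ci k * eps 0 \<omega>) \<in> borel_measurable M" by measurable
  then show ?thesis by (subst measurable_cong[OF X_eq[OF k]])
qed

text \<open>Every term containing \<open>eps 0\<close> carries a factor \<open>ci\<close>, so the
  sum over \<open>k\<close> is bounded in mean uniformly in \<open>n\<close> by the summability of
  \<open>c\<close>. Products \<open>eps 0 * U\<close> are bounded through their squares, as no
  independence is at hand.\<close>

lemma CX_negligible:
  assumes i: "i \<le> P + 1" and j: "j \<le> P + 1"
  shows "negligible_seq (\<lambda>n \<omega>. CX n i j \<omega> - C n i j \<omega>)"
proof -
  let ?e = "eps 0"
  let ?D = "\<lambda>n \<omega>. \<Sum>k=1..n. ci (int k - int i) * (?e \<omega> * U (int k - int j) \<omega>)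
    + ci (int k - int j) * (?e \<omega> * U (int k - int i) \<omega>) + ci (int k - int i) * ci (int k - int j) * (?e \<omega>)\<^sup>2"
  let ?E = "expectation (\<lambda>\<omega>. (?e \<omega>)\<^sup>2)"
  let ?K = "?E + K2"
  have E0: "?E \<ge> 0" by simp
  have K0: "?K \<ge> 0" using E0 order_trans[OF _ expectation_U2[of 0], of 0] by simp
  have eq: "CX n i j \<omega> - C n i j \<omega> = ?D n \<omega>" if w: "\<omega> \<in> space M" for n \<omega>
    unfolding CX_def C_def sum_subtractf[symmetric]
  proof (intro sum.cong refl)
    fix k assume k: "k \<in> {1..n}"
    have ki: "int k - int i \<ge> - int P" "int k - int j \<ge> - int P" using k i j by auto
    show "X (int k - int i) \<omega> * X (int k - int j) \<omega> - U (int k - int i) \<omega> * U (int k - int j) \<omega>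
      = ci (int k - int i) * (?e \<omega> * U (int k - int j) \<omega>) + ci (int k - int j) * (?e \<omega> * U (int k - int i) \<omega>)
        + ci (int k - int i) * ci (int k - int j) * (?e \<omega>)\<^sup>2"
      unfolding X_eq[OF ki(1) w] X_eq[OF ki(2) w] by (simp add: algebra_simps power2_eq_square)
  qed
  have ieU: "integrable M (\<lambda>\<omega>. ?e \<omega> * U k \<omega>)" for k
    by (rule integrable_product_of_squares) (auto intro: integrable_U2 integrable_eps)
  have EeU: "expectation (\<lambda>\<omega>. \<bar>?e \<omega> * U k \<omega>\<bar>) \<le> ?K" for k
    by (rule order_trans[OF expectation_product_le add_left_mono]) (auto intro: integrable_U2 integrable_eps expectation_U2)
  have iD: "integrable M (?D n)" for n
    by (intro Bochner_Integration.integrable_sum Bochner_Integration.integrable_add integrable_mult_right ieU integrable_eps)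
  have "negligible_seq ?D"
  proof (rule negligible_seq_L1[OF iD])
    fix n
    let ?B = "\<lambda>k \<omega>. \<bar>ci (int k - int i)\<bar> * \<bar>?e \<omega> * U (int k - int j) \<omega>\<bar>
      + \<bar>ci (int k - int j)\<bar> * \<bar>?e \<omega> * U (int k - int i) \<omega>\<bar> + \<bar>ci (int k - int i)\<bar> * cbound * (?e \<omega>)\<^sup>2"
    have iB: "integrable M (?B k)" for k
      by (intro Bochner_Integration.integrable_add integrable_mult_right integrable_abs ieU integrable_eps)
    have "expectation (\<lambda>\<omega>. \<bar>?D n \<omega>\<bar>) \<le> expectation (\<lambda>\<omega>. \<Sum>k=1..n. ?B k \<omega>)"
    proof (rule integral_mono)
      show "integrable M (\<lambda>\<omega>. \<bar>?D n \<omega>\<bar>)" using iD by simp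
      show "integrable M (\<lambda>\<omega>. \<Sum>k=1..n. ?B k \<omega>)" by (intro Bochner_Integration.integrable_sum iB)
      fix \<omega>
      show "\<bar>?D n \<omega>\<bar> \<le> (\<Sum>k=1..n. ?B k \<omega>)"
      proof (rule order_trans[OF sum_abs sum_mono])
        fix k
        have 3: "\<bar>ci (int k - int i) * ci (int k - int j) * (?e \<omega>)\<^sup>2\<bar> \<le> \<bar>ci (int k - int i)\<bar> * cbound * (?e \<omega>)\<^sup>2"
          unfolding abs_mult using ci_le[of "int k - int j"] by (intro mult_mono) auto
        show "\<bar>ci (int k - int i) * (?e \<omega> * U (int k - int j) \<omega>) + ci (int k - int j) * (?e \<omega> * U (int k - int i) \<omega>)
          + ci (int k - int i) * ci (int k - int j) * (?e \<omega>)\<^sup>2\<bar> \<le> ?B k \<omega>"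
          by (rule order_trans[OF abs_triangle_ineq add_mono[OF order_trans[OF abs_triangle_ineq add_mono] 3]])
            (simp_all add: abs_mult)
      qed
    qed
    also have "\<dots> = (\<Sum>k=1..n. expectation (?B k))" by (rule Bochner_Integration.integral_sum) (rule iB)
    also have "\<dots> = (\<Sum>k=1..n. \<bar>ci (int k - int i)\<bar> * expectation (\<lambda>\<omega>. \<bar>?e \<omega> * U (int k - int j) \<omega>\<bar>)
        + \<bar>ci (int k - int j)\<bar> * expectation (\<lambda>\<omega>. \<bar>?e \<omega> * U (int k - int i) \<omega>\<bar>) + \<bar>ci (int k - int i)\<bar> * cbound * ?E)"
    proof (intro sum.cong refl)
      fix k
      have m: "integrable M (\<lambda>\<omega>. x * \<bar>?e \<omega> * U m \<omega>\<bar>)" for m x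
        using ieU by (intro integrable_mult_right integrable_abs)
      have m3: "integrable M (\<lambda>\<omega>. x * (?e \<omega>)\<^sup>2)" for x
        using integrable_eps by (rule integrable_mult_right)
      show "expectation (?B k) = \<bar>ci (int k - int i)\<bar> * expectation (\<lambda>\<omega>. \<bar>?e \<omega> * U (int k - int j) \<omega>\<bar>)
        + \<bar>ci (int k - int j)\<bar> * expectation (\<lambda>\<omega>. \<bar>?e \<omega> * U (int k - int i) \<omega>\<bar>) + \<bar>ci (int k - int i)\<bar> * cbound * ?E"
        by (simp only: Bochner_Integration.integral_add[OF Bochner_Integration.integrable_add[OF m m] m3]
            Bochner_Integration.integral_add[OF m m] integral_mult_right_zero)
    qed
    also have "\<dots> \<le> (\<Sum>k=1..n. \<bar>ci (int k - int i)\<bar> * ?K + \<bar>ci (int k - int j)\<bar> * ?K + \<bar>ci (int k - int i)\<bar> * (cbound * ?E))"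
      by (intro sum_mono add_mono mult_left_mono EeU) (auto simp: mult.assoc)
    also have "\<dots> = (\<Sum>k=1..n. \<bar>ci (int k - int i)\<bar>) * ?K + (\<Sum>k=1..n. \<bar>ci (int k - int j)\<bar>) * ?K
        + (\<Sum>k=1..n. \<bar>ci (int k - int i)\<bar>) * (cbound * ?E)"
      by (simp only: sum.distrib sum_distrib_right)
    also have "\<dots> \<le> cbound * ?K + cbound * ?K + cbound * (cbound * ?E)"
      using K0 E0 cbound_ge(2) by (intro add_mono mult_right_mono sum_ci_le) (auto simp: inj_on_def)
    finally show "expectation (\<lambda>\<omega>. \<bar>?D n \<omega>\<bar>) \<le> cbound * ?K + cbound * ?K + cbound * (cbound * ?E)" .
  qed
  then show ?thesis
    unfolding negligible_seq_def by (rule to_zero_prob_cong[THEN iffD2, rotated]) (simp only: eq)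
qed

abbreviation ts :: "nat \<Rightarrow> real" where
  "ts j \<equiv> alpha \<theta> \<rho> * (bet j - gam * bet (P + 1 - j))"

definition G :: "nat \<Rightarrow> nat \<Rightarrow> 'a \<Rightarrow> real" where
  "G n d \<omega> = alpha \<theta> \<rho> * (N n d \<omega> - gam * N n (P + 1 - d) \<omega>)"

text \<open>Defined as the exact remainder, so that the normal equations hold as an identity; the
  term with \<open>S\<close> comes from the regularisation.\<close>

definition err :: "nat \<Rightarrow> 'p \<Rightarrow> 'a \<Rightarrow> real" where
  "err n i \<omega> = CX n 0 (idx i) \<omega> - (\<Sum>j=1..P. CX n (idx i) j \<omega> * ts j)
    - (S *v theta_star \<theta> \<rho>) $ i - G n (idx i) \<omega>"

text \<open>For covariances that depend only on the lag, \<open>yule_walker_reflect\<close> is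
  exact. The remainder therefore consists of the effect of \<open>eps 0\<close>, the deviation of
  \<open>C\<close> from Toeplitz form, the constant \<open>S *v theta_star\<close>, and the boundary
  terms of the Yule-Walker rows.\<close>

lemma err_negligible: "negligible_seq (\<lambda>n \<omega>. err n i \<omega>)"
proof -
  let ?d = "idx i"
  have d: "1 \<le> ?d" "?d \<le> P" by (rule idx_range)+
  define W where "W n d \<omega> = (\<Sum>l=0..P+1. a (int l) * C n 0 (lag d l) \<omega>)" for n d \<omega>
  have W: "negligible_seq (\<lambda>n \<omega>. W n d \<omega> - N n d \<omega>)" for d
    unfolding W_def by (rule yule_walker_negligible)
  have "negligible_seq (\<lambda>n \<omega>. (CX n 0 ?d \<omega> - C n 0 ?d \<omega>)
      - (\<Sum>j=1..P. ts j * ((CX n ?d j \<omega> - C n ?d j \<omega>) + (C n ?d j \<omega> - C n 0 (nat \<bar>int ?d - int j\<bar>) \<omega>)))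
      - (S *v theta_star \<theta> \<rho>) $ i
      + alpha \<theta> \<rho> * ((W n ?d \<omega> - N n ?d \<omega>) - gam * (W n (P + 1 - ?d) \<omega> - N n (P + 1 - ?d) \<omega>)))"
    (is "negligible_seq ?F")
    using d by (intro negligible_seq_add negligible_seq_diff negligible_seq_sum negligible_seq_cmult
        negligible_seq_const CX_negligible C_toeplitz_negligible W) auto
  moreover have "?F n \<omega> = err n i \<omega>" for n \<omega>
  proof -
    have yw: "C n 0 ?d \<omega> - (\<Sum>j=1..P. C n 0 (nat \<bar>int ?d - int j\<bar>) \<omega> * ts j)
        = alpha \<theta> \<rho> * (W n ?d \<omega> - gam * W n (P + 1 - ?d) \<omega>)"
      unfolding W_def by (rule yule_walker_reflect[OF d])
    have alg: "t * ((x - y) + (y - z)) = x * t - z * t" for t x y z :: real by (simp add: algebra_simps)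
    have s: "(\<Sum>j=1..P. ts j * ((CX n ?d j \<omega> - C n ?d j \<omega>) + (C n ?d j \<omega> - C n 0 (nat \<bar>int ?d - int j\<bar>) \<omega>)))
        = (\<Sum>j=1..P. CX n ?d j \<omega> * ts j) - (\<Sum>j=1..P. C n 0 (nat \<bar>int ?d - int j\<bar>) \<omega> * ts j)"
      unfolding sum_subtractf[symmetric] by (intro sum.cong refl) (rule alg)
    have A: "alpha \<theta> \<rho> * ((W n ?d \<omega> - N n ?d \<omega>) - gam * (W n (P + 1 - ?d) \<omega> - N n (P + 1 - ?d) \<omega>))
        = alpha \<theta> \<rho> * (W n ?d \<omega> - gam * W n (P + 1 - ?d) \<omega>) - G n ?d \<omega>"
      unfolding G_def right_diff_distrib by linarith
    show ?thesis unfolding s A err_def yw[symmetric] by linarith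
  qed
  ultimately show ?thesis by simp
qed

end

lemma norm_matrix_vector_le:
  fixes B :: "real^'n^'m"
  shows "norm (B *v y) \<le> (\<Sum>i\<in>UNIV. \<Sum>j\<in>UNIV. \<bar>B $ i $ j\<bar>) * norm y"
proof -
  have "norm (B *v y) \<le> (\<Sum>i\<in>UNIV. \<bar>(B *v y) $ i\<bar>)" by (rule norm_le_l1_cart)
  also have "\<dots> \<le> (\<Sum>i\<in>UNIV. \<Sum>j\<in>UNIV. \<bar>B $ i $ j\<bar> * norm y)"
  proof (rule sum_mono)
    fix i
    have "\<bar>(B *v y) $ i\<bar> \<le> (\<Sum>j\<in>UNIV. \<bar>B $ i $ j * y $ j\<bar>)"
      by (simp add: matrix_vector_mult_def sum_abs)
    also have "\<dots> \<le> (\<Sum>j\<in>UNIV. \<bar>B $ i $ j\<bar> * norm y)"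
      unfolding abs_mult by (intro sum_mono mult_left_mono component_le_norm_cart) simp
    finally show "\<bar>(B *v y) $ i\<bar> \<le> (\<Sum>j\<in>UNIV. \<bar>B $ i $ j\<bar> * norm y)" .
  qed
  finally show ?thesis by (simp only: sum_distrib_right)
qed

section \<open>The exchange matrix and the limiting covariance\<close>

context ar_coeffs begin

text \<open>The involution of the index type that \<open>exchange_mat\<close> represents.\<close>

definition flip :: "'p \<Rightarrow> 'p" where "flip i = (SOME j. idx j = P + 1 - idx i)"

lemma idx_flip: "idx (flip i) = P + 1 - idx i"
  unfolding flip_def by (rule someI_ex, rule ex_idx) (use idx_range[of i] in auto)

lemma flip_flip: "flip (flip i) = i"
  using idx_inject[of "flip (flip i)" i] idx_flip[of "flip i"] idx_flip[of i] idx_range[of i] by simp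

lemma exchange_mat_nth: "exchange_mat $ i $ j = (if j = flip i then 1 else 0)"
proof -
  have "idx i + idx j = P + 1 \<longleftrightarrow> idx j = idx (flip i)"
    unfolding idx_flip using idx_range[of i] by auto
  then show ?thesis by (simp add: exchange_mat_def idx_inject)
qed

lemma exchange_mat_left: "(exchange_mat ** A) $ i $ j = A $ flip i $ j"
  by (simp add: matrix_matrix_mult_def exchange_mat_nth if_distrib[of "\<lambda>x. x * _"] cong: if_cong)

lemma exchange_mat_right: "(A ** exchange_mat) $ i $ j = A $ i $ flip j"
proof -
  have "j = flip k \<longleftrightarrow> k = flip j" for k using flip_flip by metis
  then show ?thesis
    by (simp add: matrix_matrix_mult_def exchange_mat_nth if_distrib[of "\<lambda>x. _ * x"] cong: if_cong)
qed

definition KJ :: "real ^ 'p::{finite,linorder} ^ 'p::{finite,linorder}" where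
  "KJ = mat 1 - gam *\<^sub>R exchange_mat"

lemma KJ_sym: "transpose KJ = KJ"
proof -
  have "j = flip i \<longleftrightarrow> i = flip j" for i j using flip_flip by metis
  then show ?thesis
    by (auto simp: KJ_def vec_eq_iff transpose_def exchange_mat_nth mat_def)
qed

lemma KJ_left: "(KJ ** A) $ i $ j = A $ i $ j - gam * A $ flip i $ j"
proof -
  have "(KJ ** A) $ i $ j = (mat 1 ** A) $ i $ j - gam * (exchange_mat ** A) $ i $ j"
    unfolding KJ_def matrix_matrix_mult_def
    by (simp add: left_diff_distrib sum_subtractf sum_distrib_left mult.assoc)
  then show ?thesis by (simp add: exchange_mat_left)
qed

lemma KJ_right: "(A ** KJ) $ i $ j = A $ i $ j - gam * A $ i $ flip j"
proof -
  have "(A ** KJ) $ i $ j = (A ** mat 1) $ i $ j - gam * (A ** exchange_mat) $ i $ j"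
    unfolding KJ_def matrix_matrix_mult_def
    by (simp add: right_diff_distrib sum_subtractf sum_distrib_left mult.left_commute)
  then show ?thesis by (simp add: exchange_mat_right)
qed

lemma det_KJ: "det KJ \<noteq> 0"
proof (rule matrix_inv_eqI(2))
  \<comment> \<open>Since \<open>J\<close> squares to the identity, \<open>I - gam J\<close> times
    \<open>I + gam J\<close> is \<open>(1 - gam\<^sup>2) I\<close>, and \<alpha> normalises
    it.\<close>
  let ?B = "\<chi> i j. alpha \<theta> \<rho> * ((if j = i then 1 else 0) + gam * (if j = flip i then 1 else 0))"
  have "(KJ ** ?B) $ i $ j = mat 1 $ i $ j" for i j
  proof -
    have "(KJ ** ?B) $ i $ j = (alpha \<theta> \<rho> * (1 - gam\<^sup>2)) * (if j = i then 1 else 0)"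
      by (simp add: KJ_left flip_flip power2_eq_square algebra_simps)
    then show ?thesis unfolding alpha_gam by (simp add: mat_def eq_commute)
  qed
  then show "KJ ** ?B = mat 1" by (simp add: vec_eq_iff)
qed

text \<open>Reflecting both indices preserves their distance, so a symmetric Toeplitz matrix
  commutes with \<open>J\<close>.\<close>

lemma Delta_KJ: "Delta \<theta> \<rho> ** KJ = KJ ** Delta \<theta> \<rho>"
proof -
  have "lag (idx i) (P + 1 - idx j) = lag (P + 1 - idx i) (idx j)" for i j :: 'p
    using idx_range[of i] idx_range[of j] by (simp add: of_nat_diff)
  then show ?thesis
    by (simp add: vec_eq_iff KJ_left KJ_right Delta_nth idx_flip)
qed

abbreviation Di where "Di \<equiv> matrix_inv (Delta \<theta> \<rho>)"

lemma Delta_Di: "Delta \<theta> \<rho> ** Di = mat 1" "Di ** Delta \<theta> \<rho> = mat 1"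
  by (rule matrix_inv_mult[OF pos_def_det[OF Delta_pos_def]])+

lemma Di_KJ: "Di ** KJ = KJ ** Di"
proof -
  have "Di ** KJ = Di ** KJ ** (Delta \<theta> \<rho> ** Di)" by (simp add: Delta_Di)
  also have "\<dots> = Di ** (KJ ** Delta \<theta> \<rho>) ** Di" by (simp add: matrix_mul_assoc)
  also have "\<dots> = (Di ** Delta \<theta> \<rho>) ** KJ ** Di" by (simp only: Delta_KJ[symmetric] matrix_mul_assoc)
  finally show ?thesis by (simp add: Delta_Di)
qed

lemma Sigma_theta_eq: "Sigma_theta \<theta> \<rho> = (alpha \<theta> \<rho>)\<^sup>2 *\<^sub>R (KJ ** Di ** KJ)"
  by (simp add: Sigma_theta_def KJ_def gam_def)

lemma Sigma_theta_pos_def: "pos_def (Sigma_theta \<theta> \<rho>)"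
proof -
  have p: "pos_def (KJ ** Di ** KJ)"
    using pos_def_congruence[OF pos_def_inverse[OF Delta_pos_def] det_KJ] by (simp only: KJ_sym)
  have "alpha \<theta> \<rho> \<noteq> 0" using alpha_gam by auto
  then have a: "(alpha \<theta> \<rho>)\<^sup>2 > 0" by simp
  have t: "transpose (c *\<^sub>R A) = c *\<^sub>R transpose A" for c and A :: "real ^ 'p::{finite,linorder} ^ 'p::{finite,linorder}"
    by (simp add: vec_eq_iff transpose_def)
  show ?thesis
    using p a unfolding pos_def_def Sigma_theta_eq t by (simp flip: scaleR_matrix_vector_assoc)
qed

text \<open>With \<open>s\<close> the noise variance, \<open>w\<close> is the coefficient vector of
  \<open>N\<close> in \<open>u \<bullet> Z\<close> and the left side is the variance from
  \<open>N_clt\<close>. The two factors \<open>s\<close> cancel those in \<open>w\<close>, and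
  commuting \<open>KJ\<close> past \<Delta> and its inverse leaves one inverse between two copies of
  \<open>KJ\<close>.\<close>

lemma Sigma_theta_form:
  fixes u :: "real ^ 'p::{finite,linorder}"
  assumes s: "s \<noteq> 0"
  defines "w \<equiv> alpha \<theta> \<rho> *\<^sub>R (KJ *v (((1 / s) *\<^sub>R Di) *v u))"
  shows "s * (s * (w \<bullet> (Delta \<theta> \<rho> *v w))) = u \<bullet> (Sigma_theta \<theta> \<rho> *v u)"
proof -
  have w: "w = (alpha \<theta> \<rho> / s) *\<^sub>R ((KJ ** Di) *v u)"
    by (simp add: w_def matrix_vector_mul_assoc[symmetric] scaleR_matrix_vector_assoc[symmetric] matrix_vector_mult_scaleR)
  have "Delta \<theta> \<rho> ** (KJ ** Di) = KJ" by (simp add: matrix_mul_assoc Delta_KJ) (simp add: matrix_mul_assoc[symmetric] Delta_Di)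
  then have "Delta \<theta> \<rho> *v w = (alpha \<theta> \<rho> / s) *\<^sub>R (KJ *v u)"
    by (simp add: w matrix_vector_mult_scaleR matrix_vector_mul_assoc)
  then have "s * (s * (w \<bullet> (Delta \<theta> \<rho> *v w))) = (alpha \<theta> \<rho>)\<^sup>2 * (((KJ ** Di) *v u) \<bullet> (KJ *v u))"
    using s by (simp add: w power2_eq_square field_simps)
  also have "((KJ ** Di) *v u) \<bullet> (KJ *v u) = u \<bullet> ((KJ ** Di ** KJ) *v u)"
  proof -
    have "u \<bullet> ((KJ ** Di ** KJ) *v u) = u \<bullet> (KJ *v ((Di ** KJ) *v u))"
      by (simp add: matrix_vector_mul_assoc matrix_mul_assoc)
    also have "\<dots> = (KJ *v u) \<bullet> ((Di ** KJ) *v u)"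
      by (subst inner_matrix_transpose) (simp only: KJ_sym)
    finally show ?thesis by (simp only: Di_KJ inner_commute)
  qed
  finally show ?thesis by (simp add: Sigma_theta_eq flip: scaleR_matrix_vector_assoc)
qed

end

section \<open>Asymptotic normality of the estimator\<close>

context least_squares begin

text \<open>The inverse of the limit in probability of \<open>S_mat / n\<close>.\<close>

definition iA :: "real ^ 'p::{finite,linorder} ^ 'p::{finite,linorder}" where
  "iA = (1 / \<sigma>2) *\<^sub>R Di"

text \<open>The linearisation of \<open>Y\<close>: the random matrix is replaced by its limit and
  the remainder \<open>err\<close> is dropped.\<close>

definition Z :: "nat \<Rightarrow> 'a \<Rightarrow> real ^ 'p::{finite,linorder}" where
  "Z n \<omega> = iA *v (\<chi> i. G n (idx i) \<omega> / sqrt (real n))"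

definition Y :: "nat \<Rightarrow> 'a \<Rightarrow> real ^ 'p::{finite,linorder}" where
  "Y n \<omega> = sqrt (real n) *\<^sub>R (theta_hat X S n \<omega> - theta_star \<theta> \<rho>)"

lemma iA_Delta: "iA *v ((\<sigma>2 *\<^sub>R Delta \<theta> \<rho>) *v x) = x"
proof -
  have "iA ** (\<sigma>2 *\<^sub>R Delta \<theta> \<rho>) = mat 1"
    unfolding iA_def matrix_scalar_ac scalar_matrix_assoc[symmetric] Delta_Di using \<sigma>2_pos by simp
  then show ?thesis by (simp only: matrix_vector_mul_assoc matrix_vector_mul_lid)
qed

lemma iA_sym: "transpose iA = iA"
proof -
  have "transpose Di = Di" using pos_def_inverse[OF Delta_pos_def] by (simp add: pos_def_def)
  then have "Di $ j $ i = Di $ i $ j" for i j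
    unfolding transpose_def by (metis vec_lambda_beta)
  then show ?thesis by (simp add: iA_def vec_eq_iff transpose_def)
qed

lemma G_scaled:
  assumes d: "1 \<le> d" "d \<le> P"
  shows integrable_G: "integrable M (\<lambda>\<omega>. G n d \<omega> / sqrt (real n))"
    and expectation_G: "expectation (\<lambda>\<omega>. \<bar>G n d \<omega> / sqrt (real n)\<bar>)
      \<le> \<bar>alpha \<theta> \<rho>\<bar> * (sqrt (K2 * \<sigma>2) + \<bar>gam\<bar> * sqrt (K2 * \<sigma>2))"
proof -
  let ?N = "\<lambda>d \<omega>. N n d \<omega> / sqrt (real n)"
  have d': "1 \<le> P + 1 - d" using d by simp
  have eq: "G n d \<omega> / sqrt (real n) = alpha \<theta> \<rho> * (?N d \<omega> - gam * ?N (P + 1 - d) \<omega>)" for \<omega>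
    by (simp add: G_def right_diff_distrib diff_divide_distrib)
  show i: "integrable M (\<lambda>\<omega>. G n d \<omega> / sqrt (real n))"
    unfolding eq by (intro integrable_mult_right Bochner_Integration.integrable_diff integrable_N d(1) d')
  have iB: "integrable M (\<lambda>\<omega>. \<bar>alpha \<theta> \<rho>\<bar> * (\<bar>?N d \<omega>\<bar> + \<bar>gam\<bar> * \<bar>?N (P + 1 - d) \<omega>\<bar>))"
    by (intro integrable_mult_right Bochner_Integration.integrable_add integrable_abs integrable_N d(1) d')
  have "expectation (\<lambda>\<omega>. \<bar>G n d \<omega> / sqrt (real n)\<bar>)
      \<le> expectation (\<lambda>\<omega>. \<bar>alpha \<theta> \<rho>\<bar> * (\<bar>?N d \<omega>\<bar> + \<bar>gam\<bar> * \<bar>?N (P + 1 - d) \<omega>\<bar>))"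
  proof (rule integral_mono[OF integrable_abs[OF i] iB])
    fix \<omega>
    show "\<bar>G n d \<omega> / sqrt (real n)\<bar> \<le> \<bar>alpha \<theta> \<rho>\<bar> * (\<bar>?N d \<omega>\<bar> + \<bar>gam\<bar> * \<bar>?N (P + 1 - d) \<omega>\<bar>)"
      unfolding eq abs_mult[of "alpha \<theta> \<rho>"] abs_mult[of gam, symmetric]
      by (intro mult_left_mono abs_triangle_ineq4) simp
  qed
  also have "\<dots> = \<bar>alpha \<theta> \<rho>\<bar> * (expectation (\<lambda>\<omega>. \<bar>?N d \<omega>\<bar>) + \<bar>gam\<bar> * expectation (\<lambda>\<omega>. \<bar>?N (P + 1 - d) \<omega>\<bar>))"
    by (simp only: integral_mult_right_zero Bochner_Integration.integral_add[OF integrable_abs[OF integrable_N[OF d(1)]]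
        integrable_mult_right[OF integrable_abs[OF integrable_N[OF d']]]])
  also have "\<dots> \<le> \<bar>alpha \<theta> \<rho>\<bar> * (sqrt (K2 * \<sigma>2) + \<bar>gam\<bar> * sqrt (K2 * \<sigma>2))"
    by (intro mult_left_mono add_mono expectation_N d(1) d') auto
  finally show "expectation (\<lambda>\<omega>. \<bar>G n d \<omega> / sqrt (real n)\<bar>)
      \<le> \<bar>alpha \<theta> \<rho>\<bar> * (sqrt (K2 * \<sigma>2) + \<bar>gam\<bar> * sqrt (K2 * \<sigma>2))" .
qed

lemma measurable_Z [measurable]: "Z n \<in> borel_measurable M"
proof -
  have "(\<lambda>\<omega>. \<chi> i::'p. G n (idx i) \<omega> / sqrt (real n)) \<in> borel_measurable M"
    using integrable_G[OF idx_range] by (intro borel_measurable_vec_lambda) blast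
  then show ?thesis unfolding Z_def[abs_def] by (rule measurable_compose) measurable
qed

text \<open>Cramer-Wold: symmetry of \<open>iA\<close> moves it onto \<open>u\<close>, and
  reflecting the index in the \<open>gam\<close> part turns \<open>u \<bullet> Z n\<close> into a
  combination of the \<open>N n i\<close> alone, with coefficients \<open>w\<close>.\<close>

lemma char_Z:
  "(\<lambda>n. expectation (\<lambda>\<omega>. cis (u \<bullet> Z n \<omega>))) \<longlonglongrightarrow> of_real (exp (- (u \<bullet> (Sigma_theta \<theta> \<rho> *v u)) / 2))"
proof -
  define v where "v = iA *v u"
  define w where "w = alpha \<theta> \<rho> *\<^sub>R (KJ *v v)"
  have w_nth: "coord w d = alpha \<theta> \<rho> * (coord v d - gam * coord v (P + 1 - d))" if d: "1 \<le> d" "d \<le> P" for d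
  proof -
    obtain i :: 'p where i: "idx i = d" using ex_idx[OF d] by blast
    have "(exchange_mat *v v) $ i = v $ flip i"
      by (simp add: matrix_vector_mult_def exchange_mat_nth if_distrib[of "\<lambda>x. x * _"] cong: if_cong)
    then have "w $ i = alpha \<theta> \<rho> * (v $ i - gam * v $ flip i)"
      by (simp add: w_def KJ_def mat_1_minus_scale_mult)
    then show ?thesis using coord_idx[of w i] coord_idx[of v i] coord_idx[of v "flip i"] by (simp add: i idx_flip)
  qed
  have uZ: "u \<bullet> Z n \<omega> = (\<Sum>i=1..P. coord w i * (N n i \<omega> / sqrt (real n)))" for n \<omega>
  proof -
    let ?N = "\<lambda>d. N n d \<omega> / sqrt (real n)"
    have "u \<bullet> Z n \<omega> = v \<bullet> (\<chi> i. G n (idx i) \<omega> / sqrt (real n))"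
      unfolding Z_def v_def by (subst inner_matrix_transpose) (simp only: iA_sym)
    also have "\<dots> = (\<Sum>i::'p\<in>UNIV. coord v (idx i) * (G n (idx i) \<omega> / sqrt (real n)))"
      by (simp add: inner_vec_def coord_idx)
    also have "\<dots> = (\<Sum>d=1..P. coord v d * (G n d \<omega> / sqrt (real n)))" by (rule sum_idx)
    also have "\<dots> = (\<Sum>d=1..P. alpha \<theta> \<rho> * coord v d * ?N d) - (\<Sum>d=1..P. alpha \<theta> \<rho> * gam * coord v d * ?N (P + 1 - d))"
      unfolding sum_subtractf[symmetric] by (intro sum.cong refl) (simp add: G_def algebra_simps diff_divide_distrib)
    also have "(\<Sum>d=1..P. alpha \<theta> \<rho> * gam * coord v d * ?N (P + 1 - d)) = (\<Sum>d=1..P. alpha \<theta> \<rho> * gam * coord v (P + 1 - d) * ?N d)"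
      by (rule sum.reindex_bij_witness[where i="\<lambda>j. P + 1 - j" and j="\<lambda>j. P + 1 - j"]) auto
    also have "(\<Sum>d=1..P. alpha \<theta> \<rho> * coord v d * ?N d) - \<dots> = (\<Sum>i=1..P. coord w i * ?N i)"
      unfolding sum_subtractf[symmetric] by (intro sum.cong refl) (simp add: w_nth algebra_simps)
    finally show ?thesis .
  qed
  have form: "(\<Sum>i=1..P. \<Sum>j=1..P. coord w i * coord w j * lam (lag i j)) = w \<bullet> (Delta \<theta> \<rho> *v w)"
  proof -
    have "w \<bullet> (Delta \<theta> \<rho> *v w) = (\<Sum>i::'p\<in>UNIV. \<Sum>j::'p\<in>UNIV. coord w (idx i) * coord w (idx j) * lam (lag (idx i) (idx j)))"
      by (simp add: inner_vec_def matrix_vector_mult_def Delta_nth coord_idx sum_distrib_left mult_ac)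
    also have "\<dots> = (\<Sum>i::'p\<in>UNIV. \<Sum>j=1..P. coord w (idx i) * coord w j * lam (lag (idx i) j))"
      by (intro sum.cong refl) (rule sum_idx)
    also have "\<dots> = (\<Sum>i=1..P. \<Sum>j=1..P. coord w i * coord w j * lam (lag i j))"
      by (rule sum_idx)
    finally show ?thesis ..
  qed
  have q: "\<sigma>2 * (\<sigma>2 * (w \<bullet> (Delta \<theta> \<rho> *v w))) = u \<bullet> (Sigma_theta \<theta> \<rho> *v u)"
    unfolding w_def v_def iA_def by (rule Sigma_theta_form) (use \<sigma>2_pos in simp)
  from N_clt[of "coord w"] show ?thesis by (simp only: form q uZ)
qed

lemma theta_hat_equation:
  assumes n: "n \<ge> 1"
  shows "S_mat X S (n - 1) \<omega> *v (theta_hat X S n \<omega> - theta_star \<theta> \<rho>) = (\<chi> i. err n i \<omega> + G n (idx i) \<omega>)"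
    and S_mat_eq: "S_mat X S (n - 1) \<omega> $ i $ j = CX n (idx i) (idx j) \<omega> + S $ i $ j"
proof -
  let ?S = "S_mat X S (n - 1) \<omega>"
  have Snth: "?S $ i $ j = CX n (idx i) (idx j) \<omega> + S $ i $ j" for i j
  proof -
    \<comment> \<open>\<open>Phi X (k - 1)\<close> has entries \<open>X (k - idx i)\<close>, so the
      times 0 to n - 1 of the regressors become 1 to n in \<open>CX\<close>.\<close>
    have "(\<Sum>k=0..n - 1. Phi X k \<omega> $ i * Phi X k \<omega> $ j) = CX n (idx i) (idx j) \<omega>"
      unfolding CX_def
      by (rule sum.reindex_bij_witness[where i="\<lambda>k. k - 1" and j=Suc]) (use n in \<open>auto simp: Phi_def of_nat_diff algebra_simps\<close>)
    then show ?thesis by (simp add: S_mat_nth)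
  qed
  then show "?S $ i $ j = CX n (idx i) (idx j) \<omega> + S $ i $ j" .
  let ?T = "\<Sum>k=1..n. X (int k) \<omega> *\<^sub>R Phi X (k - 1) \<omega>"
  have hat: "?S *v theta_hat X S n \<omega> = ?T"
    unfolding theta_hat_def matrix_vector_mul_assoc
      matrix_inv_mult(1)[OF pos_def_det[OF S_mat_pos_def[OF S_pos]]] by simp
  have T: "?T $ i = CX n 0 (idx i) \<omega>" for i
  proof -
    have "?T $ i = (\<Sum>k=1..n. X (int k) \<omega> * X (int k - int (idx i)) \<omega>)"
      unfolding sum_component by (intro sum.cong refl) (simp add: Phi_def of_nat_diff)
    then show ?thesis by (simp add: CX_def)
  qed
  have star: "(?S *v theta_star \<theta> \<rho>) $ i = (\<Sum>j=1..P. CX n (idx i) j \<omega> * ts j) + (S *v theta_star \<theta> \<rho>) $ i" for i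
  proof -
    have "(?S *v theta_star \<theta> \<rho>) $ i = (\<Sum>j::'p\<in>UNIV. CX n (idx i) (idx j) \<omega> * ts (idx j)) + (S *v theta_star \<theta> \<rho>) $ i"
      unfolding matrix_vector_mult_def vec_lambda_beta Snth theta_star_nth distrib_right sum.distrib ..
    then show ?thesis by (simp only: sum_idx[of "\<lambda>j. CX n (idx i) j \<omega> * ts j"])
  qed
  show "?S *v (theta_hat X S n \<omega> - theta_star \<theta> \<rho>) = (\<chi> i. err n i \<omega> + G n (idx i) \<omega>)"
    unfolding matrix_vector_mult_diff_distrib hat vec_eq_iff vector_minus_component T star vec_lambda_beta err_def
    by simp
qed

text \<open>By Cramer's rule the entries of the estimator are quotients of determinants in the
  observations.\<close>

lemma measurable_Y: "Y n \<in> borel_measurable M"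
proof -
  have Phi: "(\<lambda>\<omega>. Phi X k \<omega> $ i) \<in> borel_measurable M" for k and i :: 'p
    using measurable_X[of "int k + 1 - int (idx i)"] idx_range[of i] by (simp add: Phi_def)
  have S: "(\<lambda>\<omega>. S_mat X S k \<omega> $ i $ j) \<in> borel_measurable M" for k i j
    unfolding S_mat_nth by (intro borel_measurable_add borel_measurable_sum borel_measurable_times Phi borel_measurable_const)
  define b where "b \<omega> = (\<Sum>k=1..n. X (int k) \<omega> *\<^sub>R (Phi X (k - 1) \<omega> :: real ^ 'p::{finite,linorder}))" for \<omega>
  have b: "(\<lambda>\<omega>. b \<omega> $ i) \<in> borel_measurable M" for i
    unfolding b_def sum_component vector_scaleR_component real_scaleR_def
    by (intro borel_measurable_sum borel_measurable_times Phi measurable_X) auto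
  let ?S = "S_mat X S (n - 1)"
  have d: "det (?S \<omega>) \<noteq> 0" for \<omega> by (rule pos_def_det[OF S_mat_pos_def[OF S_pos]])
  have "?S \<omega> *v theta_hat X S n \<omega> = b \<omega>" for \<omega>
    unfolding theta_hat_def matrix_vector_mul_assoc matrix_inv_mult(1)[OF d] b_def by simp
  then have th: "theta_hat X S n \<omega> = (\<chi> k. det (\<chi> i j. if j = k then b \<omega> $ i else ?S \<omega> $ i $ j) / det (?S \<omega>))" for \<omega>
    using cramer[OF d] by blast
  have m: "(\<lambda>\<omega>. if j = k then b \<omega> $ i else ?S \<omega> $ i $ j) \<in> borel_measurable M" for i j k
    using b S by (cases "j = k") auto
  have "(\<lambda>\<omega>. theta_hat X S n \<omega>) \<in> borel_measurable M"
    unfolding th using m S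
    by (intro borel_measurable_vec_lambda borel_measurable_divide borel_measurable_det) (simp_all only: vec_lambda_beta)
  then show ?thesis unfolding Y_def[abs_def]
    by (intro borel_measurable_scaleR borel_measurable_diff borel_measurable_const)
qed

lemma expectation_norm_Z: "\<exists>K. \<forall>n. integrable M (\<lambda>\<omega>. norm (Z n \<omega>)) \<and> expectation (\<lambda>\<omega>. norm (Z n \<omega>)) \<le> K"
proof -
  obtain \<kappa> where \<kappa>: "\<kappa> > 0" "\<And>x. norm (iA *v x) \<le> norm x * \<kappa>"
    using bounded_linear.pos_bounded[OF matrix_vector_mul_bounded_linear[of iA]] by blast
  define H where "H n \<omega> = (\<Sum>i\<in>UNIV. \<bar>G n (idx (i::'p)) \<omega> / sqrt (real n)\<bar>) * \<kappa>" for n \<omega>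
  let ?KG = "\<bar>alpha \<theta> \<rho>\<bar> * (sqrt (K2 * \<sigma>2) + \<bar>gam\<bar> * sqrt (K2 * \<sigma>2))"
  have iG: "integrable M (\<lambda>\<omega>. \<bar>G n (idx (i::'p)) \<omega> / sqrt (real n)\<bar>)" for n i
    by (intro integrable_abs integrable_G idx_range)
  have iH: "integrable M (H n)" for n
    unfolding H_def[abs_def] by (intro integrable_mult_left Bochner_Integration.integrable_sum iG)
  have EH: "expectation (H n) \<le> (\<Sum>i\<in>(UNIV::'p set). ?KG) * \<kappa>" for n
  proof -
    have "expectation (H n) = (\<Sum>i\<in>UNIV. expectation (\<lambda>\<omega>. \<bar>G n (idx (i::'p)) \<omega> / sqrt (real n)\<bar>)) * \<kappa>"
      unfolding H_def[abs_def] by (subst integral_mult_left_zero, subst Bochner_Integration.integral_sum) (simp_all only: iG)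
    also have "\<dots> \<le> (\<Sum>i\<in>(UNIV::'p set). ?KG) * \<kappa>"
      using \<kappa>(1) by (intro mult_right_mono sum_mono expectation_G idx_range) auto
    finally show ?thesis .
  qed
  have ZH: "norm (Z n \<omega>) \<le> H n \<omega>" for n \<omega>
  proof -
    have "norm (Z n \<omega>) \<le> norm (\<chi> i::'p. G n (idx i) \<omega> / sqrt (real n)) * \<kappa>"
      unfolding Z_def by (rule \<kappa>(2))
    also have "\<dots> \<le> (\<Sum>i\<in>UNIV. \<bar>(\<chi> i::'p. G n (idx i) \<omega> / sqrt (real n)) $ i\<bar>) * \<kappa>"
      using \<kappa>(1) by (intro mult_right_mono norm_le_l1_cart) simp
    finally show ?thesis by (simp add: H_def)
  qed
  have iZ: "integrable M (\<lambda>\<omega>. norm (Z n \<omega>))" for n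
    by (rule Bochner_Integration.integrable_bound[OF iH])
      (auto intro!: AE_I2 order_trans[OF ZH abs_ge_self] borel_measurable_norm measurable_Z)
  have "expectation (\<lambda>\<omega>. norm (Z n \<omega>)) \<le> (\<Sum>i\<in>(UNIV::'p set). ?KG) * \<kappa>" for n
    by (rule order_trans[OF integral_mono[OF iZ iH ZH] EH])
  with iZ show ?thesis by blast
qed

text \<open>The normal equations, divided by n, give
  \<open>An *v Y = err / sqrt n + G / sqrt n\<close>, so \<open>Y - Z\<close> is bounded by the
  error \<open>E\<close> plus \<open>\<delta> * norm Y\<close>, where \<delta> measures the distance
  of \<open>An\<close> from its limit. If 2 \<delta> \<le> 1, half of \<open>norm (Y - Z)\<close> is
  absorbed on the left and only \<open>norm Z\<close>, bounded in mean, remains; otherwise the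
  truncated value of 2 \<delta> is already 1. No convergence of inverse matrices enters.\<close>

lemma Y_minus_Z: "to_zero_prob M (\<lambda>n \<omega>. norm (Y n \<omega> - Z n \<omega>))"
proof -
  let ?A = "\<sigma>2 *\<^sub>R Delta \<theta> \<rho>"
  obtain \<kappa> where \<kappa>: "\<kappa> > 0" "\<And>x. norm (iA *v x) \<le> norm x * \<kappa>"
    using bounded_linear.pos_bounded[OF matrix_vector_mul_bounded_linear[of iA]] by blast
  define E where "E n \<omega> = \<kappa> * (\<Sum>i\<in>UNIV. \<bar>err n i \<omega> / sqrt (real n)\<bar>)" for n \<omega>
  define \<delta> where "\<delta> n \<omega> = \<kappa> * (\<Sum>i\<in>UNIV. \<Sum>j\<in>UNIV. \<bar>(CX n (idx i) (idx j) \<omega> + S $ i $ j) / real n - ?A $ i $ j\<bar>)" for n \<omega>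
  have abs0: "to_zero_prob M (\<lambda>n \<omega>. \<bar>f n \<omega>\<bar>)" if f: "to_zero_prob M f" for f
  proof (rule to_zero_prob_mono[OF f])
    show "(\<lambda>\<omega>. \<bar>f n \<omega>\<bar>) \<in> borel_measurable M" for n
      using f by (intro borel_measurable_abs) (simp add: to_zero_prob_def)
  qed simp
  have E0: "to_zero_prob M E"
    unfolding E_def using err_negligible
    by (intro to_zero_prob_cmult to_zero_prob_sum abs0) (simp add: negligible_seq_def)
  have \<delta>0: "to_zero_prob M \<delta>"
    unfolding \<delta>_def
  proof (intro to_zero_prob_cmult to_zero_prob_sum abs0)
    fix i j :: 'p
    have r: "idx i \<le> P + 1" "idx j \<le> P + 1" using idx_range[of i] idx_range[of j] by auto
    have "to_zero_prob M (\<lambda>n \<omega>. ((CX n (idx i) (idx j) \<omega> - C n (idx i) (idx j) \<omega>) + S $ i $ j) / real n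
      + (C n (idx i) (idx j) \<omega> / real n - \<sigma>2 * lam (lag (idx i) (idx j))))"
      by (intro to_zero_prob_add C_tendsto r negligible_seq_zero_prob negligible_seq_add CX_negligible negligible_seq_const)
    moreover have "((CX n (idx i) (idx j) \<omega> - C n (idx i) (idx j) \<omega>) + S $ i $ j) / real n
        + (C n (idx i) (idx j) \<omega> / real n - \<sigma>2 * lam (lag (idx i) (idx j)))
      = (CX n (idx i) (idx j) \<omega> + S $ i $ j) / real n - ?A $ i $ j" for n \<omega>
      by (simp add: Delta_nth diff_divide_distrib add_divide_distrib)
    ultimately show "to_zero_prob M (\<lambda>n \<omega>. (CX n (idx i) (idx j) \<omega> + S $ i $ j) / real n - ?A $ i $ j)"
      by (simp only:)
  qed
  obtain K where iZ: "\<And>n. integrable M (\<lambda>\<omega>. norm (Z n \<omega>))" and EZ: "\<And>n. expectation (\<lambda>\<omega>. \<bar>norm (Z n \<omega>)\<bar>) \<le> K"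
    using expectation_norm_Z unfolding abs_norm_cancel by blast
  have main: "norm (Y n \<omega> - Z n \<omega>) \<le> E n \<omega> + \<delta> n \<omega> * norm (Y n \<omega>)" if n: "n \<ge> 1" for n \<omega>
  proof -
    define An where "An = (1 / real n) *\<^sub>R S_mat X S (n - 1) \<omega>"
    have "An *v Y n \<omega> = (1 / real n * sqrt (real n)) *\<^sub>R (\<chi> i. err n i \<omega> + G n (idx i) \<omega>)"
      unfolding An_def Y_def scaleR_matrix_vector_assoc[symmetric] matrix_vector_mult_scaleR theta_hat_equation(1)[OF n]
      by simp
    also have "1 / real n * sqrt (real n) = 1 / sqrt (real n)"
      using n by (simp add: field_simps)
    also have "(1 / sqrt (real n)) *\<^sub>R (\<chi> i. err n i \<omega> + G n (idx i) \<omega>)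
        = (\<chi> i. err n i \<omega> / sqrt (real n)) + (\<chi> i. G n (idx i) \<omega> / sqrt (real n))"
      by (simp add: vec_eq_iff add_divide_distrib)
    finally have AnY: "An *v Y n \<omega> = (\<chi> i. err n i \<omega> / sqrt (real n)) + (\<chi> i. G n (idx i) \<omega> / sqrt (real n))" .
    have "Y n \<omega> = iA *v (An *v Y n \<omega> - (An - ?A) *v Y n \<omega>)"
      by (simp only: matrix_vector_mult_diff_rdistrib diff_diff_eq2 add_diff_cancel_left' iA_Delta)
    also have "\<dots> = iA *v (\<chi> i. err n i \<omega> / sqrt (real n)) + Z n \<omega> - iA *v ((An - ?A) *v Y n \<omega>)"
      by (simp only: AnY Z_def matrix_vector_mult_diff_distrib matrix_vector_right_distrib)
    finally have "Y n \<omega> - Z n \<omega> = iA *v (\<chi> i. err n i \<omega> / sqrt (real n)) - iA *v ((An - ?A) *v Y n \<omega>)"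
      by (simp add: algebra_simps)
    then have "norm (Y n \<omega> - Z n \<omega>) \<le> norm (iA *v (\<chi> i. err n i \<omega> / sqrt (real n))) + norm (iA *v ((An - ?A) *v Y n \<omega>))"
      by (simp only: norm_triangle_ineq4)
    also have "norm (iA *v (\<chi> i. err n i \<omega> / sqrt (real n))) \<le> E n \<omega>"
    proof -
      have "norm (iA *v (\<chi> i. err n i \<omega> / sqrt (real n))) \<le> norm (\<chi> i. err n i \<omega> / sqrt (real n)) * \<kappa>" by (rule \<kappa>(2))
      also have "\<dots> \<le> (\<Sum>i\<in>UNIV. \<bar>(\<chi> i. err n i \<omega> / sqrt (real n)) $ i\<bar>) * \<kappa>"
        using \<kappa>(1) by (intro mult_right_mono norm_le_l1_cart) simp
      finally show ?thesis by (simp add: E_def mult.commute)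
    qed
    also have "norm (iA *v ((An - ?A) *v Y n \<omega>)) \<le> \<delta> n \<omega> * norm (Y n \<omega>)"
    proof -
      have "norm (iA *v ((An - ?A) *v Y n \<omega>)) \<le> norm ((An - ?A) *v Y n \<omega>) * \<kappa>" by (rule \<kappa>(2))
      also have "\<dots> \<le> ((\<Sum>i\<in>UNIV. \<Sum>j\<in>UNIV. \<bar>(An - ?A) $ i $ j\<bar>) * norm (Y n \<omega>)) * \<kappa>"
        using \<kappa>(1) by (intro mult_right_mono norm_matrix_vector_le) simp
      also have "(\<Sum>i\<in>UNIV. \<Sum>j\<in>UNIV. \<bar>(An - ?A) $ i $ j\<bar>)
          = (\<Sum>i\<in>UNIV. \<Sum>j\<in>UNIV. \<bar>(CX n (idx i) (idx j) \<omega> + S $ i $ j) / real n - ?A $ i $ j\<bar>)"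
        unfolding An_def vector_minus_component vector_scaleR_component[of "1 / real n"] S_mat_eq[OF n] by simp
      finally show ?thesis by (simp add: \<delta>_def mult_ac)
    qed
    finally show ?thesis by simp
  qed
  have \<delta>_nonneg: "\<delta> n \<omega> \<ge> 0" for n \<omega>
    unfolding \<delta>_def using \<kappa>(1) by (intro mult_nonneg_nonneg sum_nonneg) auto
  let ?F = "\<lambda>n \<omega>. 2 * E n \<omega> + 2 * (\<delta> n \<omega> * norm (Z n \<omega>))"
  have F0: "to_zero_prob M ?F"
    by (intro to_zero_prob_add to_zero_prob_cmult E0 to_zero_prob_mult_bounded[OF \<delta>0 iZ EZ])
  have D0: "to_zero_prob M (\<lambda>n \<omega>. 2 * \<delta> n \<omega>)" by (rule to_zero_prob_cmult[OF \<delta>0])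
  have Fm: "?F n \<in> borel_measurable M" and Dm: "(\<lambda>\<omega>. 2 * \<delta> n \<omega>) \<in> borel_measurable M" for n
    using F0 D0 by (simp_all only: to_zero_prob_def)
  show ?thesis
  proof (rule to_zero_prob_bound[where Z="\<lambda>n \<omega>. min 1 \<bar>?F n \<omega>\<bar> + min 1 \<bar>2 * \<delta> n \<omega>\<bar>"])
    show "(\<lambda>\<omega>. norm (Y n \<omega> - Z n \<omega>)) \<in> borel_measurable M" for n
      using measurable_Y[of n] measurable_Z[of n] by measurable
    show "integrable M (\<lambda>\<omega>. min 1 \<bar>?F n \<omega>\<bar> + min 1 \<bar>2 * \<delta> n \<omega>\<bar>)" for n
      by (intro Bochner_Integration.integrable_add integrable_min_one Fm Dm)
    have "(\<lambda>n. expectation (\<lambda>\<omega>. min 1 \<bar>?F n \<omega>\<bar>) + expectation (\<lambda>\<omega>. min 1 \<bar>2 * \<delta> n \<omega>\<bar>)) \<longlonglongrightarrow> 0 + 0"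
      using F0 D0 by (intro tendsto_add) (simp_all only: to_zero_prob_def)
    then show "(\<lambda>n. expectation (\<lambda>\<omega>. min 1 \<bar>?F n \<omega>\<bar> + min 1 \<bar>2 * \<delta> n \<omega>\<bar>)) \<longlonglongrightarrow> 0"
      by (simp only: Bochner_Integration.integral_add[OF integrable_min_one[OF Fm] integrable_min_one[OF Dm]] add_0)
    show "min 1 \<bar>norm (Y n \<omega> - Z n \<omega>)\<bar> \<le> min 1 \<bar>?F n \<omega>\<bar> + min 1 \<bar>2 * \<delta> n \<omega>\<bar>" for n \<omega>
    proof (cases "n = 0")
      case True
      \<comment> \<open>At \<open>n = 0\<close> the factor \<open>sqrt 0\<close> kills
        \<open>Y\<close>, and division by 0 kills \<open>Z\<close>.\<close>
      then have "Y n \<omega> - Z n \<omega> = 0"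
        by (simp add: Y_def Z_def zero_vec_def[symmetric])
      then show ?thesis by simp
    next
      case False
      let ?D = "norm (Y n \<omega> - Z n \<omega>)"
      show ?thesis
      proof (cases "2 * \<delta> n \<omega> \<le> 1")
        case True
        have "norm (Y n \<omega>) \<le> ?D + norm (Z n \<omega>)"
          using norm_triangle_ineq[of "Y n \<omega> - Z n \<omega>" "Z n \<omega>"] by simp
        then have "\<delta> n \<omega> * norm (Y n \<omega>) \<le> \<delta> n \<omega> * (?D + norm (Z n \<omega>))"
          using \<delta>_nonneg by (rule mult_left_mono)
        moreover have "\<delta> n \<omega> * ?D \<le> (1 / 2) * ?D" using True by (intro mult_right_mono) auto
        ultimately have "?D \<le> ?F n \<omega>" using main[of n \<omega>] False by (simp add: distrib_left)
        then have "min 1 \<bar>?D\<bar> \<le> min 1 \<bar>?F n \<omega>\<bar>" by (intro min.mono) auto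
        moreover have "0 \<le> min 1 \<bar>2 * \<delta> n \<omega>\<bar>" by simp
        ultimately show ?thesis by linarith
      next
        case False
        then have "min 1 \<bar>2 * \<delta> n \<omega>\<bar> = 1" by simp
        moreover have "0 \<le> min 1 \<bar>?F n \<omega>\<bar>" by simp
        moreover have "min 1 \<bar>?D\<bar> \<le> 1" by simp
        ultimately show ?thesis by linarith
      qed
    qed
  qed
qed

text \<open>If \<open>norm Y\<close> exceeds \<open>r + 1\<close>, then \<open>norm Z\<close> is at
  least \<open>r\<close> or \<open>Y\<close> is farther than 1 from \<open>Z\<close>. Markov bounds
  the first event, \<open>Y_minus_Z\<close> the second.\<close>

lemma Y_tight:
  assumes e: "e > 0"
  shows "\<exists>R. eventually (\<lambda>n. prob {\<omega>\<in>space M. norm (Y n \<omega>) > R} < e) sequentially"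
proof -
  obtain K where K: "\<And>n. integrable M (\<lambda>\<omega>. norm (Z n \<omega>))" "\<And>n. expectation (\<lambda>\<omega>. norm (Z n \<omega>)) \<le> K"
    using expectation_norm_Z by blast
  have K0: "K \<ge> 0" by (rule order_trans[OF _ K(2)[of 0]]) simp
  \<comment> \<open>Makes \<open>K / r\<close> smaller than \<open>e / 2\<close>; the added 1 keeps
    \<open>r\<close> positive when \<open>K = 0\<close>.\<close>
  define r where "r = 2 * (K + 1) / e"
  have r: "r > 0" using K0 e by (simp add: r_def)
  have Kr: "K / r < e / 2"
    using r e K0 by (simp add: r_def field_simps)
  note [measurable] = measurable_Y measurable_Z
  have D: "eventually (\<lambda>n. prob {\<omega>\<in>space M. \<bar>norm (Y n \<omega> - Z n \<omega>)\<bar> > 1} < e / 2) sequentially"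
    by (rule order_tendstoD(2)[OF to_zero_prob_tail[OF Y_minus_Z]]) (use e in auto)
  have "eventually (\<lambda>n. prob {\<omega>\<in>space M. norm (Y n \<omega>) > r + 1} < e) sequentially"
    using D
  proof eventually_elim
    case (elim n)
    have "prob {\<omega>\<in>space M. norm (Z n \<omega>) \<ge> r} \<le> expectation (\<lambda>\<omega>. norm (Z n \<omega>)) / r"
      by (rule integral_Markov_inequality_measure[where A="space M"]) (use K(1) r in auto)
    also have "\<dots> \<le> K / r" using K(2) r by (intro divide_right_mono) auto
    finally have Z: "prob {\<omega>\<in>space M. norm (Z n \<omega>) \<ge> r} < e / 2" using Kr by linarith
    have "{\<omega>\<in>space M. norm (Y n \<omega>) > r + 1}
      \<subseteq> {\<omega>\<in>space M. norm (Z n \<omega>) \<ge> r} \<union> {\<omega>\<in>space M. \<bar>norm (Y n \<omega> - Z n \<omega>)\<bar> > 1}"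
    proof safe
      fix \<omega> assume "norm (Y n \<omega>) > r + 1" "\<not> \<bar>norm (Y n \<omega> - Z n \<omega>)\<bar> > 1"
      then show "norm (Z n \<omega>) \<ge> r"
        using norm_triangle_ineq[of "Y n \<omega> - Z n \<omega>" "Z n \<omega>"] by simp
    qed
    then have "prob {\<omega>\<in>space M. norm (Y n \<omega>) > r + 1}
      \<le> prob ({\<omega>\<in>space M. norm (Z n \<omega>) \<ge> r} \<union> {\<omega>\<in>space M. \<bar>norm (Y n \<omega> - Z n \<omega>)\<bar> > 1})"
      by (rule finite_measure_mono) measurable
    also have "\<dots> \<le> prob {\<omega>\<in>space M. norm (Z n \<omega>) \<ge> r} + prob {\<omega>\<in>space M. \<bar>norm (Y n \<omega> - Z n \<omega>)\<bar> > 1}"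
      by (rule measure_Un_le) measurable
    finally show ?case using Z elim by linarith
  qed
  then show ?thesis by blast
qed

lemma char_Y:
  "(\<lambda>n. expectation (\<lambda>\<omega>. cis (u \<bullet> Y n \<omega>))) \<longlonglongrightarrow> of_real (exp (- (u \<bullet> (Sigma_theta \<theta> \<rho> *v u)) / 2))"
proof (rule char_tendsto_of_to_zero_prob[OF _ _ _ char_Z])
  note [measurable] = measurable_Y measurable_Z
  show "(\<lambda>\<omega>. u \<bullet> Y n \<omega>) \<in> borel_measurable M" "(\<lambda>\<omega>. u \<bullet> Z n \<omega>) \<in> borel_measurable M" for n
    by measurable
  show "to_zero_prob M (\<lambda>n \<omega>. u \<bullet> Y n \<omega> - u \<bullet> Z n \<omega>)"
  proof (rule to_zero_prob_mono[OF to_zero_prob_cmult[OF Y_minus_Z, of "norm u"]])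
    show "(\<lambda>\<omega>. u \<bullet> Y n \<omega> - u \<bullet> Z n \<omega>) \<in> borel_measurable M" for n by measurable
    show "\<bar>u \<bullet> Y n \<omega> - u \<bullet> Z n \<omega>\<bar> \<le> \<bar>norm u * norm (Y n \<omega> - Z n \<omega>)\<bar>" for n \<omega>
      using Cauchy_Schwarz_ineq2[of u "Y n \<omega> - Z n \<omega>"] by (simp add: inner_diff_right)
  qed
qed

theorem Y_converges: "converges_in_distribution M Y (mvn 0 (Sigma_theta \<theta> \<rho>))"
  unfolding converges_in_distribution_def
proof (intro conjI allI impI)
  show "Y n \<in> borel_measurable M" for n by (rule measurable_Y)
  show N: "prob_space (mvn 0 (Sigma_theta \<theta> \<rho>))" by (rule prob_space_mvn[OF Sigma_theta_pos_def])
  show s: "sets (mvn 0 (Sigma_theta \<theta> \<rho>)) = sets borel" by (simp add: mvn_def)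
  fix f :: "real ^ 'p::{finite,linorder} \<Rightarrow> real"
  assume f: "continuous_on UNIV f \<and> bounded (range f)"
  show "(\<lambda>n. \<integral>\<omega>. f (Y n \<omega>) \<partial>M) \<longlonglongrightarrow> (\<integral>x. f x \<partial>mvn 0 (Sigma_theta \<theta> \<rho>))"
    by (rule levy_continuity_tight[OF prob_space_axioms N s measurable_Y _ Y_tight])
      (use f char_Y in \<open>simp_all add: char_mvn[OF Sigma_theta_pos_def]\<close>)
qed

end

theorem theorem2p2:
  fixes M :: "'a measure"
    and \<theta> :: "real ^ 'p::{finite,linorder}"
    and \<rho> \<sigma> :: real
    and X :: "int \<Rightarrow> 'a \<Rightarrow> real"
    and \<epsilon> V :: "nat \<Rightarrow> 'a \<Rightarrow> real"
    and S :: "real ^ 'p::{finite,linorder} ^ 'p::{finite,linorder}"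
  assumes "prob_space M"
    and "\<theta> \<noteq> 0"
    and "(\<Sum>i\<in>UNIV. \<bar>\<theta> $ i\<bar>) < 1"
    and "\<bar>\<rho>\<bar> < 1"
    and "\<And>n \<omega>. n \<ge> 1 \<Longrightarrow> \<omega> \<in> space M \<Longrightarrow>
           X (int n) \<omega> = (\<Sum>i\<in>UNIV. \<theta> $ i * X (int n - int (idx i)) \<omega>) + \<epsilon> n \<omega>"
    and "\<And>n \<omega>. n \<ge> 1 \<Longrightarrow> \<omega> \<in> space M \<Longrightarrow> \<epsilon> n \<omega> = \<rho> * \<epsilon> (n - 1) \<omega> + V n \<omega>"
    and "\<And>\<omega>. \<omega> \<in> space M \<Longrightarrow> X 0 \<omega> = \<epsilon> 0 \<omega>"
    and "\<And>k \<omega>. k \<in> {1..CARD('p)} \<Longrightarrow> \<omega> \<in> space M \<Longrightarrow> X (- int k) \<omega> = 0"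
    and "\<epsilon> 0 \<in> borel_measurable M"
    and "integrable M (\<lambda>\<omega>. (\<epsilon> 0 \<omega>)\<^sup>2)"
    and "prob_space.indep_vars M (\<lambda>_. borel) V {1..}"
    and "\<And>n. n \<ge> 1 \<Longrightarrow> distr M borel (V n) = distr M borel (V 1)"
    and "\<And>n. n \<ge> 1 \<Longrightarrow> integrable M (\<lambda>\<omega>. (V n \<omega>)\<^sup>2)"
    and "\<And>n. n \<ge> 1 \<Longrightarrow> prob_space.expectation M (V n) = 0"
    and "\<And>n. n \<ge> 1 \<Longrightarrow> prob_space.variance M (V n) = \<sigma>\<^sup>2"
    and "\<sigma>\<^sup>2 > 0"
    and "\<And>n. n \<ge> 1 \<Longrightarrow> integrable M (\<lambda>\<omega>. (V n \<omega>) ^ 4)"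
    and "pos_def S"
  shows "converges_in_distribution M
           (\<lambda>n \<omega>. sqrt (real n) *\<^sub>R (theta_hat X S n \<omega> - theta_star \<theta> \<rho>))
           (mvn 0 (Sigma_theta \<theta> \<rho>))"
proof -
  interpret prob_space M by fact
  have sq: "expectation (\<lambda>\<omega>. (V n \<omega>)\<^sup>2) = \<sigma>\<^sup>2" if "n \<ge> 1" for n
    using assms(14)[OF that] assms(15)[OF that] by simp
  interpret least_squares M V "\<sigma>\<^sup>2" \<theta> \<rho> "CARD('p)" X \<epsilon> S
    by unfold_locales (fact refl assms sq)+
  show ?thesis using Y_converges unfolding Y_def[abs_def] .
qed

end
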